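(* Let $3\le p\le t+1$ and $n\ge 1$ be integers. Let $d^*\in\Omega_{t+1,n,p}$ be a totally balanced test-control incomplete crossover design such that $r_{d^*0}$ minimizes the function $$f(r)=\frac{t(t-1)^2p}{x_1(r)}+\frac{tp}{y_1(r)}$$ over $r\in R$. Then $d^*$ is simultaneously A-optimal and MV-optimal in $\Lambda_{t+1,n,p}$.
   Context: Designs. $\Omega_{t+1,n,p}$ is the set of all crossover designs, i.e. maps $d:\{1,\dots,p\}\times\{1,\dots,n\}\to\{0,1,\dots,t\}$, where $d(k,u)$ is the treatment assigned to unit $u$ in period $k$; $0$ is the control treatment and $1,\dots,t$ are the test treatments. Counts. $n_{diu}$ = number of times treatment $i$ is assigned to unit $u$; $\tilde n_{diu}$ = the same count restricted to the first $p-1$ periods; $l_{dik}$ = number of units receiving treatment $i$ in period $k$; $m_{dij}$ = number of times treatment $i$ is immediately preceded (in the same unit) by treatment $j$; $r_{di}=\sum_u n_{diu}$; $\tilde r_{di}=\sum_u\tilde n_{diu}$. $[\cdot]$ denotes the integer part. Class $\Lambda_{t+1,n,p}$: all $d\in\Omega_{t+1,n,p}$ with $l_{d0k}=r_{d0}/p$ for $k=1,\dots,p$ and $m_{dii}=0$ for $0\le i\le t$. For such $d$, $\tilde r_{d0}=\frac{p-1}{p}r_{d0}$. Model. $Y_{dku}=\mu+\alpha_k+\beta_u+\tau_{d(k,u)}+\rho_{d(k-1,u)}+e_{ku}$, with $\rho_{d(0,u)}=0$ and $e_{ku}$ independent $N(0,\sigma^2)$. In matrix form (observations ordered unit by unit)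 $Y_d=\mu 1+P\alpha+U\beta+T_d\tau+F_d\rho+e$, where $P=1_n\otimes I_p$, $U=I_n\otimes 1_p$ ($1_m$ the all-ones vector of length $m$), $T_d=(T_{d1}',\dots,T_{dn}')'$ with $T_{du}$ the $p\times(t+1)$ period-treatment incidence matrix of unit $u$ (columns indexed by $0,\dots,t$), and $F_d=(F_{d1}',\dots,F_{dn}')'$ with $F_{du}=LT_{du}$, where $L$ is the $p\times p$ matrix with ones on the first subdiagonal and zeros elsewhere. With $\mathrm{pr}(X)=X(X'X)^-X'$ and $\mathrm{pr}^\perp(X)=I-\mathrm{pr}(X)$, the information matrix for $\tau=(\tau_0,\dots,\tau_t)'$ is $C_d=T_d'\,\mathrm{pr}^\perp([P|U|F_d])\,T_d$, and the information matrix $M_d$ for $(\tau_1-\tau_0,\dots,\tau_t-\tau_0)'$ is the $t\times t$ matrix obtained from $C_d$ by deleting the row and column indexed by $0$. If $M_d$ is nonsingular then $\mathrm{Var}_d(\hat\tau_i-\hat\tau_0)=\sigma^2(M_d^{-1})_{ii}$; if $M_d$ is singular, $\mathrm{Tr}(M_d^{-1})$ and $\max_i\mathrm{Var}_d(\hat\tau_i-\hat\tau_0)$ are taken to be $+\infty$. Optimality. A design is A-optimal in a class if it minimizes $\mathrm{Tr}(M_d^{-1})$ (equivalently $\sum_{i=1}^t\mathrm{Var}_d(\hat\tau_i-\hat\tau_0)$) over the class; it is MV-optimal if it minimizes $\max_{1\le i\le t}\mathrm{Var}_d(\hat\tau_i-\hat\tau_0)$ over the class. Function $f$. $R$ is the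 set of positive values $r=r_{d0}$ attained by designs $d\in\Lambda_{t+1,n,p}$. For $r\in R$ put $\tilde r=\frac{p-1}{p}r$, and let $A(r)$, $B(r)$, $C(r)$ be the minima of $\sum_{u=1}^n n_{d0u}^2$, $\sum_{u=1}^n n_{d0u}\tilde n_{d0u}$, $\sum_{u=1}^n\tilde n_{d0u}^2$, respectively, each taken over all $d\in\Lambda_{t+1,n,p}$ with $r_{d0}=r$. Then $$x_1(r)=t(p-1)(np-r)-p\Big(r-\tfrac1pA(r)\Big)-\frac{[nt(p-1)-t\tilde r-B(r)]^2}{n(p-1)(pt-t-1)-(pt-t+p-2)\tilde r+C(r)},$$ $$y_1(r)=p\Big(r-\tfrac1pA(r)\Big)-\frac{n(p-1)B(r)^2}{np(p-1)\tilde r-\tilde r^2-n(p-1)C(r)}.$$ (Convention: $c/0=+\infty$ for $c>0$ in $f$.) Totally balanced designs. A design $d\in\Omega_{t+1,n,p}$ is called: (1) a balanced test-control incomplete block design for the direct effects if (a) each test treatment appears equally often in the design; (b) each test treatment appears in each unit at most once; (c) the number of units in which test treatments $i$ and $j$ both appear is the same for all $i\ne j$, $1\le i,j\le t$; (d) the control treatment appears in each unit either $[r_{d0}/n]$ or $[r_{d0}/n]+1$ times; (e) the number of units in which the control appears $[r_{d0}/n]$ times and test treatment $i$ appears is the same for every $1\le i\le t$; (2) a balanced test-control incomplete block design for the carryover effects if its first $p-1$ periods form a design in $\Omega_{t+1,n,p-1}$ satisfying (1) (so with $\tilde r_{d0}$ in place of $r_{d0}$); (3) balanced for test-control carryover effects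 if (a) every test treatment $i$ is immediately preceded by every other test treatment $j$ equally often for all $i\neq j$; (b) the control is immediately preceded by every test treatment equally often; (c) every test treatment is immediately preceded by the control equally often, and no treatment (including the control) is immediately preceded by itself; (4) a proportional frequency design for test-control on the periods if every test treatment appears in every period exactly $\frac{np-r_{d0}}{tp}$ times and the control appears in every period exactly $\frac{r_{d0}}{p}$ times. A totally balanced test-control incomplete crossover design is a $d\in\Omega_{t+1,n,p}$ satisfying (1)–(4) and also (5): the number of units in which test treatment $j$ appears once in the first $p-1$ periods and test treatment $i$ appears once is the same for every pair $i\ne j$; the number of units in which the control appears $[\tilde r_{d0}/n]$ times in the first $p-1$ periods and test treatment $i$ appears once is the same for every $1\le i\le t$; and the number of units in which test treatment $i$ appears once in the first $p-1$ periods and the control appears $[r_{d0}/n]$ times is the same for every $1\le i\le t$. *)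

theory Defs
  imports
    "HOL-Library.Extended_Real"
    "HOL-Library.FuncSet"
    "Jordan_Normal_Form.Determinant"
    "Jordan_Normal_Form.Gauss_Jordan_Elimination"
begin

section \<open>Crossover designs and their counts\<close>

text \<open>
  Throughout, \<open>t\<close> is the number of test treatments (treatment \<open>0\<close> is the control), \<open>n\<close> the number
  of units and \<open>p\<close> the number of periods; \<open>d (k, u)\<close> is the treatment of unit \<open>u\<close> in period \<open>k\<close>.
\<close>

type_synonym design = "nat \<times> nat \<Rightarrow> nat"

definition designs :: "nat \<Rightarrow> nat \<Rightarrow> nat \<Rightarrow> design set" where
  "designs t n p = ({1..p} \<times> {1..n}) \<rightarrow>\<^sub>E {0..t}"

text \<open>
  The counts restricted to the first \<open>p - 1\<close> periods (written with a tilde on paper) are the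
  functions below with \<open>p - 1\<close> in place of \<open>p\<close>.
\<close>

definition unit_count :: "nat \<Rightarrow> design \<Rightarrow> nat \<Rightarrow> nat \<Rightarrow> nat" where
  "unit_count p d i u = card {k \<in> {1..p}. d (k, u) = i}"

definition period_count :: "nat \<Rightarrow> design \<Rightarrow> nat \<Rightarrow> nat \<Rightarrow> nat" where
  "period_count n d i k = card {u \<in> {1..n}. d (k, u) = i}"

definition preceded_count :: "nat \<Rightarrow> nat \<Rightarrow> design \<Rightarrow> nat \<Rightarrow> nat \<Rightarrow> nat" where
  "preceded_count n p d i j =
     card {(k, u). k \<in> {2..p} \<and> u \<in> {1..n} \<and> d (k, u) = i \<and> d (k - 1, u) = j}"

definition replication :: "nat \<Rightarrow> nat \<Rightarrow> design \<Rightarrow> nat \<Rightarrow> nat" where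
  "replication n p d i = (\<Sum>u=1..n. unit_count p d i u)"

definition Lambda_class :: "nat \<Rightarrow> nat \<Rightarrow> nat \<Rightarrow> design set" where
  "Lambda_class t n p = {d \<in> designs t n p.
     (\<forall>k\<in>{1..p}. real (period_count n d 0 k) = real (replication n p d 0) / real p) \<and>
     (\<forall>i\<in>{0..t}. preceded_count n p d i i = 0)}"


section \<open>Information matrices\<close>

definition kronecker :: "real mat \<Rightarrow> real mat \<Rightarrow> real mat" where
  "kronecker A B = mat (dim_row A * dim_row B) (dim_col A * dim_col B)
     (\<lambda>(a, b). A $$ (a div dim_row B, b div dim_col B) * B $$ (a mod dim_row B, b mod dim_col B))"

definition ones_col :: "nat \<Rightarrow> real mat" where
  "ones_col m = mat m 1 (\<lambda>_. 1)"

definition append_cols :: "real mat \<Rightarrow> real mat \<Rightarrow> real mat" where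
  "append_cols A B = four_block_mat A B (0\<^sub>m 0 (dim_col A)) (0\<^sub>m 0 (dim_col B))"

definition is_ginverse :: "real mat \<Rightarrow> real mat \<Rightarrow> bool" where
  "is_ginverse A G \<longleftrightarrow> G \<in> carrier_mat (dim_col A) (dim_row A) \<and> A * G * A = A"

text \<open>The value of \<open>proj X\<close> does not depend on the chosen generalized inverse.\<close>

definition proj :: "real mat \<Rightarrow> real mat" where
  "proj X = X * (SOME G. is_ginverse (X\<^sup>T * X) G) * X\<^sup>T"

definition proj_perp :: "real mat \<Rightarrow> real mat" where
  "proj_perp X = 1\<^sub>m (dim_row X) - proj X"

text \<open>
  Matrix indices start at \<open>0\<close>: row \<open>k\<close> of a unit block is period \<open>k + 1\<close>, block \<open>u\<close> is unit \<open>u + 1\<close>,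
  and treatment \<open>i\<close> labels column \<open>i\<close>.
\<close>

definition period_mat :: "nat \<Rightarrow> nat \<Rightarrow> real mat" where
  "period_mat n p = kronecker (ones_col n) (1\<^sub>m p)"

definition unit_mat :: "nat \<Rightarrow> nat \<Rightarrow> real mat" where
  "unit_mat n p = kronecker (1\<^sub>m n) (ones_col p)"

definition stack_blocks :: "nat \<Rightarrow> nat \<Rightarrow> nat \<Rightarrow> (nat \<Rightarrow> real mat) \<Rightarrow> real mat" where
  "stack_blocks n p m X = mat (n * p) m (\<lambda>(a, j). X (a div p) $$ (a mod p, j))"

definition unit_treatment_mat :: "nat \<Rightarrow> nat \<Rightarrow> design \<Rightarrow> nat \<Rightarrow> real mat" where
  "unit_treatment_mat t p d u =
     mat p (t + 1) (\<lambda>(k, i). if d (k + 1, u + 1) = i then 1 else 0)"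

definition lag_mat :: "nat \<Rightarrow> real mat" where
  "lag_mat p = mat p p (\<lambda>(k, l). if k = l + 1 then 1 else 0)"

definition treatment_mat :: "nat \<Rightarrow> nat \<Rightarrow> nat \<Rightarrow> design \<Rightarrow> real mat" where
  "treatment_mat t n p d = stack_blocks n p (t + 1) (unit_treatment_mat t p d)"

definition carryover_mat :: "nat \<Rightarrow> nat \<Rightarrow> nat \<Rightarrow> design \<Rightarrow> real mat" where
  "carryover_mat t n p d =
     stack_blocks n p (t + 1) (\<lambda>u. lag_mat p * unit_treatment_mat t p d u)"

definition info_mat :: "nat \<Rightarrow> nat \<Rightarrow> nat \<Rightarrow> design \<Rightarrow> real mat" where
  "info_mat t n p d =
     (treatment_mat t n p d)\<^sup>T
     * proj_perp (append_cols (append_cols (period_mat n p) (unit_mat n p)) (carryover_mat t n p d))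
     * treatment_mat t n p d"

definition control_info_mat :: "nat \<Rightarrow> nat \<Rightarrow> nat \<Rightarrow> design \<Rightarrow> real mat" where
  "control_info_mat t n p d = mat_delete (info_mat t n p d) 0 0"


section \<open>Optimality\<close>

text \<open>
  \<^const>\<open>mat_inverse\<close> returns \<^const>\<open>None\<close> exactly for singular matrices. In the control information
  matrix, test treatment \<open>i\<close> has index \<open>i - 1\<close>.
\<close>

definition trace_inverse :: "nat \<Rightarrow> nat \<Rightarrow> nat \<Rightarrow> design \<Rightarrow> ereal" where
  "trace_inverse t n p d =
     (case mat_inverse (control_info_mat t n p d) of
        None \<Rightarrow> \<infinity>
      | Some V \<Rightarrow> ereal (\<Sum>i<t. V $$ (i, i)))"

text \<open>
  Variance of the estimator of the contrast between test treatment \<open>i\<close> and the control, for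
  observations with independent errors of variance \<open>\<sigma>\<^sup>2\<close>.
\<close>

definition contrast_variance :: "real \<Rightarrow> nat \<Rightarrow> nat \<Rightarrow> nat \<Rightarrow> design \<Rightarrow> nat \<Rightarrow> ereal" where
  "contrast_variance \<sigma> t n p d i =
     (case mat_inverse (control_info_mat t n p d) of
        None \<Rightarrow> \<infinity>
      | Some V \<Rightarrow> ereal (\<sigma>\<^sup>2 * V $$ (i - 1, i - 1)))"

definition max_contrast_variance :: "real \<Rightarrow> nat \<Rightarrow> nat \<Rightarrow> nat \<Rightarrow> design \<Rightarrow> ereal" where
  "max_contrast_variance \<sigma> t n p d = (MAX i\<in>{1..t}. contrast_variance \<sigma> t n p d i)"

definition A_optimal :: "nat \<Rightarrow> nat \<Rightarrow> nat \<Rightarrow> design set \<Rightarrow> design \<Rightarrow> bool" where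
  "A_optimal t n p D d \<longleftrightarrow>
     d \<in> D \<and> (\<forall>d'\<in>D. trace_inverse t n p d \<le> trace_inverse t n p d')"

definition MV_optimal :: "real \<Rightarrow> nat \<Rightarrow> nat \<Rightarrow> nat \<Rightarrow> design set \<Rightarrow> design \<Rightarrow> bool" where
  "MV_optimal \<sigma> t n p D d \<longleftrightarrow>
     d \<in> D \<and> (\<forall>d'\<in>D. max_contrast_variance \<sigma> t n p d \<le> max_contrast_variance \<sigma> t n p d')"


section \<open>The criterion function\<close>

definition R_set :: "nat \<Rightarrow> nat \<Rightarrow> nat \<Rightarrow> nat set" where
  "R_set t n p = {r. 0 < r \<and> (\<exists>d\<in>Lambda_class t n p. replication n p d 0 = r)}"

definition A_min :: "nat \<Rightarrow> nat \<Rightarrow> nat \<Rightarrow> nat \<Rightarrow> nat" where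
  "A_min t n p r = Min ((\<lambda>d. \<Sum>u=1..n. (unit_count p d 0 u)\<^sup>2)
     ` {d \<in> Lambda_class t n p. replication n p d 0 = r})"

definition B_min :: "nat \<Rightarrow> nat \<Rightarrow> nat \<Rightarrow> nat \<Rightarrow> nat" where
  "B_min t n p r = Min ((\<lambda>d. \<Sum>u=1..n. unit_count p d 0 u * unit_count (p - 1) d 0 u)
     ` {d \<in> Lambda_class t n p. replication n p d 0 = r})"

definition C_min :: "nat \<Rightarrow> nat \<Rightarrow> nat \<Rightarrow> nat \<Rightarrow> nat" where
  "C_min t n p r = Min ((\<lambda>d. \<Sum>u=1..n. (unit_count (p - 1) d 0 u)\<^sup>2)
     ` {d \<in> Lambda_class t n p. replication n p d 0 = r})"

definition x1 :: "nat \<Rightarrow> nat \<Rightarrow> nat \<Rightarrow> nat \<Rightarrow> real" where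
  "x1 t n p r =
     (let T = real t; N = real n; P = real p; r' = real r; rt = (P - 1) / P * r';
          A = real (A_min t n p r); B = real (B_min t n p r); C = real (C_min t n p r)
      in T * (P - 1) * (N * P - r') - P * (r' - 1 / P * A)
         - (N * T * (P - 1) - T * rt - B)\<^sup>2
           / (N * (P - 1) * (P * T - T - 1) - (P * T - T + P - 2) * rt + C))"

definition y1 :: "nat \<Rightarrow> nat \<Rightarrow> nat \<Rightarrow> nat \<Rightarrow> real" where
  "y1 t n p r =
     (let N = real n; P = real p; r' = real r; rt = (P - 1) / P * r';
          A = real (A_min t n p r); B = real (B_min t n p r); C = real (C_min t n p r)
      in P * (r' - 1 / P * A)
         - N * (P - 1) * B\<^sup>2 / (N * P * (P - 1) * rt - rt\<^sup>2 - N * (P - 1) * C))"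

text \<open>The divisions are those of \<^typ>\<open>ereal\<close>, where \<open>c / 0 = \<infinity>\<close> for \<open>c > 0\<close>.\<close>

definition f_crit :: "nat \<Rightarrow> nat \<Rightarrow> nat \<Rightarrow> nat \<Rightarrow> ereal" where
  "f_crit t n p r =
     ereal (real t * (real t - 1)\<^sup>2 * real p) / ereal (x1 t n p r)
     + ereal (real t * real p) / ereal (y1 t n p r)"


section \<open>Totally balanced designs\<close>

definition balanced_direct :: "nat \<Rightarrow> nat \<Rightarrow> nat \<Rightarrow> design \<Rightarrow> bool" where
  "balanced_direct t n p d \<longleftrightarrow>
     d \<in> designs t n p \<and>
     (\<exists>c. \<forall>i\<in>{1..t}. replication n p d i = c) \<and>
     (\<forall>i\<in>{1..t}. \<forall>u\<in>{1..n}. unit_count p d i u \<le> 1) \<and>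
     (\<exists>c. \<forall>i\<in>{1..t}. \<forall>j\<in>{1..t}. i \<noteq> j \<longrightarrow>
        card {u \<in> {1..n}. 1 \<le> unit_count p d i u \<and> 1 \<le> unit_count p d j u} = c) \<and>
     (\<forall>u\<in>{1..n}. unit_count p d 0 u = replication n p d 0 div n
        \<or> unit_count p d 0 u = replication n p d 0 div n + 1) \<and>
     (\<exists>c. \<forall>i\<in>{1..t}.
        card {u \<in> {1..n}. unit_count p d 0 u = replication n p d 0 div n
          \<and> 1 \<le> unit_count p d i u} = c)"

definition balanced_carryover :: "nat \<Rightarrow> nat \<Rightarrow> nat \<Rightarrow> design \<Rightarrow> bool" where
  "balanced_carryover t n p d \<longleftrightarrow>
     balanced_direct t n (p - 1) (restrict d ({1..p - 1} \<times> {1..n}))"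

definition balanced_precedence :: "nat \<Rightarrow> nat \<Rightarrow> nat \<Rightarrow> design \<Rightarrow> bool" where
  "balanced_precedence t n p d \<longleftrightarrow>
     (\<exists>c. \<forall>i\<in>{1..t}. \<forall>j\<in>{1..t}. i \<noteq> j \<longrightarrow> preceded_count n p d i j = c) \<and>
     (\<exists>c. \<forall>j\<in>{1..t}. preceded_count n p d 0 j = c) \<and>
     (\<exists>c. \<forall>i\<in>{1..t}. preceded_count n p d i 0 = c) \<and>
     (\<forall>i\<in>{0..t}. preceded_count n p d i i = 0)"

definition proportional_periods :: "nat \<Rightarrow> nat \<Rightarrow> nat \<Rightarrow> design \<Rightarrow> bool" where
  "proportional_periods t n p d \<longleftrightarrow>
     (\<forall>k\<in>{1..p}.
        (\<forall>i\<in>{1..t}. real (period_count n d i k)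
           = (real n * real p - real (replication n p d 0)) / (real t * real p)) \<and>
        real (period_count n d 0 k) = real (replication n p d 0) / real p)"

definition balanced_direct_carryover :: "nat \<Rightarrow> nat \<Rightarrow> nat \<Rightarrow> design \<Rightarrow> bool" where
  "balanced_direct_carryover t n p d \<longleftrightarrow>
     (\<exists>c. \<forall>i\<in>{1..t}. \<forall>j\<in>{1..t}. i \<noteq> j \<longrightarrow>
        card {u \<in> {1..n}. unit_count (p - 1) d j u = 1 \<and> unit_count p d i u = 1} = c) \<and>
     (\<exists>c. \<forall>i\<in>{1..t}.
        card {u \<in> {1..n}. unit_count (p - 1) d 0 u = replication n (p - 1) d 0 div n
          \<and> unit_count p d i u = 1} = c) \<and>
     (\<exists>c. \<forall>i\<in>{1..t}.
        card {u \<in> {1..n}. unit_count (p - 1) d i u = 1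
          \<and> unit_count p d 0 u = replication n p d 0 div n} = c)"

definition totally_balanced :: "nat \<Rightarrow> nat \<Rightarrow> nat \<Rightarrow> design \<Rightarrow> bool" where
  "totally_balanced t n p d \<longleftrightarrow>
     d \<in> designs t n p \<and>
     balanced_direct t n p d \<and>
     balanced_carryover t n p d \<and>
     balanced_precedence t n p d \<and>
     proportional_periods t n p d \<and>
     balanced_direct_carryover t n p d"

end

theory Submission
  imports Defs
begin

text \<open>
  Write \<open>T\<close> for the treatment matrix, \<open>C\<close> for the information matrix of all treatments of a design and
  \<open>M\<close> for the part of \<open>C\<close> that belongs to the tests. For every vector \<open>v\<close> the value \<open>v\<^sup>T C v\<close> is the
  least residual sum of squares when \<open>T v\<close> is fitted by period, unit and carryover effects
  (\<open>info_form_le_residual\<close>, \<open>info_mat_via_normal_equations\<close>). Any particular fit therefore bounds the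
  information from above. For the control the carryover coefficients are taken as \<open>e\<close> times the
  control indicator. For the contrasts \<open>v\<^sub>i\<close> between test \<open>i\<close> and the average test they are
  \<open>c v\<^sub>i\<close>, with the same \<open>c \<ge> 0\<close> for every \<open>i\<close>. This gives quadratic polynomials in \<open>e\<close> and \<open>c\<close> that bound
  \<open>y\<^sub>d = p C\<^sub>0\<^sub>0\<close> and \<open>x\<^sub>d = t p \<Sum>\<^sub>i v\<^sub>i\<^sup>T C v\<^sub>i = p (t tr M - C\<^sub>0\<^sub>0)\<close>. In them the design enters only through
  the replication \<open>r\<close> of the control and the sums \<open>A\<^sub>d\<close>, \<open>B\<^sub>d\<close>, \<open>C\<^sub>d\<close> of products of the unit counts of the
  control (\<open>control_info_le\<close>, \<open>contrast_info_le\<close>). The functions \<open>x\<^sub>1\<close> and \<open>y\<^sub>1\<close> are these polynomials,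
  minimized over \<open>c\<close> and \<open>e\<close>, at the least possible sums \<open>A\<close>, \<open>B\<close>, \<open>C\<close>.

  On the other side, \<open>tr M\<^sup>-\<^sup>1\<close> is at least \<open>t (t - 1)\<^sup>2 p / x\<^sub>d + t p / y\<^sub>d\<close>, and it lies above every tangent
  plane of this convex function of \<open>(x\<^sub>d, y\<^sub>d)\<close> (\<open>trace_inverse_tangent\<close>). The tangent plane at \<open>(x\<^sub>1, y\<^sub>1)\<close> is
  used.

  The delicate point is that larger sums \<open>A\<^sub>d\<close>, \<open>B\<^sub>d\<close>, \<open>C\<^sub>d\<close> lower the bound for \<open>y\<^sub>d\<close> but raise the bound
  for \<open>x\<^sub>d\<close>, so \<open>x\<^sub>d\<close> alone need not stay below \<open>x\<^sub>1\<close>. Along the tangent plane the loss in \<open>y\<close> outweighs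
  the gain in \<open>x\<close>, because \<open>(t - 1) y\<^sub>1 \<le> x\<^sub>1\<close> and \<open>c (t - 1) y\<^sub>1 \<le> e x\<^sub>1\<close> at the optimal \<open>c\<close> and \<open>e\<close>
  (locale \<open>criterion_arith\<close>). Both inequalities rest on the fact that the control, never following itself
  and equally frequent in all periods, takes at most half of the observations.

  In a totally balanced design all three sums are minimal and the adjusted products of the treatment
  and carryover indicators do not distinguish the tests. The fits above then satisfy the normal
  equations, \<open>M\<close> is completely symmetric with \<open>x\<^sub>d = x\<^sub>1\<close> and \<open>y\<^sub>d = y\<^sub>1\<close>, and \<open>tr M\<^sup>-\<^sup>1 = f(r)\<close>
  (\<open>balanced_info_entries\<close>). As all tests have the same variance there, and the largest variance of any
  design is at least the average one, optimality for the trace implies optimality for the maximum.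

  If \<open>y\<^sub>1\<close> vanishes at the minimizing \<open>r\<close>, then \<open>f\<close> is infinite everywhere, every design is singular
  and there is nothing to compare.
\<close>

section \<open>Generalized inverses and orthogonal projections\<close>

text \<open>
  \<open>G\<close> maps the unit vector of each nonzero row to that of its pivot column, so \<open>E G\<close> is the
  identity on the nonzero rows and zero elsewhere.
\<close>

lemma ginverse_of_row_echelon:
  fixes E :: "real mat"
  assumes E: "E \<in> carrier_mat nr nc" and ref: "row_echelon_form E"
  shows "\<exists>G. is_ginverse E G"
proof -
  obtain f where f: "pivot_fun E f nc"
    using ref E unfolding row_echelon_form_def by auto
  have dE: "dim_row E = nr" "dim_col E = nc" using E by auto
  note piv = pivot_funD[OF dE(1) f]
  define G where "G = mat nc nr (\<lambda>(j, i). if f i = j then 1 else 0 :: real)"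
  have G: "G \<in> carrier_mat nc nr" unfolding G_def by auto
  have EG: "(E * G) $$ (i, k) = (if f k < nc \<and> i = k then 1 else 0)" if "i < nr" "k < nr" for i k
  proof -
    have "(E * G) $$ (i, k) = (\<Sum>j<nc. E $$ (i, j) * (if f k = j then 1 else 0))"
      using that dE by (simp add: G_def scalar_prod_def atLeast0LessThan)
    also have "\<dots> = (if f k < nc then E $$ (i, f k) else 0)"
      by (simp add: if_distrib[of "(*) _"] sum.delta cong: if_cong)
    also have "\<dots> = (if f k < nc \<and> i = k then 1 else 0)"
      using piv(4)[of k] piv(5)[of k i] that by auto
    finally show ?thesis .
  qed
  have "E * G * E = E"
  proof (rule eq_matI)
    fix i j assume "i < dim_row E" "j < dim_col E"
    hence ij: "i < nr" "j < nc" using dE by auto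
    have "(E * G * E) $$ (i, j) = (\<Sum>k<nr. (E * G) $$ (i, k) * E $$ (k, j))"
      using ij dE G by (auto simp: scalar_prod_def atLeast0LessThan intro!: sum.cong)
    also have "\<dots> = (\<Sum>k<nr. if k = i then (if f i < nc then E $$ (i, j) else 0) else 0)"
      using ij by (intro sum.cong) (auto simp: EG)
    also have "\<dots> = (if f i < nc then E $$ (i, j) else 0)"
      using ij by simp
    also have "\<dots> = E $$ (i, j)"
      using piv(1)[of i] piv(2)[of i j] ij by auto
    finally show "(E * G * E) $$ (i, j) = E $$ (i, j)" .
  qed (use E G in auto)
  thus ?thesis unfolding is_ginverse_def using G dE by auto
qed

lemma assoc_mult_mat4:
  assumes "A \<in> carrier_mat a b" "B \<in> carrier_mat b c" "C \<in> carrier_mat c d" "D \<in> carrier_mat d e"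
  shows "A * B * C * D = A * (B * (C * D))"
  using assms assoc_mult_mat[of "A * B" a c C d D e] assoc_mult_mat[of A a b B c "C * D" e]
  by simp

lemma ginverse_exists:
  fixes A :: "real mat"
  shows "\<exists>G. is_ginverse A G"
proof -
  define nr nc where "nr = dim_row A" and "nc = dim_col A"
  have A: "A \<in> carrier_mat nr nc" unfolding nr_def nc_def by auto
  define E where "E = gauss_jordan_single A"
  note gj = gauss_jordan_single[OF A E_def[symmetric]]
  obtain P Q where PQ: "E = P * A" "P \<in> carrier_mat nr nr" "Q \<in> carrier_mat nr nr"
    "P * Q = 1\<^sub>m nr" "Q * P = 1\<^sub>m nr"
    using gj(4) by auto
  have E: "E \<in> carrier_mat nr nc" using gj(2) .
  obtain G where G: "G \<in> carrier_mat nc nr" "E * G * E = E"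
    using ginverse_of_row_echelon[OF E gj(3)] E unfolding is_ginverse_def by auto
  have A_eq: "A = Q * E"
    unfolding PQ(1) using PQ A assoc_mult_mat[of Q nr nr P nr A nc] by simp
  have "A * (G * P) * A = A * (G * (P * A))"
    using A G PQ assoc_mult_mat[of A nr nc "G * P" nr A nc] assoc_mult_mat[of G nc nr P nr A nc]
    by simp
  also have "\<dots> = Q * (E * (G * E))"
    unfolding PQ(1)[symmetric] using assoc_mult_mat[of Q nr nr E nc "G * E" nc] PQ(3) E G A_eq by simp
  also have "\<dots> = Q * (E * G * E)" using assoc_mult_mat[of E nr nc G nr E nc] E G by simp
  also have "\<dots> = A" using G(2) A_eq by simp
  finally have "is_ginverse A (G * P)"
    unfolding is_ginverse_def using A G PQ by auto
  thus ?thesis by blast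
qed

lemma sum_squares_vec_eq_0:
  fixes x :: "real vec"
  assumes "x \<bullet> x = 0"
  shows "x = 0\<^sub>v (dim_vec x)"
proof (rule eq_vecI)
  fix i assume "i < dim_vec (0\<^sub>v (dim_vec x))"
  moreover have "(\<Sum>i = 0..<dim_vec x. x $ i * x $ i) = 0"
    using assms by (simp add: scalar_prod_def)
  ultimately show "x $ i = 0\<^sub>v (dim_vec x) $ i"
    by (subst (asm) sum_nonneg_eq_0_iff) auto
qed auto

lemma gram_mult_eq_0D:
  fixes X E :: "real mat"
  assumes X: "X \<in> carrier_mat n m" and E: "E \<in> carrier_mat m k"
    and zero: "X\<^sup>T * X * E = 0\<^sub>m m k"
  shows "X * E = 0\<^sub>m n k"
proof (rule eq_matI)
  fix i j assume ij: "i < dim_row (0\<^sub>m n k :: real mat)" "j < dim_col (0\<^sub>m n k :: real mat)"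
  define y where "y = X *\<^sub>v col E j"
  have e: "col E j \<in> carrier_vec m" using E ij by auto
  have y: "y \<in> carrier_vec n" unfolding y_def using X e by auto
  have "col (X\<^sup>T * X * E) j = X\<^sup>T *\<^sub>v y"
    unfolding y_def using X E ij e
    by (smt (verit) assoc_mult_mat_vec col_mult2 index_zero_mat(3) mult_carrier_mat transpose_carrier_mat)
  hence "X\<^sup>T *\<^sub>v y = 0\<^sub>v m" using zero ij by simp
  moreover have "y \<bullet> y = (X\<^sup>T *\<^sub>v y) \<bullet> col E j"
    using transpose_vec_mult_scalar[OF X e y] by (simp add: y_def)
  ultimately have "y \<bullet> y = 0" using e by simp
  hence "y = 0\<^sub>v n" using sum_squares_vec_eq_0 y by fastforce
  moreover have "(X * E) $$ (i, j) = y $ i"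
    unfolding y_def using X E ij by simp
  ultimately show "(X * E) $$ (i, j) = 0\<^sub>m n k $$ (i, j)" using ij by simp
qed (use X E in auto)

context
  fixes X :: "real mat" and n m :: nat
  assumes X: "X \<in> carrier_mat n m"
begin

text \<open>
  With \<open>E = G X\<^sup>T X - I\<close>, the equation \<open>X\<^sup>T X G X\<^sup>T X = X\<^sup>T X\<close> says \<open>X\<^sup>T X E = 0\<close>. So
  \<open>(X E)\<^sup>T (X E) = 0\<close>, whence \<open>X E = 0\<close>; a transposed argument then makes \<open>proj X\<close> symmetric.
\<close>

lemma ginverse_gram_fixes:
  assumes G: "G \<in> carrier_mat m m" and gi: "X\<^sup>T * X * G * (X\<^sup>T * X) = X\<^sup>T * X"
  shows "X * G * X\<^sup>T * X = X"
proof -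
  define S where "S = X\<^sup>T * X"
  have S: "S \<in> carrier_mat m m" unfolding S_def using X by auto
  define E where "E = G * S - 1\<^sub>m m"
  have E: "E \<in> carrier_mat m m" unfolding E_def using G S by auto
  have "S * E = S * (G * S) - S * 1\<^sub>m m"
    unfolding E_def using S G by (intro mult_minus_distrib_mat) auto
  also have "\<dots> = 0\<^sub>m m m"
    using gi assoc_mult_mat[OF S G S] S unfolding S_def[symmetric] by simp
  finally have "X * E = 0\<^sub>m n m"
    using gram_mult_eq_0D[OF X E] unfolding S_def by auto
  moreover have "X * E = X * (G * S) - X"
  proof -
    have "X * E = X * (G * S) - X * 1\<^sub>m m"
      unfolding E_def using X G S by (intro mult_minus_distrib_mat) auto
    thus ?thesis using X by simp
  qed
  ultimately have z: "X * (G * S) - X = 0\<^sub>m n m" by simp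
  have "X * (G * S) = X"
  proof (rule eq_matI)
    fix i j assume "i < dim_row X" "j < dim_col X"
    thus "(X * (G * S)) $$ (i, j) = X $$ (i, j)"
      using arg_cong[OF z, of "\<lambda>A. A $$ (i, j)"] X by auto
  qed (use X G S in auto)
  moreover have "X * G * X\<^sup>T * X = X * (G * S)"
    unfolding S_def using X G by (intro assoc_mult_mat4) auto
  ultimately show ?thesis by simp
qed

lemma proj_carrier: "proj X \<in> carrier_mat n n"
  and proj_fixes: "proj X * X = X"
  and proj_symmetric: "(proj X)\<^sup>T = proj X"
  and proj_kills: "z \<in> carrier_vec n \<Longrightarrow> X\<^sup>T *\<^sub>v z = 0\<^sub>v m \<Longrightarrow> proj X *\<^sub>v z = 0\<^sub>v n"
proof -
  define G where "G = (SOME G. is_ginverse (X\<^sup>T * X) G)"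
  have "is_ginverse (X\<^sup>T * X) G"
    unfolding G_def using ginverse_exists by (rule someI_ex)
  hence G: "G \<in> carrier_mat m m" and gi: "X\<^sup>T * X * G * (X\<^sup>T * X) = X\<^sup>T * X"
    unfolding is_ginverse_def using X by auto
  have H: "proj X = X * G * X\<^sup>T" unfolding proj_def G_def by simp
  show carr: "proj X \<in> carrier_mat n n" unfolding H using X G by auto
  show fix1: "proj X * X = X" unfolding H by (rule ginverse_gram_fixes[OF G gi])
  have "(X\<^sup>T * X * G * (X\<^sup>T * X))\<^sup>T = X\<^sup>T * X"
    unfolding gi using X by (simp add: transpose_mult[of _ m n _ m])
  moreover have "(X\<^sup>T * X * G * (X\<^sup>T * X))\<^sup>T = X\<^sup>T * X * G\<^sup>T * (X\<^sup>T * X)"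
  proof -
    have S: "X\<^sup>T * X \<in> carrier_mat m m" using X by auto
    have "(X\<^sup>T * X)\<^sup>T = X\<^sup>T * X" using X by (simp add: transpose_mult[of _ m n _ m])
    thus ?thesis using S G
      by (simp add: transpose_mult[of _ m m _ m] assoc_mult_mat[of _ m m _ m _ m])
  qed
  ultimately have gi': "X\<^sup>T * X * G\<^sup>T * (X\<^sup>T * X) = X\<^sup>T * X" by simp
  have GT: "G\<^sup>T \<in> carrier_mat m m" using G by auto
  have HT: "(proj X)\<^sup>T = X * G\<^sup>T * X\<^sup>T"
    unfolding H using X G
    by (simp add: transpose_mult[of _ n m _ n] transpose_mult[of _ m m _ n])
  have fix2: "(proj X)\<^sup>T * X = X" unfolding HT by (rule ginverse_gram_fixes[OF GT gi'])
  have HTH: "(proj X)\<^sup>T * proj X = proj X"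
  proof -
    have "(proj X)\<^sup>T * (X * G * X\<^sup>T) = ((proj X)\<^sup>T * X) * G * X\<^sup>T"
      using carr X G assoc_mult_mat4[of "(proj X)\<^sup>T" n n X m G m "X\<^sup>T" n]
        assoc_mult_mat[of X n m G m "X\<^sup>T" n] by simp
    thus ?thesis unfolding fix2 unfolding H[symmetric] by simp
  qed
  have "((proj X)\<^sup>T * proj X)\<^sup>T = (proj X)\<^sup>T * proj X"
    using carr by (simp add: transpose_mult[of _ n n _ n])
  thus "(proj X)\<^sup>T = proj X" unfolding HTH .
  fix z assume z: "z \<in> carrier_vec n" and Xz: "X\<^sup>T *\<^sub>v z = 0\<^sub>v m"
  have "proj X *\<^sub>v z = (X * G) *\<^sub>v (X\<^sup>T *\<^sub>v z)"
    unfolding H using X G z by (intro assoc_mult_mat_vec[of _ n m _ n]) auto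
  also have "\<dots> = 0\<^sub>v n"
    unfolding Xz using X G by (intro eq_vecI) (auto simp: scalar_prod_def simp del: assoc_mult_mat_vec)
  finally show "proj X *\<^sub>v z = 0\<^sub>v n" .
qed

lemma proj_perp_carrier: "proj_perp X \<in> carrier_mat n n"
  unfolding proj_perp_def using proj_carrier X by auto

lemma proj_perp_symmetric: "(proj_perp X)\<^sup>T = proj_perp X"
proof -
  have "(proj_perp X)\<^sup>T = (1\<^sub>m n)\<^sup>T - (proj X)\<^sup>T"
    unfolding proj_perp_def using X proj_carrier by (auto intro!: eq_matI)
  thus ?thesis unfolding proj_perp_def using X proj_symmetric by simp
qed

lemma proj_perp_mult_vec:
  assumes "z \<in> carrier_vec n"
  shows "proj_perp X *\<^sub>v z = z - proj X *\<^sub>v z"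
  unfolding proj_perp_def using X assms proj_carrier
  by (simp add: minus_mult_distrib_mat_vec[of _ n n])

lemma proj_perp_annihilates:
  assumes b: "b \<in> carrier_vec m"
  shows "proj_perp X *\<^sub>v (X *\<^sub>v b) = 0\<^sub>v n"
proof -
  have "proj X *\<^sub>v (X *\<^sub>v b) = (proj X * X) *\<^sub>v b"
    using proj_carrier X b by (intro assoc_mult_mat_vec[symmetric, of _ n n _ m]) auto
  thus ?thesis using proj_fixes X b by (subst proj_perp_mult_vec) auto
qed

lemma proj_perp_fixes:
  assumes "z \<in> carrier_vec n" "X\<^sup>T *\<^sub>v z = 0\<^sub>v m"
  shows "proj_perp X *\<^sub>v z = z"
  using proj_kills[OF assms] proj_perp_mult_vec[OF assms(1)] assms(1) by simp

lemma proj_perp_idempotent_vec: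
  assumes z: "z \<in> carrier_vec n"
  shows "proj_perp X *\<^sub>v (proj_perp X *\<^sub>v z) = proj_perp X *\<^sub>v z"
proof (rule proj_perp_fixes)
  show c: "proj_perp X *\<^sub>v z \<in> carrier_vec n" using proj_perp_carrier z by auto
  have XQ: "X\<^sup>T * proj_perp X = 0\<^sub>m m n"
  proof -
    have "X\<^sup>T * proj X = (proj X * X)\<^sup>T"
      using X proj_carrier proj_symmetric by (simp add: transpose_mult[of _ n n _ m])
    hence "X\<^sup>T * proj X = X\<^sup>T" using proj_fixes by simp
    moreover have "X\<^sup>T * proj_perp X = X\<^sup>T * 1\<^sub>m n - X\<^sup>T * proj X"
      unfolding proj_perp_def using X proj_carrier
      by (simp add: mult_minus_distrib_mat[of _ m n _ n])
    ultimately show ?thesis using X by auto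
  qed
  have "X\<^sup>T *\<^sub>v (proj_perp X *\<^sub>v z) = (X\<^sup>T * proj_perp X) *\<^sub>v z"
    using X proj_perp_carrier z by (intro assoc_mult_mat_vec[symmetric, of _ m n _ n]) auto
  thus "X\<^sup>T *\<^sub>v (proj_perp X *\<^sub>v z) = 0\<^sub>v m" unfolding XQ using z
    by (intro eq_vecI) (auto simp: scalar_prod_def)
qed

lemma proj_perp_self_adjoint:
  assumes "y \<in> carrier_vec n" "z \<in> carrier_vec n"
  shows "y \<bullet> (proj_perp X *\<^sub>v z) = (proj_perp X *\<^sub>v y) \<bullet> z"
  using transpose_vec_mult_scalar[OF proj_perp_carrier assms(2,1)] proj_perp_symmetric by simp

lemma proj_perp_quadratic_nonneg:
  assumes y: "y \<in> carrier_vec n"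
  shows "y \<bullet> (proj_perp X *\<^sub>v y) \<ge> 0"
proof -
  have c: "proj_perp X *\<^sub>v y \<in> carrier_vec n" using proj_perp_carrier y by auto
  have "y \<bullet> (proj_perp X *\<^sub>v y) = y \<bullet> (proj_perp X *\<^sub>v (proj_perp X *\<^sub>v y))"
    using proj_perp_idempotent_vec[OF y] by simp
  also have "\<dots> = (proj_perp X *\<^sub>v y) \<bullet> (proj_perp X *\<^sub>v y)"
    using proj_perp_self_adjoint[OF y c] .
  finally show ?thesis by (simp add: scalar_prod_def sum_nonneg)
qed

text \<open>Projecting away the column space is the least squares fit, so no other fit has a smaller residual.\<close>

lemma proj_perp_least_squares:
  assumes y: "y \<in> carrier_vec n" and b: "b \<in> carrier_vec m"
  shows "y \<bullet> (proj_perp X *\<^sub>v y) \<le> (y + X *\<^sub>v b) \<bullet> (y + X *\<^sub>v b)"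
proof -
  define z where "z = y + X *\<^sub>v b"
  have z: "z \<in> carrier_vec n" and Xb: "X *\<^sub>v b \<in> carrier_vec n" unfolding z_def using y X b by auto
  define q where "q = proj_perp X *\<^sub>v y"
  have q: "q \<in> carrier_vec n" unfolding q_def using proj_perp_carrier y by auto
  have Qz: "proj_perp X *\<^sub>v z = q"
    unfolding z_def q_def using proj_perp_annihilates[OF b] proj_perp_carrier y Xb
    by (subst mult_add_distrib_mat_vec[of _ n n]) auto
  have qq: "y \<bullet> q = q \<bullet> q"
    using proj_perp_idempotent_vec[OF y] proj_perp_self_adjoint[OF y q] unfolding q_def by simp
  have zq: "z \<bullet> q = q \<bullet> q"
    using proj_perp_self_adjoint[OF z q] Qz proj_perp_idempotent_vec[OF y] unfolding q_def by simp
  have "0 \<le> (z - q) \<bullet> (z - q)" by (simp add: scalar_prod_def sum_nonneg)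
  also have "(z - q) \<bullet> (z - q) = z \<bullet> z - z \<bullet> q - (q \<bullet> z - q \<bullet> q)"
    using z q by (simp add: minus_scalar_prod_distrib[of _ n] scalar_prod_minus_distrib[of _ n])
  also have "q \<bullet> z = z \<bullet> q" using z q by (rule comm_scalar_prod[symmetric])
  finally show ?thesis unfolding z_def[symmetric] q_def[symmetric] using qq zq by simp
qed

end

section \<open>The information matrix through arrays indexed by period and unit\<close>

text \<open>
  An observation vector is handled as an array \<open>z k u\<close>, with periods \<open>k < p\<close> and units \<open>u < n\<close>
  numbered from \<open>0\<close> as in the matrices.
\<close>

definition stack :: "nat \<Rightarrow> nat \<Rightarrow> (nat \<Rightarrow> nat \<Rightarrow> real) \<Rightarrow> real vec" where
  "stack n p z = vec (n * p) (\<lambda>a. z (a mod p) (a div p))"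

definition direct_ind :: "design \<Rightarrow> nat \<Rightarrow> nat \<Rightarrow> nat \<Rightarrow> real" where
  "direct_ind d i k u = (if d (Suc k, Suc u) = i then 1 else 0)"

definition carry_ind :: "design \<Rightarrow> nat \<Rightarrow> nat \<Rightarrow> nat \<Rightarrow> real" where
  "carry_ind d i k u = (if 0 < k \<and> d (k, Suc u) = i then 1 else 0)"

lemma stack_carrier [simp]: "stack n p z \<in> carrier_vec (n * p)"
  unfolding stack_def by simp

lemma sum_blocks:
  fixes g :: "nat \<Rightarrow> nat \<Rightarrow> real"
  shows "(\<Sum>a<n * p. g (a mod p) (a div p)) = (\<Sum>u<n. \<Sum>k<p. g k u)"
proof -
  have "(\<Sum>a<n * p. g (a mod p) (a div p)) = (\<Sum>u<n. \<Sum>a\<in>{u * p..<u * p + p}. g (a mod p) (a div p))"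
    by (rule sum.nat_group[symmetric])
  also have "\<dots> = (\<Sum>u<n. \<Sum>k<p. g k u)"
  proof (rule sum.cong[OF refl])
    fix u
    have "(\<Sum>a\<in>{u * p..<u * p + p}. g (a mod p) (a div p))
        = (\<Sum>k\<in>{0..<p}. g ((k + u * p) mod p) ((k + u * p) div p))"
      using sum.shift_bounds_nat_ivl[of "\<lambda>a. g (a mod p) (a div p)" 0 "u * p" p]
      by (simp add: add.commute)
    also have "\<dots> = (\<Sum>k<p. g k u)"
      by (auto simp: atLeast0LessThan intro!: sum.cong)
    finally show "(\<Sum>a\<in>{u * p..<u * p + p}. g (a mod p) (a div p)) = (\<Sum>k<p. g k u)" .
  qed
  finally show ?thesis .
qed

lemma stack_scalar_prod: "stack n p y \<bullet> stack n p z = (\<Sum>u<n. \<Sum>k<p. y k u * z k u)"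
  using sum_blocks[of "\<lambda>k u. y k u * z k u" p n]
  by (simp add: stack_def scalar_prod_def atLeast0LessThan)

definition nuisance_mat :: "nat \<Rightarrow> nat \<Rightarrow> nat \<Rightarrow> design \<Rightarrow> real mat" where
  "nuisance_mat t n p d =
     append_cols (append_cols (period_mat n p) (unit_mat n p)) (carryover_mat t n p d)"

lemma nuisance_mat_carrier: "nuisance_mat t n p d \<in> carrier_mat (n * p) (p + n + (t + 1))"
  unfolding nuisance_mat_def append_cols_def period_mat_def unit_mat_def carryover_mat_def
    kronecker_def ones_col_def stack_blocks_def
  by (rule carrier_matI) simp_all

lemma treatment_mat_carrier: "treatment_mat t n p d \<in> carrier_mat (n * p) (t + 1)"
  unfolding treatment_mat_def stack_blocks_def by simp

lemma treatment_mat_index: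
  assumes "a < n * p" "i \<le> t"
  shows "treatment_mat t n p d $$ (a, i) = direct_ind d i (a mod p) (a div p)"
proof -
  have "a mod p < p" using assms by (cases "p = 0") auto
  thus ?thesis
    using assms by (simp add: treatment_mat_def stack_blocks_def unit_treatment_mat_def direct_ind_def)
qed

lemma carryover_mat_index:
  assumes "a < n * p" "i \<le> t"
  shows "carryover_mat t n p d $$ (a, i) = carry_ind d i (a mod p) (a div p)"
proof -
  define k u where "k = a mod p" and "u = a div p"
  have k: "k < p" unfolding k_def using assms by (cases "p = 0") auto
  have "carryover_mat t n p d $$ (a, i)
      = (\<Sum>l<p. (if k = l + 1 then 1 else 0) * (if d (l + 1, u + 1) = i then 1 else 0 :: real))"
    using assms k unfolding k_def u_def
    by (simp add: carryover_mat_def stack_blocks_def lag_mat_def unit_treatment_mat_def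
        scalar_prod_def atLeast0LessThan)
  also have "\<dots> = (\<Sum>l<p. if l = k - 1 then carry_ind d i k u else 0)"
    using k by (intro sum.cong) (auto simp: carry_ind_def)
  also have "\<dots> = carry_ind d i k u" using k by (auto simp: carry_ind_def)
  finally show ?thesis unfolding k_def u_def .
qed

lemma nuisance_mat_index:
  assumes "a < n * p"
  shows "j < p \<Longrightarrow> nuisance_mat t n p d $$ (a, j) = (if a mod p = j then 1 else 0)"
    and "u < n \<Longrightarrow> nuisance_mat t n p d $$ (a, p + u) = (if a div p = u then 1 else 0)"
    and "i \<le> t \<Longrightarrow> nuisance_mat t n p d $$ (a, p + n + i) = carry_ind d i (a mod p) (a div p)"
proof -
  have p: "0 < p" using assms by (cases "p = 0") auto
  have m: "a mod p < p" using p by simp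
  have q: "a div p < n" using assms p by (simp add: less_mult_imp_div_less)
  have dims: "dim_row (period_mat n p) = n * p" "dim_col (period_mat n p) = p"
    "dim_row (unit_mat n p) = n * p" "dim_col (unit_mat n p) = n"
    "dim_row (carryover_mat t n p d) = n * p" "dim_col (carryover_mat t n p d) = t + 1"
    unfolding period_mat_def unit_mat_def carryover_mat_def kronecker_def ones_col_def stack_blocks_def
    by simp_all
  show "j < p \<Longrightarrow> nuisance_mat t n p d $$ (a, j) = (if a mod p = j then 1 else 0)"
    using assms m q dims unfolding nuisance_mat_def append_cols_def
    by (simp add: period_mat_def kronecker_def ones_col_def)
  show "u < n \<Longrightarrow> nuisance_mat t n p d $$ (a, p + u) = (if a div p = u then 1 else 0)"
    using assms m q dims unfolding nuisance_mat_def append_cols_def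
    by (simp add: unit_mat_def kronecker_def ones_col_def)
  show "i \<le> t \<Longrightarrow> nuisance_mat t n p d $$ (a, p + n + i) = carry_ind d i (a mod p) (a div p)"
    using assms dims carryover_mat_index[OF assms] unfolding nuisance_mat_def append_cols_def by simp
qed

definition direct_comb :: "nat \<Rightarrow> design \<Rightarrow> (nat \<Rightarrow> real) \<Rightarrow> nat \<Rightarrow> nat \<Rightarrow> real" where
  "direct_comb t d v k u = (\<Sum>i\<le>t. v i * direct_ind d i k u)"

definition carry_comb :: "nat \<Rightarrow> design \<Rightarrow> (nat \<Rightarrow> real) \<Rightarrow> nat \<Rightarrow> nat \<Rightarrow> real" where
  "carry_comb t d \<rho> k u = (\<Sum>i\<le>t. \<rho> i * carry_ind d i k u)"

lemma treatment_mat_mult_vec: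
  "treatment_mat t n p d *\<^sub>v vec (t + 1) v = stack n p (direct_comb t d v)"
proof (rule eq_vecI)
  fix a assume "a < dim_vec (stack n p (direct_comb t d v))"
  hence a: "a < n * p" by (simp add: stack_def)
  have "(treatment_mat t n p d *\<^sub>v vec (t + 1) v) $ a = (\<Sum>i<t + 1. treatment_mat t n p d $$ (a, i) * v i)"
    using a treatment_mat_carrier[of t n p d]
    by (auto simp: scalar_prod_def atLeast0LessThan intro!: sum.cong)
  also have "\<dots> = (\<Sum>i\<le>t. v i * direct_ind d i (a mod p) (a div p))"
    using a treatment_mat_index by (intro sum.cong) auto
  finally show "(treatment_mat t n p d *\<^sub>v vec (t + 1) v) $ a = stack n p (direct_comb t d v) $ a"
    using a by (simp add: stack_def direct_comb_def)
qed (use treatment_mat_carrier[of t n p d] in \<open>auto simp: stack_def\<close>)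

lemma sum_lessThan_add:
  fixes h :: "nat \<Rightarrow> real"
  shows "sum h {..<m + k} = sum h {..<m} + (\<Sum>i<k. h (m + i))"
  by (induction k) auto

lemma nuisance_mat_mult_vec:
  fixes \<alpha> \<beta> \<rho> :: "nat \<Rightarrow> real"
  shows "nuisance_mat t n p d
    *\<^sub>v vec (p + n + (t + 1)) (\<lambda>j. if j < p then \<alpha> j else if j < p + n then \<beta> (j - p) else \<rho> (j - p - n))
    = stack n p (\<lambda>k u. \<alpha> k + \<beta> u + carry_comb t d \<rho> k u)" (is "?X *\<^sub>v ?b = ?s")
proof (rule eq_vecI)
  fix a assume "a < dim_vec ?s"
  hence a: "a < n * p" by (simp add: stack_def)
  have p: "0 < p" using a by (cases "p = 0") auto
  have m: "a mod p < p" using p by simp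
  have q: "a div p < n" using a p by (simp add: less_mult_imp_div_less)
  have split: "sum h {..<p + n + (t + 1)}
      = (\<Sum>j<p. h j) + (\<Sum>u<n. h (p + u)) + (\<Sum>i\<le>t. h (p + n + i))" for h :: "nat \<Rightarrow> real"
    unfolding sum_lessThan_add by (simp add: lessThan_Suc_atMost[symmetric])
  have "(?X *\<^sub>v ?b) $ a = (\<Sum>j<p + n + (t + 1). ?X $$ (a, j) * ?b $ j)"
    using a nuisance_mat_carrier[of t n p d]
    by (auto simp: scalar_prod_def atLeast0LessThan intro!: sum.cong)
  also have "\<dots> = (\<Sum>j<p. if a mod p = j then \<alpha> j else 0)
      + (\<Sum>u<n. if a div p = u then \<beta> u else 0)
      + (\<Sum>i\<le>t. \<rho> i * carry_ind d i (a mod p) (a div p))"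
    unfolding split using nuisance_mat_index[OF a] by (intro arg_cong2[of _ _ _ _ "(+)"] sum.cong) auto
  also have "\<dots> = \<alpha> (a mod p) + \<beta> (a div p) + carry_comb t d \<rho> (a mod p) (a div p)"
    using m q by (simp add: carry_comb_def)
  finally show "(?X *\<^sub>v ?b) $ a = ?s $ a" using a by (simp add: stack_def)
qed (use nuisance_mat_carrier[of t n p d] in \<open>auto simp: stack_def\<close>)

lemma nuisance_mat_transpose_mult_eq_0:
  fixes z :: "nat \<Rightarrow> nat \<Rightarrow> real"
  assumes periods: "\<And>k. k < p \<Longrightarrow> (\<Sum>u<n. z k u) = 0"
    and units: "\<And>u. u < n \<Longrightarrow> (\<Sum>k<p. z k u) = 0"
    and carry: "\<And>i. i \<le> t \<Longrightarrow> (\<Sum>u<n. \<Sum>k<p. carry_ind d i k u * z k u) = 0"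
  shows "(nuisance_mat t n p d)\<^sup>T *\<^sub>v stack n p z = 0\<^sub>v (p + n + (t + 1))"
proof (rule eq_vecI)
  fix j assume "j < dim_vec (0\<^sub>v (p + n + (t + 1)) :: real vec)"
  hence j: "j < p + n + (t + 1)" by simp
  let ?X = "nuisance_mat t n p d"
  have sum: "(?X\<^sup>T *\<^sub>v stack n p z) $ j = (\<Sum>a<n * p. ?X $$ (a, j) * z (a mod p) (a div p))"
    using j nuisance_mat_carrier[of t n p d]
    by (auto simp: scalar_prod_def stack_def atLeast0LessThan intro!: sum.cong)
  consider (period) "j < p" | (unit) u where "u < n" "j = p + u" | (carry) i where "i \<le> t" "j = p + n + i"
  proof -
    assume a: "j < p \<Longrightarrow> thesis" "\<And>u. u < n \<Longrightarrow> j = p + u \<Longrightarrow> thesis"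
      "\<And>i. i \<le> t \<Longrightarrow> j = p + n + i \<Longrightarrow> thesis"
    show thesis
    proof (cases "j < p")
      case False
      show thesis
      proof (cases "j < p + n")
        case True
        thus thesis using False by (intro a(2)[of "j - p"]) auto
      next
        case False
        thus thesis using j by (intro a(3)[of "j - (p + n)"]) auto
      qed
    qed (rule a(1))
  qed
  hence "(\<Sum>a<n * p. ?X $$ (a, j) * z (a mod p) (a div p)) = 0"
  proof cases
    case period
    have "(\<Sum>a<n * p. ?X $$ (a, j) * z (a mod p) (a div p))
        = (\<Sum>a<n * p. if a mod p = j then z (a mod p) (a div p) else 0)"
      using period nuisance_mat_index(1) by (intro sum.cong) auto
    also have "\<dots> = (\<Sum>u<n. \<Sum>k<p. if k = j then z k u else 0)" by (rule sum_blocks)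
    also have "\<dots> = (\<Sum>u<n. z j u)" using period by simp
    finally show ?thesis using periods[OF period] by simp
  next
    case unit
    have "(\<Sum>a<n * p. ?X $$ (a, j) * z (a mod p) (a div p))
        = (\<Sum>a<n * p. if a div p = u then z (a mod p) (a div p) else 0)"
      using unit nuisance_mat_index(2) by (intro sum.cong) auto
    also have "\<dots> = (\<Sum>w<n. \<Sum>k<p. if w = u then z k w else 0)" by (rule sum_blocks)
    also have "\<dots> = (\<Sum>k<p. z k u)" using unit by (subst sum.swap) simp
    finally show ?thesis using units unit by simp
  next
    case carry
    have "(\<Sum>a<n * p. ?X $$ (a, j) * z (a mod p) (a div p))
        = (\<Sum>a<n * p. carry_ind d i (a mod p) (a div p) * z (a mod p) (a div p))"
      using carry nuisance_mat_index(3) by (intro sum.cong) auto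
    also have "\<dots> = (\<Sum>u<n. \<Sum>k<p. carry_ind d i k u * z k u)" by (rule sum_blocks)
    finally show ?thesis using assms(3) carry by simp
  qed
  thus "(?X\<^sup>T *\<^sub>v stack n p z) $ j = 0\<^sub>v (p + n + (t + 1)) $ j" using sum j by simp
qed (use nuisance_mat_carrier[of t n p d] in auto)

definition info_form :: "nat \<Rightarrow> nat \<Rightarrow> nat \<Rightarrow> design \<Rightarrow> (nat \<Rightarrow> real) \<Rightarrow> (nat \<Rightarrow> real) \<Rightarrow> real" where
  "info_form t n p d v w = (\<Sum>i\<le>t. \<Sum>j\<le>t. v i * info_mat t n p d $$ (i, j) * w j)"

lemma info_mat_carrier: "info_mat t n p d \<in> carrier_mat (t + 1) (t + 1)"
  using treatment_mat_carrier[of t n p d] proj_perp_carrier[OF nuisance_mat_carrier[of t n p d]]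
  unfolding info_mat_def nuisance_mat_def by auto

lemma info_mat_mult_vec:
  "info_mat t n p d *\<^sub>v vec (t + 1) w
   = (treatment_mat t n p d)\<^sup>T *\<^sub>v (proj_perp (nuisance_mat t n p d) *\<^sub>v stack n p (direct_comb t d w))"
proof -
  have Q: "proj_perp (nuisance_mat t n p d) \<in> carrier_mat (n * p) (n * p)"
    by (rule proj_perp_carrier[OF nuisance_mat_carrier])
  have T: "treatment_mat t n p d \<in> carrier_mat (n * p) (t + 1)" by (rule treatment_mat_carrier)
  show ?thesis
    unfolding info_mat_def nuisance_mat_def[symmetric] treatment_mat_mult_vec[symmetric]
    using Q T assoc_mult_mat_vec[of "(treatment_mat t n p d)\<^sup>T * proj_perp (nuisance_mat t n p d)" "t + 1" "n * p"
        "treatment_mat t n p d" "t + 1" "vec (t + 1) w"]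
      assoc_mult_mat_vec[of "(treatment_mat t n p d)\<^sup>T" "t + 1" "n * p" "proj_perp (nuisance_mat t n p d)" "n * p"
        "treatment_mat t n p d *\<^sub>v vec (t + 1) w"]
    by simp
qed

lemma info_form_eq:
  "info_form t n p d v w
   = stack n p (direct_comb t d v)
     \<bullet> (proj_perp (nuisance_mat t n p d) *\<^sub>v stack n p (direct_comb t d w))"
proof -
  let ?Q = "proj_perp (nuisance_mat t n p d)" and ?T = "treatment_mat t n p d"
  have Q: "?Q \<in> carrier_mat (n * p) (n * p)" by (rule proj_perp_carrier[OF nuisance_mat_carrier])
  have "info_form t n p d v w = vec (t + 1) v \<bullet> (info_mat t n p d *\<^sub>v vec (t + 1) w)"
    using info_mat_carrier[of t n p d] unfolding info_form_def
    by (auto simp: scalar_prod_def atLeast0LessThan lessThan_Suc_atMost sum_distrib_left mult.assoc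
        simp del: sum.lessThan_Suc sum.atMost_Suc intro!: sum.cong)
  also have "\<dots> = (info_mat t n p d *\<^sub>v vec (t + 1) w) \<bullet> vec (t + 1) v"
    using info_mat_carrier[of t n p d] by (intro comm_scalar_prod[of _ "t + 1"]) auto
  also have "\<dots> = (?Q *\<^sub>v stack n p (direct_comb t d w)) \<bullet> (?T *\<^sub>v vec (t + 1) v)"
    unfolding info_mat_mult_vec
    using Q treatment_mat_carrier[of t n p d] by (intro transpose_vec_mult_scalar) auto
  also have "\<dots> = stack n p (direct_comb t d v) \<bullet> (?Q *\<^sub>v stack n p (direct_comb t d w))"
    unfolding treatment_mat_mult_vec using Q by (intro comm_scalar_prod[of _ "n * p"]) auto
  finally show ?thesis .
qed

lemma info_form_commute: "info_form t n p d v w = info_form t n p d w v"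
proof -
  have Q: "proj_perp (nuisance_mat t n p d) \<in> carrier_mat (n * p) (n * p)"
    by (rule proj_perp_carrier[OF nuisance_mat_carrier])
  show ?thesis
    unfolding info_form_eq using Q
    by (subst proj_perp_self_adjoint[OF nuisance_mat_carrier]) (auto intro!: comm_scalar_prod[of _ "n * p"])
qed

lemma info_form_nonneg: "0 \<le> info_form t n p d v v"
  unfolding info_form_eq by (rule proj_perp_quadratic_nonneg[OF nuisance_mat_carrier]) simp

text \<open>
  The information in a linear combination of treatments is at most the residual sum of squares of
  any fit of it by period, unit and carryover effects. All upper bounds on information come from here.
\<close>

lemma info_form_le_residual:
  fixes \<alpha> \<beta> \<rho> :: "nat \<Rightarrow> real"
  shows "info_form t n p d v v
    \<le> (\<Sum>u<n. \<Sum>k<p. (direct_comb t d v k u + carry_comb t d \<rho> k u + \<alpha> k + \<beta> u)\<^sup>2)"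
proof -
  let ?X = "nuisance_mat t n p d"
  let ?b = "vec (p + n + (t + 1)) (\<lambda>j. if j < p then \<alpha> j else if j < p + n then \<beta> (j - p) else \<rho> (j - p - n))"
  have "info_form t n p d v v \<le> (stack n p (direct_comb t d v) + ?X *\<^sub>v ?b) \<bullet> (stack n p (direct_comb t d v) + ?X *\<^sub>v ?b)"
    unfolding info_form_eq by (rule proj_perp_least_squares[OF nuisance_mat_carrier]) auto
  also have "stack n p (direct_comb t d v) + ?X *\<^sub>v ?b
      = stack n p (\<lambda>k u. direct_comb t d v k u + carry_comb t d \<rho> k u + \<alpha> k + \<beta> u)"
    unfolding nuisance_mat_mult_vec by (auto simp: stack_def)
  finally show ?thesis unfolding stack_scalar_prod by (simp add: power2_eq_square)
qed

text \<open>
  Conversely, a fit whose residuals satisfy the normal equations is the projection itself, and so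
  yields the information exactly.
\<close>

lemma info_mat_via_normal_equations:
  fixes z :: "nat \<Rightarrow> nat \<Rightarrow> real" and \<alpha> \<beta> \<rho> :: "nat \<Rightarrow> real"
  assumes z: "\<And>k u. k < p \<Longrightarrow> u < n \<Longrightarrow> z k u = direct_comb t d v k u + carry_comb t d \<rho> k u + \<alpha> k + \<beta> u"
    and periods: "\<And>k. k < p \<Longrightarrow> (\<Sum>u<n. z k u) = 0"
    and units: "\<And>u. u < n \<Longrightarrow> (\<Sum>k<p. z k u) = 0"
    and carry: "\<And>i. i \<le> t \<Longrightarrow> (\<Sum>u<n. \<Sum>k<p. carry_ind d i k u * z k u) = 0"
    and i: "i \<le> t"
  shows "(\<Sum>j\<le>t. info_mat t n p d $$ (i, j) * v j) = (\<Sum>u<n. \<Sum>k<p. direct_ind d i k u * z k u)"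
proof -
  let ?X = "nuisance_mat t n p d"
  let ?b = "vec (p + n + (t + 1)) (\<lambda>j. if j < p then \<alpha> j else if j < p + n then \<beta> (j - p) else \<rho> (j - p - n))"
  let ?y = "stack n p (direct_comb t d v)"
  have Xb: "?X *\<^sub>v ?b \<in> carrier_vec (n * p)" unfolding nuisance_mat_mult_vec by simp
  have y: "?y + ?X *\<^sub>v ?b = stack n p z"
  proof (rule eq_vecI)
    fix a assume "a < dim_vec (stack n p z)"
    hence a: "a < n * p" by (simp add: stack_def)
    have p: "0 < p" using a by (cases "p = 0") auto
    have "a mod p < p" "a div p < n" using a p by (simp_all add: less_mult_imp_div_less)
    thus "(?y + ?X *\<^sub>v ?b) $ a = stack n p z $ a"
      using a z unfolding nuisance_mat_mult_vec by (simp add: stack_def)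
  qed (use nuisance_mat_carrier[of t n p d] in \<open>auto simp: stack_def\<close>)
  have Q: "proj_perp ?X \<in> carrier_mat (n * p) (n * p)" by (rule proj_perp_carrier[OF nuisance_mat_carrier])
  have "proj_perp ?X *\<^sub>v (?y + ?X *\<^sub>v ?b) = proj_perp ?X *\<^sub>v ?y + proj_perp ?X *\<^sub>v (?X *\<^sub>v ?b)"
    using Xb by (intro mult_add_distrib_mat_vec[OF Q]) auto
  also have "\<dots> = proj_perp ?X *\<^sub>v ?y + 0\<^sub>v (n * p)"
    by (subst proj_perp_annihilates[OF nuisance_mat_carrier]) auto
  also have "\<dots> = proj_perp ?X *\<^sub>v ?y" using Q by (intro right_zero_vec) auto
  finally have "proj_perp ?X *\<^sub>v ?y = proj_perp ?X *\<^sub>v (?y + ?X *\<^sub>v ?b)" ..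
  also have "\<dots> = stack n p z"
    unfolding y using nuisance_mat_transpose_mult_eq_0[OF periods units carry]
    by (intro proj_perp_fixes[OF nuisance_mat_carrier]) auto
  finally have Qy: "proj_perp ?X *\<^sub>v ?y = stack n p z" .
  have "(\<Sum>j\<le>t. info_mat t n p d $$ (i, j) * v j) = (info_mat t n p d *\<^sub>v vec (t + 1) v) $ i"
    using i info_mat_carrier[of t n p d]
    by (auto simp: scalar_prod_def atLeast0LessThan lessThan_Suc_atMost
        simp del: sum.lessThan_Suc sum.atMost_Suc intro!: sum.cong)
  also have "\<dots> = ((treatment_mat t n p d)\<^sup>T *\<^sub>v stack n p z) $ i"
    unfolding info_mat_mult_vec Qy ..
  also have "\<dots> = (\<Sum>a<n * p. treatment_mat t n p d $$ (a, i) * z (a mod p) (a div p))"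
    using i treatment_mat_carrier[of t n p d]
    by (auto simp: scalar_prod_def stack_def atLeast0LessThan intro!: sum.cong)
  also have "\<dots> = (\<Sum>a<n * p. direct_ind d i (a mod p) (a div p) * z (a mod p) (a div p))"
    using i treatment_mat_index by (intro sum.cong) auto
  also have "\<dots> = (\<Sum>u<n. \<Sum>k<p. direct_ind d i k u * z k u)" by (rule sum_blocks)
  finally show ?thesis .
qed

section \<open>Adjustment for periods and units\<close>

text \<open>
  The residual of the least squares fit of an array by period and unit effects, and the inner product
  of the residuals of two arrays.
\<close>

definition resid :: "nat \<Rightarrow> nat \<Rightarrow> (nat \<Rightarrow> nat \<Rightarrow> real) \<Rightarrow> nat \<Rightarrow> nat \<Rightarrow> real" where
  "resid n p z k u = z k u - (\<Sum>w<n. z k w) / n - (\<Sum>l<p. z l u) / p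
     + (\<Sum>w<n. \<Sum>l<p. z l w) / (real n * real p)"

definition adj_prod :: "nat \<Rightarrow> nat \<Rightarrow> (nat \<Rightarrow> nat \<Rightarrow> real) \<Rightarrow> (nat \<Rightarrow> nat \<Rightarrow> real) \<Rightarrow> real" where
  "adj_prod n p y z = (\<Sum>u<n. \<Sum>k<p. y k u * resid n p z k u)"

lemma adj_prod_cong:
  assumes "\<And>k u. k < p \<Longrightarrow> u < n \<Longrightarrow> y k u = y' k u" "\<And>k u. k < p \<Longrightarrow> u < n \<Longrightarrow> z k u = z' k u"
  shows "adj_prod n p y z = adj_prod n p y' z'"
proof -
  have "resid n p z k u = resid n p z' k u" if "k < p" "u < n" for k u
    unfolding resid_def using assms(2) that by simp
  thus ?thesis unfolding adj_prod_def using assms(1) by (intro sum.cong refl) auto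
qed

context
  fixes n p :: nat
  assumes n: "0 < n" and p: "0 < p"
begin

lemma resid_sum_units: "(\<Sum>u<n. resid n p z k u) = 0"
proof -
  have "(\<Sum>u<n. resid n p z k u) = (\<Sum>u<n. z k u) - (\<Sum>u<n. z k u)
      - (\<Sum>u<n. \<Sum>l<p. z l u) / p + n * ((\<Sum>u<n. \<Sum>l<p. z l u) / (real n * real p))"
    using n by (simp add: resid_def sum.distrib sum_subtractf sum_divide_distrib[symmetric])
  thus ?thesis using n by simp
qed

lemma resid_sum_periods: "(\<Sum>k<p. resid n p z k u) = 0"
proof -
  have "(\<Sum>k<p. resid n p z k u) = (\<Sum>k<p. z k u) - (\<Sum>k<p. \<Sum>w<n. z k w) / n
      - (\<Sum>k<p. z k u) + p * ((\<Sum>w<n. \<Sum>l<p. z l w) / (real n * real p))"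
    using p by (simp add: resid_def sum.distrib sum_subtractf sum_divide_distrib[symmetric])
  moreover have "(\<Sum>k<p. \<Sum>w<n. z k w) = (\<Sum>w<n. \<Sum>k<p. z k w)" by (rule sum.swap)
  ultimately show ?thesis using p by simp
qed

lemma adj_prod_add_effects:
  "adj_prod n p (\<lambda>k u. y k u + \<alpha> k + \<beta> u) z = adj_prod n p y z"
proof -
  have "(\<Sum>u<n. \<Sum>k<p. \<alpha> k * resid n p z k u) = (\<Sum>k<p. \<alpha> k * (\<Sum>u<n. resid n p z k u))"
    by (subst sum.swap) (simp add: sum_distrib_left)
  moreover have "(\<Sum>u<n. \<Sum>k<p. \<beta> u * resid n p z k u) = (\<Sum>u<n. \<beta> u * (\<Sum>k<p. resid n p z k u))"
    by (simp add: sum_distrib_left)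
  ultimately show ?thesis
    unfolding adj_prod_def by (simp add: distrib_right sum.distrib resid_sum_units resid_sum_periods)
qed

text \<open>In this form every term of an adjusted product of indicators is one of the counts of the design.\<close>

lemma adj_prod_eq:
  "adj_prod n p y z = (\<Sum>u<n. \<Sum>k<p. y k u * z k u)
     - (\<Sum>k<p. (\<Sum>u<n. y k u) * (\<Sum>u<n. z k u)) / n
     - (\<Sum>u<n. (\<Sum>k<p. y k u) * (\<Sum>k<p. z k u)) / p
     + (\<Sum>u<n. \<Sum>k<p. y k u) * (\<Sum>u<n. \<Sum>k<p. z k u) / (real n * real p)"
proof -
  have "(\<Sum>u<n. \<Sum>k<p. y k u * ((\<Sum>w<n. z k w) / n)) = (\<Sum>k<p. (\<Sum>u<n. y k u) * (\<Sum>u<n. z k u)) / n"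
    unfolding sum.swap[of _ "{..<p}"] sum_distrib_right[symmetric] sum_divide_distrib[of _ "{..<p}"] by simp
  moreover have "(\<Sum>u<n. \<Sum>k<p. y k u * ((\<Sum>l<p. z l u) / p)) = (\<Sum>u<n. (\<Sum>k<p. y k u) * (\<Sum>k<p. z k u)) / p"
    unfolding sum_distrib_right[symmetric] sum_divide_distrib[of _ "{..<n}"] by simp
  moreover have "(\<Sum>u<n. \<Sum>k<p. y k u * ((\<Sum>w<n. \<Sum>l<p. z l w) / (real n * real p)))
      = (\<Sum>u<n. \<Sum>k<p. y k u) * (\<Sum>u<n. \<Sum>k<p. z k u) / (real n * real p)"
    unfolding sum_distrib_right[symmetric] by simp
  ultimately show ?thesis
    unfolding adj_prod_def resid_def by (simp add: distrib_left right_diff_distrib sum.distrib sum_subtractf)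
qed

lemma adj_prod_commute: "adj_prod n p y z = adj_prod n p z y"
  unfolding adj_prod_eq by (simp add: mult.commute)

lemma adj_prod_self: "adj_prod n p z z = (\<Sum>u<n. \<Sum>k<p. (resid n p z k u)\<^sup>2)"
proof -
  have "resid n p z = (\<lambda>k u. z k u + (- (\<Sum>w<n. z k w) / n)
      + ((\<Sum>w<n. \<Sum>l<p. z l w) / (real n * real p) - (\<Sum>l<p. z l u) / p))"
    by (intro ext) (simp add: resid_def algebra_simps)
  hence "adj_prod n p (resid n p z) z = adj_prod n p z z"
    by (simp only: adj_prod_add_effects)
  thus ?thesis by (simp add: adj_prod_def power2_eq_square)
qed

lemma adj_prod_combine_left:
  "adj_prod n p (\<lambda>k u. a * y k u + b * y' k u) z = a * adj_prod n p y z + b * adj_prod n p y' z"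
  unfolding adj_prod_def by (simp add: sum_distrib_left distrib_right sum.distrib mult.assoc)

lemma adj_prod_combine_right:
  "adj_prod n p z (\<lambda>k u. a * y k u + b * y' k u) = a * adj_prod n p z y + b * adj_prod n p z y'"
  using adj_prod_combine_left[of a y b y' z] by (simp only: adj_prod_commute[of z])

lemma adj_prod_sum_left:
  "adj_prod n p (\<lambda>k u. \<Sum>i\<in>I. y i k u) z = (\<Sum>i\<in>I. adj_prod n p (y i) z)"
proof -
  have "adj_prod n p (\<lambda>k u. \<Sum>i\<in>I. y i k u) z = (\<Sum>u<n. \<Sum>i\<in>I. \<Sum>k<p. y i k u * resid n p z k u)"
    unfolding adj_prod_def sum_distrib_right by (intro sum.cong refl sum.swap)
  also have "\<dots> = (\<Sum>i\<in>I. adj_prod n p (y i) z)" unfolding adj_prod_def by (rule sum.swap)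
  finally show ?thesis .
qed

text \<open>
  Centring an array by periods and by units leaves the least residual for given carryover
  coefficients, so these are the period and unit effects that are fitted.
\<close>

lemma info_form_le_adj_prod:
  assumes "\<And>k u. y k u = direct_comb t d v k u + carry_comb t d \<rho> k u"
  shows "info_form t n p d v v \<le> adj_prod n p y y"
proof -
  have "info_form t n p d v v \<le> (\<Sum>u<n. \<Sum>k<p. (direct_comb t d v k u + carry_comb t d \<rho> k u
      + (- (\<Sum>w<n. y k w) / n)
      + ((\<Sum>w<n. \<Sum>l<p. y l w) / (real n * real p) - (\<Sum>l<p. y l u) / p))\<^sup>2)"
    by (rule info_form_le_residual)
  also have "\<dots> = adj_prod n p y y"
    unfolding adj_prod_self by (intro sum.cong refl arg_cong[of _ _ power2]) (simp add: resid_def assms[symmetric])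
  finally show ?thesis .
qed

lemma info_mat_via_adj_prod:
  assumes y: "\<And>k u. y k u = direct_comb t d v k u + carry_comb t d \<rho> k u"
    and orth: "\<And>i. i \<le> t \<Longrightarrow> adj_prod n p (carry_ind d i) y = 0"
    and i: "i \<le> t"
  shows "(\<Sum>j\<le>t. info_mat t n p d $$ (i, j) * v j) = adj_prod n p (direct_ind d i) y"
proof -
  have "(\<Sum>j\<le>t. info_mat t n p d $$ (i, j) * v j) = (\<Sum>u<n. \<Sum>k<p. direct_ind d i k u * resid n p y k u)"
  proof (rule info_mat_via_normal_equations[where \<rho> = \<rho> and \<alpha> = "\<lambda>k. - (\<Sum>w<n. y k w) / n"
        and \<beta> = "\<lambda>u. (\<Sum>w<n. \<Sum>l<p. y l w) / (real n * real p) - (\<Sum>l<p. y l u) / p"])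
    show "resid n p y k u = direct_comb t d v k u + carry_comb t d \<rho> k u + - (\<Sum>w<n. y k w) / n
        + ((\<Sum>w<n. \<Sum>l<p. y l w) / (real n * real p) - (\<Sum>l<p. y l u) / p)" for k u
      by (simp add: resid_def y[symmetric])
  qed (use orth i in \<open>auto simp: resid_sum_units resid_sum_periods adj_prod_def\<close>)
  thus ?thesis by (simp add: adj_prod_def)
qed

end


section \<open>Counts as sums of indicators\<close>

lemma real_card_eq_sum:
  "finite S \<Longrightarrow> real (card {x \<in> S. Q x}) = (\<Sum>x\<in>S. if Q x then 1 else 0)"
  by (simp add: sum.If_cases Int_def)

lemma sum_shift_1: "(\<Sum>k = 1..m. f k) = (\<Sum>k<m. f (Suc k))"
  by (simp add: sum.atLeast1_atMost_eq)

lemma unit_count_eq: "real (unit_count p d i (Suc u)) = (\<Sum>k<p. direct_ind d i k u)"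
  unfolding unit_count_def real_card_eq_sum[OF finite_atLeastAtMost] sum_shift_1 direct_ind_def ..

lemma unit_count_carry_eq: "real (unit_count (p - 1) d i (Suc u)) = (\<Sum>k<p. carry_ind d i k u)"
proof (cases p)
  case (Suc q)
  have "(\<Sum>k<Suc q. carry_ind d i k u) = carry_ind d i 0 u + (\<Sum>k<q. carry_ind d i (Suc k) u)"
    by (rule sum.lessThan_Suc_shift)
  thus ?thesis using Suc unfolding unit_count_eq by (simp add: direct_ind_def carry_ind_def)
qed (simp add: unit_count_def)

lemma period_count_eq: "real (period_count n d i (Suc k)) = (\<Sum>u<n. direct_ind d i k u)"
  unfolding period_count_def real_card_eq_sum[OF finite_atLeastAtMost] sum_shift_1 direct_ind_def ..

lemma period_count_carry_eq:
  "(\<Sum>u<n. carry_ind d i k u) = (if 0 < k then real (period_count n d i k) else 0)"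
  unfolding period_count_def real_card_eq_sum[OF finite_atLeastAtMost] sum_shift_1 carry_ind_def
  by simp

lemma replication_eq: "real (replication n p d i) = (\<Sum>u<n. \<Sum>k<p. direct_ind d i k u)"
  unfolding replication_def of_nat_sum sum_shift_1 unit_count_eq ..

lemma replication_carry_eq: "real (replication n (p - 1) d i) = (\<Sum>u<n. \<Sum>k<p. carry_ind d i k u)"
  unfolding replication_def of_nat_sum sum_shift_1 unit_count_carry_eq ..

lemma replication_by_periods:
  "real (replication n p d i) = (\<Sum>k<p. real (period_count n d i (Suc k)))"
  unfolding replication_eq period_count_eq by (rule sum.swap)

lemma preceded_count_eq:
  "real (preceded_count n p d i j) = (\<Sum>u<n. \<Sum>k<p. direct_ind d i k u * carry_ind d j k u)"
proof -
  have "{(k, u). k \<in> {2..p} \<and> u \<in> {1..n} \<and> d (k, u) = i \<and> d (k - 1, u) = j}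
     = {x \<in> {2..p} \<times> {1..n}. d (fst x, snd x) = i \<and> d (fst x - 1, snd x) = j}" by auto
  hence "real (preceded_count n p d i j)
      = (\<Sum>x\<in>{2..p} \<times> {1..n}. if d (fst x, snd x) = i \<and> d (fst x - 1, snd x) = j then 1 else 0)"
    unfolding preceded_count_def by (simp add: real_card_eq_sum)
  also have "\<dots> = (\<Sum>k\<in>{2..p}. \<Sum>u\<in>{1..n}. if d (k, u) = i \<and> d (k - 1, u) = j then 1 else 0)"
    by (simp add: sum.cartesian_product case_prod_unfold)
  also have "\<dots> = (\<Sum>k\<in>{1..p}. \<Sum>u\<in>{1..n}. if 1 < k \<and> d (k, u) = i \<and> d (k - 1, u) = j then 1 else 0)"
    by (rule sum.mono_neutral_cong_left) auto
  also have "\<dots> = (\<Sum>k<p. \<Sum>u<n. direct_ind d i k u * carry_ind d j k u)"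
    unfolding sum_shift_1 by (intro sum.cong) (auto simp: direct_ind_def carry_ind_def)
  finally show ?thesis by (simp add: sum.swap[of _ "{..<n}"])
qed

lemma direct_direct_sum:
  "(\<Sum>u<n. \<Sum>k<p. direct_ind d i k u * direct_ind d j k u) = (if i = j then real (replication n p d i) else 0)"
  unfolding replication_eq by (auto simp: direct_ind_def intro!: sum.cong sum.neutral)

lemma carry_carry_sum:
  "(\<Sum>u<n. \<Sum>k<p. carry_ind d i k u * carry_ind d j k u) = (if i = j then real (replication n (p - 1) d i) else 0)"
  unfolding replication_carry_eq by (auto simp: carry_ind_def intro!: sum.cong sum.neutral)

context
  fixes t n p :: nat and d :: design
  assumes d: "d \<in> designs t n p"
begin

lemma designs_le: "k < p \<Longrightarrow> u < n \<Longrightarrow> d (Suc k, Suc u) \<le> t"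
  using d unfolding designs_def by (auto dest!: PiE_mem[where x = "(Suc k, Suc u)"])

lemma direct_ind_total: "k < p \<Longrightarrow> u < n \<Longrightarrow> (\<Sum>i\<le>t. direct_ind d i k u) = 1"
  using designs_le[of k u] by (simp add: direct_ind_def)

lemma carry_ind_total: "k < p \<Longrightarrow> u < n \<Longrightarrow> (\<Sum>i\<le>t. carry_ind d i k u) = (if 0 < k then 1 else 0)"
  using designs_le[of "k - 1" u] by (cases k) (auto simp: carry_ind_def)

end

lemma adj_prod_direct_direct:
  assumes "0 < n" "0 < p"
  shows "adj_prod n p (direct_ind d i) (direct_ind d j)
    = (if i = j then real (replication n p d i) else 0)
      - (\<Sum>k<p. real (period_count n d i (Suc k)) * real (period_count n d j (Suc k))) / n
      - (\<Sum>u<n. real (unit_count p d i (Suc u)) * real (unit_count p d j (Suc u))) / p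
      + real (replication n p d i) * real (replication n p d j) / (real n * real p)"
  unfolding adj_prod_eq[OF assms] direct_direct_sum period_count_eq unit_count_eq replication_eq ..

lemma adj_prod_direct_carry:
  assumes "0 < n" "0 < p"
  shows "adj_prod n p (direct_ind d i) (carry_ind d j)
    = real (preceded_count n p d i j)
      - (\<Sum>k<p. real (period_count n d i (Suc k)) * (if 0 < k then real (period_count n d j k) else 0)) / n
      - (\<Sum>u<n. real (unit_count p d i (Suc u)) * real (unit_count (p - 1) d j (Suc u))) / p
      + real (replication n p d i) * real (replication n (p - 1) d j) / (real n * real p)"
  unfolding adj_prod_eq[OF assms] preceded_count_eq period_count_carry_eq
    unit_count_carry_eq replication_carry_eq
  by (simp add: period_count_eq unit_count_eq replication_eq)

lemma adj_prod_carry_carry: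
  assumes "0 < n" "0 < p"
  shows "adj_prod n p (carry_ind d i) (carry_ind d j)
    = (if i = j then real (replication n (p - 1) d i) else 0)
      - (\<Sum>k<p. (if 0 < k then real (period_count n d i k) else 0)
                * (if 0 < k then real (period_count n d j k) else 0)) / n
      - (\<Sum>u<n. real (unit_count (p - 1) d i (Suc u)) * real (unit_count (p - 1) d j (Suc u))) / p
      + real (replication n (p - 1) d i) * real (replication n (p - 1) d j) / (real n * real p)"
  unfolding adj_prod_eq[OF assms] carry_carry_sum period_count_carry_eq
    unit_count_carry_eq replication_carry_eq
  by simp

section \<open>Comparing the two parts of the criterion\<close>

text \<open>
  Here \<open>A\<close>, \<open>B\<close>, \<open>C\<close> stand for the minima in \<open>f\<close>; \<open>c\<close> and \<open>e\<close> are
  the optimal coefficients of the two fits, and \<open>x\<close> and \<open>y\<close> become \<open>x\<^sub>1(r)\<close> and \<open>y\<^sub>1(r)\<close>. The share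
  \<open>s\<close> of the control among all observations is the natural parameter. The quantities \<open>U\<close>, \<open>V\<close>, \<open>c0\<close>,
  \<open>e0\<close> are what \<open>u / m\<close>, \<open>v / m\<close>, \<open>c\<close>, \<open>e\<close> become in the extreme case \<open>A = r\<close>, \<open>B = C = rt\<close>, where the control
  occurs at most once in each unit.
\<close>

locale criterion_arith =
  fixes T P N r A B C rt S u v w X Y m s :: real
  assumes P: "3 \<le> P" and T: "P - 1 \<le> T" and N: "0 < N" and r: "0 < r" and half: "2 * r \<le> N * P"
    and rt: "rt = (P - 1) / P * r"
    and A: "r \<le> A" and B: "rt \<le> B" "B \<le> (P - 1) * rt" and C: "rt \<le> C" "C \<le> (P - 2) * rt"
    and S: "S = N * (P - 1) - rt" and u: "u = T * S - B"
    and v: "v = N * (P - 1) * (P * T - T - 1) - (P * T - T + P - 2) * rt + C"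
    and w: "w = P * rt - rt\<^sup>2 / (N * (P - 1)) - C"
    and m_def: "m = N * (P - 1)" and s_def: "s = rt / m"
    and Y: "Y = P * r - A" and X: "X = T * (P - 1) * (N * P - r) - Y"
begin

definition U where "U = T * (1 - s) - s"
definition V where "V = (T * (P - 1) - 1) - (T * (P - 1) + P - 3) * s"

lemma m: "0 < m" using N P by (simp add: m_def)

lemma rt_eq: "rt = s * m" using m by (simp add: s_def)

lemma s: "0 < s" "s \<le> 1 / 2"
proof -
  have "0 < rt" unfolding rt using P r by simp
  thus "0 < s" unfolding s_def using m by simp
  have "P * (2 * rt) = (P - 1) * (2 * r)" unfolding rt using P by simp
  also have "\<dots> \<le> (P - 1) * (N * P)" using half P by (intro mult_left_mono) auto
  finally have "P * (2 * rt) \<le> P * m" by (simp add: m_def algebra_simps)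
  hence "2 * rt \<le> m" using P by simp
  thus "s \<le> 1 / 2" unfolding s_def using m by (simp add: field_simps)
qed

lemma T2: "2 \<le> T" using P T by simp

lemma U_pos: "0 < U"
proof -
  have "T * s \<le> T * (1 / 2)" using s T2 by (intro mult_left_mono) auto
  thus ?thesis unfolding U_def right_diff_distrib using s T2 by linarith
qed

lemma U_ge: "(T - 1) * s \<le> U"
proof -
  have "T * s \<le> T * (1 - s)" using s T2 by (intro mult_left_mono) auto
  thus ?thesis unfolding U_def by (simp add: algebra_simps)
qed

lemma V_eq: "V = (P - 1) * U - (1 - 2 * s)"
  unfolding V_def U_def by (simp add: algebra_simps)

text \<open>
  Both comparisons of \<open>x\<close> with \<open>y\<close> come down to this polynomial inequality of the extreme case. The
  difference of its sides is a sum of terms that are nonnegative for \<open>s \<le> 1/2\<close>.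
\<close>

lemma key_product: "(T - 1) * s * (P * (P - 1 - s) - 1) \<le> P * V - U"
proof -
  have "T * (P * P - P - 1) - P \<ge> 0"
  proof -
    have "3 * P \<le> P * P" using P by simp
    hence "P \<le> P * P - P - 1" using P by linarith
    moreover have "P * P - P - 1 \<le> T * (P * P - P - 1)"
      using T2 P \<open>P \<le> P * P - P - 1\<close> mult_right_mono[of 1 T "P * P - P - 1"] by simp
    ultimately show ?thesis by linarith
  qed
  hence "0 \<le> (1 - 2 * s) * (T * (P * P - P - 1) - P) + (T - 1) * P * (s * s)"
    using s T2 P by (intro add_nonneg_nonneg mult_nonneg_nonneg) auto
  also have "\<dots> = (P * V - U) - (T - 1) * s * (P * (P - 1 - s) - 1)"
    unfolding V_eq U_def by (simp add: algebra_simps)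
  finally show ?thesis by simp
qed

lemma E_pos: "0 < P - 1 - s" using P s by simp

lemma PE: "1 < P * (P - 1 - s)"
proof -
  have "3 * (3 / 2) \<le> P * (P - 1 - s)" using P s by (intro mult_mono) auto
  thus ?thesis by simp
qed

lemma UPV: "U < P * V"
proof -
  have "0 < (T - 1) * s * (P * (P - 1 - s) - 1)" using PE s T2 by simp
  thus ?thesis using key_product by linarith
qed

lemma V_pos: "0 < V"
proof -
  have "0 < P * V" using UPV U_pos by linarith
  thus ?thesis using P by (simp add: zero_less_mult_iff)
qed

lemma w_bounds: "0 < w" "w \<le> s * m * (P - 1 - s)"
proof -
  have eq: "w = P * (s * m) - s * s * m - C"
    unfolding w m_def[symmetric] rt_eq using m by (simp add: power2_eq_square)
  have "C \<le> (P - 2) * (s * m)" using C(2) unfolding rt_eq .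
  hence "(2 - s) * (s * m) \<le> w" unfolding eq by (simp add: algebra_simps)
  moreover have "0 < (2 - s) * (s * m)" using s m by simp
  ultimately show "0 < w" by linarith
  show "w \<le> s * m * (P - 1 - s)" unfolding eq using C(1) rt_eq by (simp add: algebra_simps)
qed

lemma v_ge: "m * V \<le> v"
proof -
  have "m * V = m * (P * T - T - 1) - (P * T - T + P - 2) * rt + rt"
    unfolding V_def rt_eq by (simp add: algebra_simps)
  thus ?thesis unfolding v m_def[symmetric] using C(1) by linarith
qed

lemma v_pos: "0 < v"
proof -
  have "0 < m * V" using m V_pos by simp
  thus ?thesis using v_ge by linarith
qed

lemma S_eq: "S = m * (1 - s)" unfolding S m_def[symmetric] rt_eq by (simp add: algebra_simps)

lemma u_bounds: "0 \<le> u" "u \<le> m * U"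
proof -
  have "(P - 1) * (s * m) \<le> T * ((1 - s) * m)"
    using T s m P by (intro mult_mono) auto
  thus "0 \<le> u" unfolding u S_eq using B(2) rt_eq by (simp add: algebra_simps)
  show "u \<le> m * U" unfolding u S_eq U_def using B(1) rt_eq by (simp add: algebra_simps)
qed

definition c where "c = u / v"
definition e where "e = B / w"
definition x where "x = X - u\<^sup>2 / v"
definition y where "y = Y - B\<^sup>2 / w"
definition c0 where "c0 = U / V"
definition e0 where "e0 = 1 / (P - 1 - s)"

lemma c_bounds: "0 \<le> c" "c \<le> c0"
proof -
  show "0 \<le> c" unfolding c_def using u_bounds v_pos by simp
  have "u / v \<le> (m * U) / (m * V)"
    using u_bounds v_ge v_pos m U_pos V_pos by (intro frac_le) auto
  thus "c \<le> c0" unfolding c_def c0_def using m by simp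
qed

lemma e_ge: "e0 \<le> e" "0 < e0"
proof -
  have "(s * m) / (s * m * (P - 1 - s)) \<le> B / w"
    using w_bounds B(1) rt_eq mult_pos_pos[OF s(1) m] by (intro frac_le) auto
  thus "e0 \<le> e" unfolding e0_def e_def using s m by simp
  show "0 < e0" unfolding e0_def using E_pos by simp
qed

lemma P_c0: "0 < P - c0" unfolding c0_def using UPV V_pos by (simp add: field_simps)

lemma P_e0: "0 < P - e0" unfolding e0_def using PE E_pos by (simp add: field_simps)

lemma r_eq: "(P - 1) * r = P * (s * m)"
  unfolding rt_eq[symmetric] rt using P by simp

lemma x_ge: "m * U * (P - c0) \<le> x"
proof -
  have uc: "u\<^sup>2 / v = c * u" unfolding c_def by (simp add: power2_eq_square)
  have "c * u \<le> c0 * (m * U)" using c_bounds u_bounds m U_pos by (intro mult_mono) auto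
  moreover have "m * U * P \<le> X"
  proof -
    have "Y \<le> (P - 1) * r" unfolding Y using A by (simp add: algebra_simps)
    moreover have "(P - 1) * (N * P - r) = P * m - P * (s * m)"
      using r_eq by (simp add: m_def algebra_simps)
    hence "T * (P - 1) * (N * P - r) = T * (P * m - P * (s * m))" by (simp add: mult.assoc)
    ultimately show ?thesis unfolding X U_def using r_eq by (simp add: algebra_simps)
  qed
  ultimately show ?thesis unfolding x_def uc by (simp add: algebra_simps)
qed

lemma x_pos: "0 < x"
proof -
  have "0 < m * U * (P - c0)" using m U_pos P_c0 by simp
  thus ?thesis using x_ge by linarith
qed

lemma y_le: "y \<le> s * m * (P - e0)"
proof -
  have "B\<^sup>2 / w = e * B" unfolding e_def by (simp add: power2_eq_square)
  moreover have "e0 * (s * m) \<le> e * B" using e_ge B(1) rt_eq s m by (intro mult_mono) auto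
  moreover have "Y \<le> P * (s * m)" unfolding Y using A r_eq by (simp add: algebra_simps)
  ultimately show ?thesis unfolding y_def by (simp add: algebra_simps)
qed

lemma base_ratio: "c0 * ((T - 1) * s * (P - e0)) \<le> e0 * (U * (P - c0))"
proof -
  have "c0 * ((T - 1) * s * (P - e0)) = U / (V * (P - 1 - s)) * ((T - 1) * s * (P * (P - 1 - s) - 1))"
    unfolding c0_def e0_def using E_pos V_pos by (simp add: field_simps)
  also have "\<dots> \<le> U / (V * (P - 1 - s)) * (P * V - U)"
    using key_product U_pos V_pos E_pos by (intro mult_left_mono) auto
  also have "\<dots> = e0 * (U * (P - c0))"
    unfolding c0_def e0_def using E_pos V_pos by (simp add: field_simps)
  finally show ?thesis .
qed

text \<open>
  If \<open>c0 \<le> e0\<close>, both factors can be compared separately; otherwise the previous inequality is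
  stronger than the claim.
\<close>

lemma base_le: "(T - 1) * s * (P - e0) \<le> U * (P - c0)"
proof (cases "c0 \<le> e0")
  case True
  thus ?thesis using U_ge U_pos P_c0 P_e0 by (intro mult_mono) auto
next
  case False
  have "c0 * ((T - 1) * s * (P - e0)) \<le> c0 * (U * (P - c0))"
    using base_ratio False U_pos P_c0 by (smt (verit) mult_nonneg_nonneg mult_right_mono)
  thus ?thesis using False e_ge by simp
qed

lemma control_le_contrast: "(T - 1) * y \<le> x"
proof -
  have "(T - 1) * y \<le> (T - 1) * (s * m * (P - e0))" using y_le T2 by (intro mult_left_mono) auto
  also have "\<dots> = m * ((T - 1) * s * (P - e0))" by (simp add: algebra_simps)
  also have "\<dots> \<le> m * (U * (P - c0))" using base_le m by (intro mult_left_mono) auto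
  finally show ?thesis using x_ge by (simp add: mult.assoc)
qed

lemma control_le_contrast_weighted: "c * ((T - 1) * y) \<le> e * x"
proof (cases "0 \<le> y")
  case True
  have "c * ((T - 1) * y) \<le> c0 * ((T - 1) * (s * m * (P - e0)))"
    using True c_bounds y_le T2 by (intro mult_mono) auto
  also have "\<dots> = m * (c0 * ((T - 1) * s * (P - e0)))" by (simp add: algebra_simps)
  also have "\<dots> \<le> m * (e0 * (U * (P - c0)))" using base_ratio m by (intro mult_left_mono) auto
  also have "\<dots> = e0 * (m * U * (P - c0))" by (simp add: algebra_simps)
  also have "\<dots> \<le> e * x" using e_ge x_ge m U_pos P_c0 by (intro mult_mono) auto
  finally show ?thesis .
next
  case False
  have "(T - 1) * y \<le> 0" using False T2 by (simp add: mult_le_0_iff)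
  hence "c * ((T - 1) * y) \<le> 0" using c_bounds by (simp add: mult_le_0_iff)
  moreover have "0 \<le> e * x" using e_ge x_pos by simp
  ultimately show ?thesis by linarith
qed

text \<open>At its optimal coefficient the bound for the control can only drop when the three sums grow.\<close>

lemma control_bound:
  assumes A': "A \<le> A'" and B': "B \<le> B'" and C': "C \<le> C'"
    and yd: "yd \<le> (Y - (A' - A)) - 2 * e * B' + e\<^sup>2 * (w - (C' - C))"
  shows "yd \<le> y - ((A' - A) + 2 * e * (B' - B) + e\<^sup>2 * (C' - C))" "yd \<le> y"
proof -
  have "e * w = B" unfolding e_def using w_bounds by simp
  hence ee: "e\<^sup>2 * w = e * B" "B\<^sup>2 / w = e * B" by (simp_all add: e_def power2_eq_square)
  show le: "yd \<le> y - ((A' - A) + 2 * e * (B' - B) + e\<^sup>2 * (C' - C))"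
    using yd unfolding y_def using ee by (simp add: algebra_simps)
  have "0 \<le> e" using e_ge by linarith
  hence "0 \<le> (A' - A) + 2 * e * (B' - B) + e\<^sup>2 * (C' - C)"
    using A' B' C' by (intro add_nonneg_nonneg mult_nonneg_nonneg) auto
  thus "yd \<le> y" using le by linarith
qed

text \<open>
  Replacing the minima \<open>A\<close>, \<open>B\<close>, \<open>C\<close> by larger values raises the bound for the test contrasts and
  lowers the one for the control. The comparisons of \<open>x\<close> and \<open>y\<close> above say that at the optimal
  weights \<open>m1\<close>, \<open>m0\<close> the loss for the control dominates.
\<close>

lemma tangent_bound:
  assumes y: "0 < y"
    and A': "A \<le> A'" and B': "B \<le> B'" and C': "C \<le> C'"
    and xd: "xd \<le> (X + (A' - A)) - 2 * c * (u - (B' - B)) + c\<^sup>2 * (v + (C' - C))"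
    and yd: "yd \<le> (Y - (A' - A)) - 2 * e * B' + e\<^sup>2 * (w - (C' - C))"
    and m1: "m1 = T * P * (T - 1) / x" and m0: "m0 = T * P / y"
  shows "(T - 1) * m1 + m0
    \<le> 2 * (T - 1) * m1 + 2 * m0 - m1\<^sup>2 * xd / (T * P) - m0\<^sup>2 * yd / (T * P)"
proof -
  define \<delta>x where "\<delta>x = (A' - A) + 2 * c * (B' - B) + c\<^sup>2 * (C' - C)"
  define \<delta>y where "\<delta>y = (A' - A) + 2 * e * (B' - B) + e\<^sup>2 * (C' - C)"
  have TP: "0 < T * P" using T2 P by simp
  have "c * v = u" unfolding c_def using v_pos by simp
  hence cc: "c\<^sup>2 * v = c * u" "u\<^sup>2 / v = c * u" by (simp_all add: c_def power2_eq_square)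
  have xd': "xd \<le> x + \<delta>x" using xd unfolding x_def \<delta>x_def using cc by (simp add: algebra_simps)
  have yd': "yd \<le> y - \<delta>y" unfolding \<delta>y_def by (rule control_bound(1)[OF A' B' C' yd])
  have m1_pos: "0 < m1" and m0_pos: "0 < m0" unfolding m1 m0 using x_pos y TP T2 by auto
  have m1x: "m1 * x = T * P * (T - 1)" and m0y: "m0 * y = T * P" unfolding m1 m0 using x_pos y by auto
  have m1m0: "m1 \<le> m0"
    unfolding m1 m0 using control_le_contrast x_pos y TP mult_left_mono[of "(T - 1) * y" x "T * P"]
    by (simp add: field_simps)
  have cm: "c * m1 \<le> e * m0"
    unfolding m1 m0 using control_le_contrast_weighted x_pos y TP
      mult_left_mono[of "c * ((T - 1) * y)" "e * x" "T * P"]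
    by (simp add: field_simps)
  have e_nonneg: "0 \<le> e" using e_ge by linarith
  have "m1\<^sup>2 * \<delta>x \<le> m0\<^sup>2 * \<delta>y"
  proof -
    have "m1\<^sup>2 * (A' - A) \<le> m0\<^sup>2 * (A' - A)"
      using m1m0 m1_pos A' by (intro mult_right_mono power_mono) auto
    moreover have "(c * m1) * m1 * (B' - B) \<le> (e * m0) * m0 * (B' - B)"
      using mult_mono[OF cm m1m0] m1_pos m0_pos e_nonneg B' by (intro mult_right_mono) auto
    moreover have "(c * m1)\<^sup>2 * (C' - C) \<le> (e * m0)\<^sup>2 * (C' - C)"
      using cm m1_pos c_bounds C' by (intro mult_right_mono power_mono) auto
    ultimately show ?thesis
      unfolding \<delta>x_def \<delta>y_def by (simp add: algebra_simps power2_eq_square power_mult_distrib)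
  qed
  moreover have "m1\<^sup>2 * xd \<le> m1\<^sup>2 * (x + \<delta>x)" using xd' by (intro mult_left_mono) auto
  moreover have "m0\<^sup>2 * yd \<le> m0\<^sup>2 * (y - \<delta>y)" using yd' by (intro mult_left_mono) auto
  moreover have "m1\<^sup>2 * x = T * P * ((T - 1) * m1)" unfolding power2_eq_square mult.assoc[of m1] m1x by simp
  moreover have "m0\<^sup>2 * y = T * P * m0" unfolding power2_eq_square mult.assoc[of m0] m0y by simp
  ultimately have "m1\<^sup>2 * xd + m0\<^sup>2 * yd \<le> T * P * ((T - 1) * m1 + m0)"
    by (simp add: algebra_simps)
  hence "(m1\<^sup>2 * xd + m0\<^sup>2 * yd) / (T * P) \<le> (T - 1) * m1 + m0"
    using TP by (simp add: pos_divide_le_eq mult.commute)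
  thus ?thesis unfolding add_divide_distrib mult.assoc[of 2] by linarith
qed

end

section \<open>Linear algebra of the information form\<close>

lemma info_form_combine_left:
  "info_form t n p d (\<lambda>j. a * g j + b * h j) f = a * info_form t n p d g f + b * info_form t n p d h f"
  unfolding info_form_def by (simp add: sum_distrib_left distrib_right sum.distrib mult.assoc)

lemma info_form_combine_right:
  "info_form t n p d f (\<lambda>j. a * g j + b * h j) = a * info_form t n p d f g + b * info_form t n p d f h"
  using info_form_combine_left[of t n p d a g b h f] by (simp only: info_form_commute[of t n p d f])

lemma info_form_combine:
  "info_form t n p d (\<lambda>j. a * g j + b * h j) (\<lambda>j. a * g j + b * h j)
   = a\<^sup>2 * info_form t n p d g g + 2 * a * b * info_form t n p d g h + b\<^sup>2 * info_form t n p d h h"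
  unfolding info_form_combine_left info_form_combine_right info_form_commute[of t n p d h g]
  by (simp add: power2_eq_square algebra_simps)

lemma info_form_sum_left:
  "info_form t n p d (\<lambda>j. \<Sum>i\<in>I. g i j) f = (\<Sum>i\<in>I. info_form t n p d (g i) f)"
proof -
  have "info_form t n p d (\<lambda>j. \<Sum>i\<in>I. g i j) f
      = (\<Sum>j\<le>t. \<Sum>i\<in>I. \<Sum>k\<le>t. g i j * info_mat t n p d $$ (j, k) * f k)"
    unfolding info_form_def sum_distrib_right by (intro sum.cong refl sum.swap)
  also have "\<dots> = (\<Sum>i\<in>I. info_form t n p d (g i) f)" unfolding info_form_def by (rule sum.swap)
  finally show ?thesis .
qed

text \<open>The sum of all treatment indicators is constant, hence fitted without residual.\<close>

lemma info_mat_row_sum: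
  assumes d: "d \<in> designs t n p" and n: "0 < n" and p: "0 < p" and i: "i \<le> t"
  shows "(\<Sum>j\<le>t. info_mat t n p d $$ (i, j)) = 0"
proof -
  define y where "y = (\<lambda>k u. direct_comb t d (\<lambda>_. 1) k u + carry_comb t d (\<lambda>_. 0) k u)"
  have y1: "y k u = 0 + (\<lambda>_. 1) k + (\<lambda>_. 0) u" if "k < p" "u < n" for k u
    unfolding y_def direct_comb_def carry_comb_def using direct_ind_total[OF d that] by simp
  have 0: "adj_prod n p z y = 0" for z
  proof -
    have "adj_prod n p z y = adj_prod n p z (\<lambda>k u. 0 + (\<lambda>_. 1) k + (\<lambda>_. 0) u)"
      using y1 by (intro adj_prod_cong) auto
    also have "\<dots> = adj_prod n p (\<lambda>_ _. 0) z"
      unfolding adj_prod_commute[OF n p, of z] by (rule adj_prod_add_effects[OF n p])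
    also have "\<dots> = 0" by (simp add: adj_prod_def)
    finally show ?thesis .
  qed
  have "(\<Sum>j\<le>t. info_mat t n p d $$ (i, j) * 1) = adj_prod n p (direct_ind d i) y"
    by (rule info_mat_via_adj_prod[OF n p, where \<rho> = "\<lambda>_. 0"]) (use 0 i in \<open>auto simp: y_def\<close>)
  thus ?thesis using 0 by simp
qed

definition control :: "nat \<Rightarrow> real" where
  "control j = (if j = 0 then 1 else 0)"

definition test_contrast :: "nat \<Rightarrow> nat \<Rightarrow> nat \<Rightarrow> real" where
  "test_contrast t i j = (if j = 0 then 0 else (if j = i then 1 else 0) - 1 / real t)"

text \<open>
  The quantities \<open>x\<^sub>d\<close> and \<open>y\<^sub>d\<close>: when the information matrix does not distinguish the tests, they are
  \<open>t (t - 1) p\<close> and \<open>t p\<close> times the two eigenvalues of \<open>M\<close>.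
\<close>

definition contrast_info :: "nat \<Rightarrow> nat \<Rightarrow> nat \<Rightarrow> design \<Rightarrow> real" where
  "contrast_info t n p d
     = real t * real p * (\<Sum>i = 1..t. info_form t n p d (test_contrast t i) (test_contrast t i))"

definition control_info :: "nat \<Rightarrow> nat \<Rightarrow> nat \<Rightarrow> design \<Rightarrow> real" where
  "control_info t n p d = real p * info_form t n p d control control"

lemma sum_atMost_split: "(\<Sum>j\<le>t. f j) = f 0 + (\<Sum>j = 1..t. f j)" for f :: "nat \<Rightarrow> real"
  unfolding sum_shift_1 by (simp add: lessThan_Suc_atMost[symmetric] sum.lessThan_Suc_shift del: sum.lessThan_Suc)

lemma control_info_mat_index:
  assumes "i \<in> {1..t}" "j \<in> {1..t}"
  shows "control_info_mat t n p d $$ (i - 1, j - 1) = info_mat t n p d $$ (i, j)"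
proof -
  have "mat_delete (info_mat t n p d) 0 0 $$ (i - 1, j - 1)
      = info_mat t n p d $$ (insert_index 0 (i - 1), insert_index 0 (j - 1))"
    using assms by (intro mat_delete_index[symmetric, OF _ _ _ _ _] ) (use info_mat_carrier[of t n p d] in auto)
  thus ?thesis unfolding control_info_mat_def using assms by simp
qed

lemma control_info_mat_carrier: "control_info_mat t n p d \<in> carrier_mat t t"
  unfolding control_info_mat_def using mat_delete_carrier[OF info_mat_carrier[of t n p d], of 0 0] by simp

text \<open>
  For \<open>z = V e\<^sub>i\<close> and any \<open>g\<close> the form of \<open>g - z\<close> is nonnegative, which bounds \<open>V\<^sub>i\<^sub>i\<close> below by
  \<open>2 g\<^sub>i\<close> minus the form of \<open>g\<close>. Taking for \<open>g\<close> the columns of a completely symmetric matrix with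
  eigenvalues \<open>m1\<close> and \<open>m0\<close> and summing over \<open>i\<close> gives a bound that is linear in the information.
  It replaces a convexity argument about the trace of the inverse under relabelling of the tests.
\<close>

lemma trace_inverse_tangent:
  fixes m0 m1 :: real
  assumes d: "d \<in> designs t n p" and n: "0 < n" and p: "0 < p" and t: "0 < t"
    and inv: "mat_inverse (control_info_mat t n p d) = Some V"
  shows "2 * (real t - 1) * m1 + 2 * m0 - m1\<^sup>2 * contrast_info t n p d / (real t * real p)
      - m0\<^sup>2 * control_info t n p d / (real t * real p) \<le> (\<Sum>i<t. V $$ (i, i))"
proof -
  let ?Q = "info_form t n p d" and ?C = "info_mat t n p d" and ?M = "control_info_mat t n p d"
  have MV: "?M * V = 1\<^sub>m t" and V: "V \<in> carrier_mat t t"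
    using mat_inverse(2)[OF control_info_mat_carrier inv] by auto
  define z where "z = (\<lambda>i j. if j = 0 then 0 else V $$ (j - 1, i - 1))"
  have Mz: "(\<Sum>j\<le>t. ?C $$ (k, j) * z i j) = (if k = i then 1 else 0)" if "k \<in> {1..t}" "i \<in> {1..t}" for k i
  proof -
    have "(\<Sum>j\<le>t. ?C $$ (k, j) * z i j) = (\<Sum>j = 1..t. ?M $$ (k - 1, j - 1) * V $$ (j - 1, i - 1))"
      unfolding sum_atMost_split z_def using that control_info_mat_index by (auto intro!: sum.cong)
    also have "\<dots> = (\<Sum>j<t. ?M $$ (k - 1, j) * V $$ (j, i - 1))" unfolding sum_shift_1 by simp
    also have "\<dots> = (?M * V) $$ (k - 1, i - 1)"
      using that V control_info_mat_carrier[of t n p d]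
      by (auto simp: scalar_prod_def atLeast0LessThan intro!: sum.cong)
    also have "\<dots> = (if k = i then 1 else 0)" unfolding MV using that by auto
    finally show ?thesis .
  qed
  have Qz: "?Q g (z i) = g i" if "g 0 = 0" "i \<in> {1..t}" for g i
  proof -
    have "?Q g (z i) = (\<Sum>k\<le>t. g k * (\<Sum>j\<le>t. ?C $$ (k, j) * z i j))"
      unfolding info_form_def by (simp add: sum_distrib_left mult.assoc)
    also have "\<dots> = (\<Sum>k = 1..t. g k * (\<Sum>j\<le>t. ?C $$ (k, j) * z i j))"
      by (subst sum_atMost_split) (simp add: that(1))
    also have "\<dots> = (\<Sum>k = 1..t. if k = i then g i else 0)"
      using that Mz by (intro sum.cong) auto
    also have "\<dots> = g i" using that by simp
    finally show ?thesis .
  qed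
  have diag: "2 * g i - ?Q g g \<le> V $$ (i - 1, i - 1)" if "g 0 = 0" "i \<in> {1..t}" for g i
  proof -
    have "0 \<le> ?Q (\<lambda>j. 1 * g j + (- 1) * z i j) (\<lambda>j. 1 * g j + (- 1) * z i j)" by (rule info_form_nonneg)
    also have "\<dots> = ?Q g g - 2 * g i + z i i"
      unfolding info_form_combine using Qz[of g i] Qz[of "z i" i] that by (simp add: z_def)
    finally show ?thesis using that by (simp add: z_def)
  qed
  define w where "w = (\<lambda>j::nat. if j = 0 then 0 else 1 :: real)"
  define g where "g = (\<lambda>i j. m1 * test_contrast t i j + (m0 / t) * w j)"
  have gi: "g i i = m1 * (1 - 1 / t) + m0 / t" if "i \<in> {1..t}" for i
    using that by (simp add: g_def test_contrast_def w_def)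
  have "(\<Sum>i = 1..t. 2 * g i i - ?Q (g i) (g i)) \<le> (\<Sum>i = 1..t. V $$ (i - 1, i - 1))"
    by (intro sum_mono diag) (auto simp: g_def test_contrast_def w_def)
  hence "(\<Sum>i = 1..t. 2 * g i i) - (\<Sum>i = 1..t. ?Q (g i) (g i)) \<le> (\<Sum>i<t. V $$ (i, i))"
    by (simp only: sum_subtractf sum_shift_1 diff_Suc_1)
  moreover have "(\<Sum>i = 1..t. 2 * g i i) = 2 * (real t - 1) * m1 + 2 * m0"
    using t by (simp add: gi field_simps)
  moreover have "(\<Sum>i = 1..t. ?Q (g i) (g i))
      = m1\<^sup>2 * contrast_info t n p d / (real t * real p) + m0\<^sup>2 * control_info t n p d / (real t * real p)"
  proof -
    \<comment> \<open>The contrasts add up to zero, so the mixed terms cancel in the sum over \<open>i\<close>.\<close>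
    have sum0: "(\<Sum>i = 1..t. test_contrast t i j) = 0" if "j \<le> t" for j
      using that t by (cases "j = 0") (simp_all add: test_contrast_def sum_subtractf)
    have "(\<Sum>i = 1..t. ?Q (test_contrast t i) w) = ?Q (\<lambda>j. \<Sum>i = 1..t. test_contrast t i j) w"
      by (rule info_form_sum_left[symmetric])
    also have "\<dots> = 0" unfolding info_form_def using sum0 by simp
    finally have cross: "(\<Sum>i = 1..t. ?Q (test_contrast t i) w) = 0" .
    \<comment> \<open>Modulo constants, the sum of all tests is minus the control.\<close>
    have ones: "?Q f (\<lambda>_. 1) = 0" for f
      unfolding info_form_def using info_mat_row_sum[OF d n p] by (simp add: sum_distrib_left[symmetric])
    have w_eq: "w = (\<lambda>j. 1 * 1 + (- 1) * control j)" by (auto simp: w_def control_def)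
    have ww: "?Q w w = ?Q control control"
      unfolding w_eq info_form_combine using ones info_form_commute[of t n p d "\<lambda>_. 1"] by simp
    have "(\<Sum>i = 1..t. ?Q (g i) (g i)) = m1\<^sup>2 * (\<Sum>i = 1..t. ?Q (test_contrast t i) (test_contrast t i))
        + 2 * m1 * (m0 / t) * (\<Sum>i = 1..t. ?Q (test_contrast t i) w) + t * ((m0 / t)\<^sup>2 * ?Q w w)"
      unfolding g_def info_form_combine by (simp add: sum.distrib sum_distrib_left)
    thus ?thesis
      unfolding cross ww contrast_info_def control_info_def using t p by (simp add: field_simps power2_eq_square)
  qed
  ultimately show ?thesis by simp
qed


section \<open>Bounds on the information of a design\<close>

text \<open>
  With \<open>p, p\<close>, with \<open>p, p - 1\<close> and with \<open>p - 1, p - 1\<close> these are the sums \<open>A\<^sub>d\<close>, \<open>B\<^sub>d\<close>, \<open>C\<^sub>d\<close> whose minima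
  occur in \<open>f\<close>.
\<close>

definition unit_inner :: "nat \<Rightarrow> nat \<Rightarrow> nat \<Rightarrow> design \<Rightarrow> nat" where
  "unit_inner n p q d = (\<Sum>u = 1..n. unit_count p d 0 u * unit_count q d 0 u)"

lemma unit_inner_eq:
  "(\<Sum>u<n. real (unit_count p d 0 (Suc u)) * real (unit_count q d 0 (Suc u))) = real (unit_inner n p q d)"
  unfolding unit_inner_def sum_shift_1 by simp

context
  fixes t n p :: nat and d :: design
  assumes d: "d \<in> Lambda_class t n p" and n: "0 < n" and p: "2 \<le> p" and t: "0 < t"
begin

lemma Lambda_designs: "d \<in> designs t n p"
  using d unfolding Lambda_class_def by auto

lemma Lambda_period_count: "k < p \<Longrightarrow> real (period_count n d 0 (Suc k)) = real (replication n p d 0) / real p"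
  using d unfolding Lambda_class_def by auto

lemma Lambda_preceded: "i \<le> t \<Longrightarrow> preceded_count n p d i i = 0"
  using d unfolding Lambda_class_def by auto

lemma replication_tilde: "real (replication n (p - 1) d 0) = (real p - 1) / real p * real (replication n p d 0)"
proof -
  have "real (replication n (p - 1) d 0) = (\<Sum>k<p - 1. real (replication n p d 0) / real p)"
    unfolding replication_by_periods using Lambda_period_count by (intro sum.cong) auto
  thus ?thesis using p by (simp add: of_nat_diff)
qed

lemma sum_if_pos: "(\<Sum>k<p. if 0 < k then a else 0) = (real p - 1) * a" for a :: real
proof -
  have "(\<Sum>k<Suc (p - 1). if 0 < k then a else 0) = (\<Sum>k<p - 1. a)"
    by (subst sum.lessThan_Suc_shift) simp
  thus ?thesis using p by (simp add: of_nat_diff)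
qed

lemma adj_control_direct:
  "real p * adj_prod n p (direct_ind d 0) (direct_ind d 0) = real p * real (replication n p d 0) - real (unit_inner n p p d)"
  using n p
  by (subst adj_prod_direct_direct) (auto simp: Lambda_period_count unit_inner_eq power2_eq_square field_simps)

lemma adj_control_cross:
  "real p * adj_prod n p (direct_ind d 0) (carry_ind d 0) = - real (unit_inner n p (p - 1) d)"
proof -
  have "(\<Sum>k<p. real (period_count n d 0 (Suc k)) * (if 0 < k then real (period_count n d 0 k) else 0))
      = (\<Sum>k<p. if 0 < k then (real (replication n p d 0) / p) * (real (replication n p d 0) / p) else 0)"
  proof (rule sum.cong[OF refl])
    fix k assume "k \<in> {..<p}"
    thus "real (period_count n d 0 (Suc k)) * (if 0 < k then real (period_count n d 0 k) else 0)
        = (if 0 < k then (real (replication n p d 0) / p) * (real (replication n p d 0) / p) else 0)"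
      using Lambda_period_count[of k] Lambda_period_count[of "k - 1"] by auto
  qed
  also have "\<dots> = (real p - 1) * ((real (replication n p d 0) / p) * (real (replication n p d 0) / p))" by (rule sum_if_pos)
  finally have periods: "(\<Sum>k<p. real (period_count n d 0 (Suc k)) * (if 0 < k then real (period_count n d 0 k) else 0))
      = (real p - 1) * ((real (replication n p d 0) / p) * (real (replication n p d 0) / p))" .
  have "adj_prod n p (direct_ind d 0) (carry_ind d 0)
      = - ((real p - 1) * ((real (replication n p d 0) / p) * (real (replication n p d 0) / p)) / n)
        - real (unit_inner n p (p - 1) d) / p
        + real (replication n p d 0) * ((real p - 1) / real p * real (replication n p d 0)) / (real n * real p)"
    using n p Lambda_preceded[of 0] unfolding replication_tilde[symmetric]
    by (subst adj_prod_direct_carry) (auto simp: periods unit_inner_eq)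
  thus ?thesis using n p by (simp add: field_simps)
qed

lemma adj_control_carry:
  "real p * adj_prod n p (carry_ind d 0) (carry_ind d 0)
   = real p * real (replication n (p - 1) d 0) - (real (replication n (p - 1) d 0))\<^sup>2 / (real n * (real p - 1)) - real (unit_inner n (p - 1) (p - 1) d)"
proof -
  have "(\<Sum>k<p. (if 0 < k then real (period_count n d 0 k) else 0) * (if 0 < k then real (period_count n d 0 k) else 0))
      = (\<Sum>k<p. if 0 < k then (real (replication n p d 0) / p) * (real (replication n p d 0) / p) else 0)"
  proof (rule sum.cong[OF refl])
    fix k assume "k \<in> {..<p}"
    thus "(if 0 < k then real (period_count n d 0 k) else 0) * (if 0 < k then real (period_count n d 0 k) else 0)
        = (if 0 < k then (real (replication n p d 0) / p) * (real (replication n p d 0) / p) else 0)"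
      using Lambda_period_count[of "k - 1"] by auto
  qed
  also have "\<dots> = (real p - 1) * ((real (replication n p d 0) / p) * (real (replication n p d 0) / p))" by (rule sum_if_pos)
  also have "\<dots> = (real (replication n (p - 1) d 0))\<^sup>2 / (real p - 1)"
    using p unfolding replication_tilde by (simp add: power2_eq_square field_simps)
  finally have periods: "(\<Sum>k<p. (if 0 < k then real (period_count n d 0 k) else 0)
      * (if 0 < k then real (period_count n d 0 k) else 0)) = (real (replication n (p - 1) d 0))\<^sup>2 / (real p - 1)" .
  have "adj_prod n p (carry_ind d 0) (carry_ind d 0)
      = real (replication n (p - 1) d 0) - (real (replication n (p - 1) d 0))\<^sup>2 / (real p - 1) / n - real (unit_inner n (p - 1) (p - 1) d) / p + (real (replication n (p - 1) d 0))\<^sup>2 / (real n * real p)"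
    using n p by (subst adj_prod_carry_carry) (auto simp: periods unit_inner_eq power2_eq_square)
  moreover have "P * (R - R\<^sup>2 / (P - 1) / N - C / P + R\<^sup>2 / (N * P)) = P * R - R\<^sup>2 / (N * (P - 1)) - C"
    if "0 < N" "1 < P" for P R N C :: real
  proof -
    have "P * (R - R\<^sup>2 / (P - 1) / N - C / P + R\<^sup>2 / (N * P))
        = P * R - R\<^sup>2 / N * (P / (P - 1) - 1) - C"
      using that by (simp add: field_simps)
    also have "P / (P - 1) - 1 = 1 / (P - 1)" using that by (simp add: field_simps)
    finally show ?thesis by simp
  qed
  ultimately show ?thesis using n p by simp
qed

lemma control_info_le:
  "control_info t n p d \<le> (real p * real (replication n p d 0) - real (unit_inner n p p d)) - 2 * e * real (unit_inner n p (p - 1) d)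
     + e\<^sup>2 * (real p * real (replication n (p - 1) d 0) - (real (replication n (p - 1) d 0))\<^sup>2 / (real n * (real p - 1)) - real (unit_inner n (p - 1) (p - 1) d))"
proof -
  have p0: "0 < p" using p by simp
  define y where "y = (\<lambda>k u. 1 * direct_ind d 0 k u + e * carry_ind d 0 k u)"
  have "info_form t n p d control control \<le> adj_prod n p y y"
  proof (rule info_form_le_adj_prod[OF n p0])
    show "y k u = direct_comb t d control k u + carry_comb t d (\<lambda>j. e * control j) k u" for k u
      unfolding direct_comb_def carry_comb_def sum_atMost_split by (simp add: y_def control_def)
  qed
  also have "adj_prod n p y y = adj_prod n p (direct_ind d 0) (direct_ind d 0)
      + 2 * e * adj_prod n p (direct_ind d 0) (carry_ind d 0) + e\<^sup>2 * adj_prod n p (carry_ind d 0) (carry_ind d 0)"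
    unfolding y_def adj_prod_combine_left[OF n p0] adj_prod_combine_right[OF n p0]
      adj_prod_commute[OF n p0, of "carry_ind d 0" "direct_ind d 0"]
    by (simp add: power2_eq_square algebra_simps)
  finally have "control_info t n p d \<le> real p * (adj_prod n p (direct_ind d 0) (direct_ind d 0)
      + 2 * e * adj_prod n p (direct_ind d 0) (carry_ind d 0) + e\<^sup>2 * adj_prod n p (carry_ind d 0) (carry_ind d 0))"
    unfolding control_info_def by (rule mult_left_mono) simp
  also have "\<dots> = real p * adj_prod n p (direct_ind d 0) (direct_ind d 0)
      + 2 * e * (real p * adj_prod n p (direct_ind d 0) (carry_ind d 0))
      + e\<^sup>2 * (real p * adj_prod n p (carry_ind d 0) (carry_ind d 0))"
    by (simp add: distrib_left mult.left_commute)
  finally show ?thesis unfolding adj_control_direct adj_control_cross adj_control_carry by simp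
qed

end

lemma sum_deviation_sq:
  fixes l :: "nat \<Rightarrow> real"
  assumes "0 < p"
  shows "(\<Sum>k<p. (l k - (\<Sum>j<p. l j) / p)\<^sup>2) = (\<Sum>k<p. (l k)\<^sup>2) - (\<Sum>k<p. l k)\<^sup>2 / p"
proof -
  define m where "m = (\<Sum>j<p. l j) / p"
  have pm: "(\<Sum>j<p. l j) = p * m" unfolding m_def using assms by simp
  have "(\<Sum>k<p. (l k - m)\<^sup>2) = (\<Sum>k<p. (l k)\<^sup>2 - 2 * m * l k + m\<^sup>2)"
    by (intro sum.cong) (auto simp: power2_eq_square algebra_simps)
  also have "\<dots> = (\<Sum>k<p. (l k)\<^sup>2) - 2 * m * (\<Sum>k<p. l k) + p * m\<^sup>2"
    by (simp add: sum.distrib sum_subtractf sum_distrib_left)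
  also have "\<dots> = (\<Sum>k<p. (l k)\<^sup>2) - (\<Sum>k<p. l k)\<^sup>2 / p"
    unfolding pm using assms by (simp add: power2_eq_square field_simps)
  finally show ?thesis unfolding m_def .
qed

text \<open>
  A sum of squared deviations is a convex function of the profile over the periods, so it is least on
  average when all tests share the same profile.
\<close>

lemma deviation_convex:
  fixes l :: "nat \<Rightarrow> nat \<Rightarrow> real"
  assumes p: "0 < p" and t: "0 < t"
  shows "((\<Sum>k<p. (\<Sum>i = 1..t. l i k)\<^sup>2) - (\<Sum>k<p. \<Sum>i = 1..t. l i k)\<^sup>2 / p) / t
    \<le> (\<Sum>i = 1..t. (\<Sum>k<p. (l i k)\<^sup>2) - (\<Sum>k<p. l i k)\<^sup>2 / p)"
proof -
  define v where "v = (\<lambda>i k. l i k - (\<Sum>j<p. l i j) / p)"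
  have sum_v: "(\<Sum>i = 1..t. v i k) = (\<Sum>i = 1..t. l i k) - (\<Sum>j<p. \<Sum>i = 1..t. l i j) / p" for k
    unfolding v_def sum_subtractf sum_divide_distrib[symmetric] by (subst sum.swap) simp
  have CS: "(\<Sum>i = 1..t. v i k)\<^sup>2 \<le> t * (\<Sum>i = 1..t. (v i k)\<^sup>2)" for k
  proof -
    have "0 \<le> (\<Sum>i<t. (v (Suc i) k - (\<Sum>j<t. v (Suc j) k) / t)\<^sup>2)" by (simp add: sum_nonneg)
    also have "\<dots> = (\<Sum>i = 1..t. (v i k)\<^sup>2) - (\<Sum>i = 1..t. v i k)\<^sup>2 / t"
      unfolding sum_shift_1 by (rule sum_deviation_sq[OF t])
    finally show ?thesis using t by (simp add: field_simps)
  qed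
  have "(\<Sum>k<p. (\<Sum>i = 1..t. l i k)\<^sup>2) - (\<Sum>k<p. \<Sum>i = 1..t. l i k)\<^sup>2 / p
      = (\<Sum>k<p. (\<Sum>i = 1..t. v i k)\<^sup>2)"
    unfolding sum_v by (rule sum_deviation_sq[OF p, symmetric])
  also have "\<dots> \<le> (\<Sum>k<p. t * (\<Sum>i = 1..t. (v i k)\<^sup>2))" by (intro sum_mono CS)
  also have "\<dots> = t * (\<Sum>i = 1..t. \<Sum>k<p. (v i k)\<^sup>2)"
    by (simp add: sum_distrib_left[symmetric] sum.swap[of _ "{..<p}"])
  also have "\<dots> = t * (\<Sum>i = 1..t. (\<Sum>k<p. (l i k)\<^sup>2) - (\<Sum>k<p. l i k)\<^sup>2 / p)"
    unfolding v_def by (simp only: sum_deviation_sq[OF p])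
  finally show ?thesis using t by (simp add: pos_divide_le_eq mult.commute)
qed

context
  fixes t n p :: nat and d :: design
  assumes d: "d \<in> Lambda_class t n p" and n: "0 < n" and p: "2 \<le> p" and t: "0 < t"
begin

lemma replication_total: "(\<Sum>i = 1..t. real (replication n p d i)) = real n * real p - real (replication n p d 0)"
proof -
  have "(\<Sum>i\<le>t. real (replication n p d i)) = (\<Sum>u<n. \<Sum>k<p. \<Sum>i\<le>t. direct_ind d i k u)"
    unfolding replication_eq by (simp add: sum.swap[of _ _ "{..t}"])
  also have "\<dots> = (\<Sum>u<n. \<Sum>k<p. 1)"
    using direct_ind_total[OF Lambda_designs[OF d n p t]] by (intro sum.cong) auto
  finally show ?thesis unfolding sum_atMost_split by simp
qed

lemma replication_total_tilde:
  "(\<Sum>i = 1..t. real (replication n (p - 1) d i)) = real n * (real p - 1) - real (replication n (p - 1) d 0)"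
proof -
  have "(\<Sum>i\<le>t. real (replication n (p - 1) d i)) = (\<Sum>u<n. \<Sum>k<p. \<Sum>i\<le>t. carry_ind d i k u)"
    unfolding replication_carry_eq by (simp add: sum.swap[of _ _ "{..t}"])
  also have "\<dots> = (\<Sum>u<n. \<Sum>k<p. if 0 < k then 1 else 0)"
    using carry_ind_total[OF Lambda_designs[OF d n p t]] by (intro sum.cong) auto
  also have "\<dots> = real n * (real p - 1)" using sum_if_pos[OF d n p t, of 1] by simp
  finally show ?thesis unfolding sum_atMost_split by simp
qed

text \<open>
  Three effects bound the adjusted squares of the tests: a test never follows itself, which removes
  the mixed term; unit counts are integers, so their squares are at least the counts themselves and
  their products at least the counts of the first \<open>p - 1\<close> periods (the mixed term calls for \<open>c \<ge> 0\<close>); and by convexity the dispersion over periods is least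
  for tests that are equally frequent in all periods.
\<close>

lemma test_effects_dispersion:
  fixes c :: real
  defines "h \<equiv> \<lambda>i k u. direct_ind d i k u + c * carry_ind d i k u"
    and "S \<equiv> real n * (real p - 1) - real (replication n (p - 1) d 0)"
  assumes c: "0 \<le> c"
  shows "(\<Sum>i = 1..t. adj_prod n p (h i) (h i))
    \<le> (1 - 1 / p) * (real n * real p - real (replication n p d 0)) + c\<^sup>2 * S * (1 - 1 / p) - 2 * c * S / p
      - c\<^sup>2 * S\<^sup>2 / (real n * real t * real p * (real p - 1))"
proof -
  define L where "L = real (replication n p d 0) / p"
  define l where "l = (\<lambda>i k. \<Sum>u<n. h i k u)"
  have p0: "0 < p" and P: "1 < real p" and N: "0 < real n" and T: "0 < real t" using p n t by auto
  have S_eq: "S = (real p - 1) * (n - L)"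
    unfolding S_def L_def replication_tilde[OF d n p t] using P by (simp add: field_simps)
  have squares: "(\<Sum>u<n. \<Sum>k<p. h i k u * h i k u)
      = real (replication n p d i) + c\<^sup>2 * real (replication n (p - 1) d i)" if i: "i \<in> {1..t}" for i
  proof -
    have "(\<Sum>u<n. \<Sum>k<p. h i k u * h i k u)
        = (\<Sum>u<n. \<Sum>k<p. direct_ind d i k u * direct_ind d i k u)
          + 2 * c * (\<Sum>u<n. \<Sum>k<p. direct_ind d i k u * carry_ind d i k u)
          + c\<^sup>2 * (\<Sum>u<n. \<Sum>k<p. carry_ind d i k u * carry_ind d i k u)"
      unfolding h_def by (simp add: sum.distrib sum_distrib_left power2_eq_square algebra_simps)
    thus ?thesis
      unfolding direct_direct_sum carry_carry_sum preceded_count_eq[symmetric]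
      using Lambda_preceded[OF d n p t, of i] i by simp
  qed
  have units: "real (replication n p d i) + 2 * c * real (replication n (p - 1) d i)
        + c\<^sup>2 * real (replication n (p - 1) d i)
      \<le> (\<Sum>u<n. (\<Sum>k<p. h i k u) * (\<Sum>k<p. h i k u))" for i
  proof -
    have "real (replication n p d i) + 2 * c * real (replication n (p - 1) d i)
        + c\<^sup>2 * real (replication n (p - 1) d i)
      = (\<Sum>u<n. real (unit_count p d i (Suc u)) + 2 * c * real (unit_count (p - 1) d i (Suc u))
          + c\<^sup>2 * real (unit_count (p - 1) d i (Suc u)))"
      unfolding replication_def of_nat_sum sum_shift_1 by (simp add: sum.distrib sum_distrib_left)
    also have "\<dots> \<le> (\<Sum>u<n. (\<Sum>k<p. h i k u) * (\<Sum>k<p. h i k u))"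
    proof (rule sum_mono)
      fix u
      define a b where "a = unit_count p d i (Suc u)" and "b = unit_count (p - 1) d i (Suc u)"
      have ba: "b \<le> a" unfolding a_def b_def unit_count_def by (intro card_mono) auto
      have "a \<le> a * a" "b \<le> b * b" "b \<le> a * b" using ba by (auto intro: le_square)
      hence "real a \<le> real a * real a" "real b \<le> real b * real b" "real b \<le> real a * real b"
        by (metis of_nat_le_iff of_nat_mult)+
      hence "real a + 2 * c * real b + c\<^sup>2 * real b \<le> real a * real a + 2 * c * (real a * real b) + c\<^sup>2 * (real b * real b)"
        using c by (intro add_mono mult_left_mono) auto
      also have "\<dots> = (real a + c * real b) * (real a + c * real b)"
        by (simp add: power2_eq_square algebra_simps)
      finally show "real (unit_count p d i (Suc u)) + 2 * c * real (unit_count (p - 1) d i (Suc u))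
          + c\<^sup>2 * real (unit_count (p - 1) d i (Suc u)) \<le> (\<Sum>k<p. h i k u) * (\<Sum>k<p. h i k u)"
        unfolding h_def a_def b_def unit_count_carry_eq unfolding unit_count_eq
        by (simp add: sum.distrib sum_distrib_left)
    qed
    finally show ?thesis .
  qed
  define D where "D = (\<lambda>i. (\<Sum>k<p. (l i k)\<^sup>2) - (\<Sum>k<p. l i k)\<^sup>2 / p)"
  have l_sum: "(\<Sum>i = 1..t. l i k) = (n - L) * (if 0 < k then 1 + c else 1)" if k: "k < p" for k
  proof -
    have "(\<Sum>i\<le>t. l i k) = (\<Sum>u<n. \<Sum>i\<le>t. h i k u)" unfolding l_def by (rule sum.swap)
    also have "\<dots> = (\<Sum>u<n. if 0 < k then 1 + c else 1)"
      unfolding h_def using direct_ind_total[OF Lambda_designs[OF d n p t] k] carry_ind_total[OF Lambda_designs[OF d n p t] k]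
      by (intro sum.cong) (auto simp: sum.distrib sum_distrib_left[symmetric])
    finally have "l 0 k + (\<Sum>i = 1..t. l i k) = n * (if 0 < k then 1 + c else 1)"
      unfolding sum_atMost_split by simp
    moreover have "l 0 k = L * (if 0 < k then 1 + c else 1)"
    proof -
      have "l 0 k = real (period_count n d 0 (Suc k)) + c * (if 0 < k then real (period_count n d 0 k) else 0)"
        unfolding l_def h_def period_count_eq period_count_carry_eq[symmetric]
        by (simp add: sum.distrib sum_distrib_left)
      thus ?thesis
        using Lambda_period_count[OF d n p t, of k] Lambda_period_count[OF d n p t, of "k - 1"] k
        by (cases k) (auto simp: L_def algebra_simps add_divide_distrib)
    qed
    ultimately show ?thesis by (simp add: algebra_simps)
  qed
  \<comment> \<open>The first period carries no carryover effect, so even equal period counts leave a dispersion.\<close>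
  have periods: "c\<^sup>2 * S\<^sup>2 / (real p * (real p - 1)) / t
      \<le> (\<Sum>i = 1..t. (\<Sum>k<p. (l i k)\<^sup>2) - (\<Sum>k<p. l i k)\<^sup>2 / p)"
  proof -
    have "(\<Sum>k<p. (\<Sum>i = 1..t. l i k)\<^sup>2) = (\<Sum>k<p. (n - L)\<^sup>2 + (if 0 < k then (n - L)\<^sup>2 * ((1 + c)\<^sup>2 - 1) else 0))"
      by (intro sum.cong) (auto simp: l_sum[unfolded One_nat_def] power_mult_distrib right_diff_distrib)
    also have "\<dots> = p * (n - L)\<^sup>2 + (real p - 1) * ((n - L)\<^sup>2 * ((1 + c)\<^sup>2 - 1))"
      unfolding sum.distrib sum_if_pos[OF d n p t] by simp
    finally have sq: "(\<Sum>k<p. (\<Sum>i = 1..t. l i k)\<^sup>2)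
        = p * (n - L)\<^sup>2 + (real p - 1) * ((n - L)\<^sup>2 * ((1 + c)\<^sup>2 - 1))" .
    have "(\<Sum>k<p. \<Sum>i = 1..t. l i k) = (\<Sum>k<p. (n - L) + (if 0 < k then (n - L) * c else 0))"
      by (intro sum.cong) (auto simp: l_sum[unfolded One_nat_def] algebra_simps)
    also have "\<dots> = p * (n - L) + (real p - 1) * ((n - L) * c)"
      unfolding sum.distrib sum_if_pos[OF d n p t] by simp
    finally have su: "(\<Sum>k<p. \<Sum>i = 1..t. l i k) = p * (n - L) + (real p - 1) * ((n - L) * c)" .
    have "c\<^sup>2 * S\<^sup>2 / (real p * (real p - 1)) = c\<^sup>2 * (n - L)\<^sup>2 * (real p - 1) / p"
      unfolding S_eq using P by (simp add: power2_eq_square field_simps)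
    also have "\<dots> = (\<Sum>k<p. (\<Sum>i = 1..t. l i k)\<^sup>2) - (\<Sum>k<p. \<Sum>i = 1..t. l i k)\<^sup>2 / p"
      unfolding sq su using P by (simp add: power2_eq_square field_simps)
    finally have "c\<^sup>2 * S\<^sup>2 / (real p * (real p - 1)) / t
        = ((\<Sum>k<p. (\<Sum>i = 1..t. l i k)\<^sup>2) - (\<Sum>k<p. \<Sum>i = 1..t. l i k)\<^sup>2 / p) / t" by simp
    also have "\<dots> \<le> (\<Sum>i = 1..t. (\<Sum>k<p. (l i k)\<^sup>2) - (\<Sum>k<p. l i k)\<^sup>2 / p)"
      by (rule deviation_convex[OF p0 t])
    finally show ?thesis .
  qed
  have each: "adj_prod n p (h i) (h i) \<le> (1 - 1 / p) * real (replication n p d i)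
        + (c\<^sup>2 * (1 - 1 / p) - 2 * c / p) * real (replication n (p - 1) d i)
        - D i / n" if i: "i \<in> {1..t}" for i
  proof -
    have "(\<Sum>u<n. \<Sum>k<p. h i k u) = (\<Sum>k<p. l i k)" unfolding l_def by (rule sum.swap)
    hence "adj_prod n p (h i) (h i) = (\<Sum>u<n. \<Sum>k<p. h i k u * h i k u)
        - D i / n - (\<Sum>u<n. (\<Sum>k<p. h i k u) * (\<Sum>k<p. h i k u)) / p"
      unfolding adj_prod_eq[OF n p0] D_def power2_eq_square l_def using n p0 by (simp add: field_simps)
    also have "\<dots> \<le> (real (replication n p d i) + c\<^sup>2 * real (replication n (p - 1) d i))
        - D i / n
        - (real (replication n p d i) + 2 * c * real (replication n (p - 1) d i)
        + c\<^sup>2 * real (replication n (p - 1) d i)) / p"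
      unfolding squares[OF i] using units[of i] by (intro diff_left_mono divide_right_mono) auto
    finally show ?thesis by (simp add: algebra_simps add_divide_distrib diff_divide_distrib)
  qed
  have "(\<Sum>i = 1..t. adj_prod n p (h i) (h i)) \<le> (\<Sum>i = 1..t. (1 - 1 / p) * real (replication n p d i)
        + (c\<^sup>2 * (1 - 1 / p) - 2 * c / p) * real (replication n (p - 1) d i)
        - D i / n)"
    by (intro sum_mono each)
  also have "\<dots> = (1 - 1 / p) * (\<Sum>i = 1..t. real (replication n p d i))
      + (c\<^sup>2 * (1 - 1 / p) - 2 * c / p) * (\<Sum>i = 1..t. real (replication n (p - 1) d i))
      - (\<Sum>i = 1..t. D i) / n"
    by (simp only: sum.distrib sum_subtractf sum_distrib_left sum_divide_distrib)
  also have "\<dots> = (1 - 1 / p) * (real n * real p - real (replication n p d 0))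
      + (c\<^sup>2 * (1 - 1 / p) - 2 * c / p) * S
      - (\<Sum>i = 1..t. D i) / n"
    unfolding replication_total replication_total_tilde S_def ..
  also have "\<dots> \<le> (1 - 1 / p) * (real n * real p - real (replication n p d 0))
      + (c\<^sup>2 * (1 - 1 / p) - 2 * c / p) * S - c\<^sup>2 * S\<^sup>2 / (real p * (real p - 1)) / t / n"
    using periods unfolding D_def by (intro diff_left_mono divide_right_mono) auto
  finally show ?thesis by (simp add: algebra_simps)
qed

text \<open>
  The contrasts with the average test lose \<open>1/t\<close> of the adjusted square of the sum of all tests, which
  equals that of the control. This is how \<open>A\<^sub>d\<close>, \<open>B\<^sub>d\<close>, \<open>C\<^sub>d\<close> enter with the opposite sign.
\<close>

lemma contrast_info_le:
  fixes c :: real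
  defines "N \<equiv> real n" and "P \<equiv> real p" and "T \<equiv> real t" and "r \<equiv> real (replication n p d 0)"
    and "rt \<equiv> real (replication n (p - 1) d 0)"
    and "A \<equiv> real (unit_inner n p p d)" and "B \<equiv> real (unit_inner n p (p - 1) d)"
    and "C \<equiv> real (unit_inner n (p - 1) (p - 1) d)"
  assumes c: "0 \<le> c"
  shows "contrast_info t n p d \<le> (T * (P - 1) * (N * P - r) - (P * r - A))
      - 2 * c * (T * (N * (P - 1) - rt) - B)
      + c\<^sup>2 * (N * (P - 1) * (P * T - T - 1) - (P * T - T + P - 2) * rt + C)"
proof -
  have p0: "0 < p" and P: "1 < P" and N: "0 < N" and T: "0 < T" using p n t by (auto simp: P_def N_def T_def)
  define S where "S = N * (P - 1) - rt"
  define h where "h = (\<lambda>i k u. direct_ind d i k u + c * carry_ind d i k u)"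
  define s where "s = (\<lambda>k u. \<Sum>j = 1..t. h j k u)"
  have v_le: "info_form t n p d (test_contrast t i) (test_contrast t i)
      \<le> adj_prod n p (h i) (h i) - 2 / T * adj_prod n p (h i) s + 1 / T\<^sup>2 * adj_prod n p s s"
    if i: "i \<in> {1..t}" for i
  proof -
    define y where "y = (\<lambda>k u. 1 * h i k u + (- (1 / T)) * s k u)"
    have comb: "(\<Sum>j\<le>t. test_contrast t i j * g j) = g i - (1 / T) * (\<Sum>j = 1..t. g j)" for g :: "nat \<Rightarrow> real"
    proof -
      have "(\<Sum>j\<le>t. test_contrast t i j * g j) = (\<Sum>j = 1..t. (if j = i then g j else 0) - (1 / T) * g j)"
        unfolding sum_atMost_split by (auto simp: test_contrast_def T_def algebra_simps intro!: sum.cong)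
      thus ?thesis using i by (simp add: sum_subtractf sum_distrib_left)
    qed
    have "info_form t n p d (test_contrast t i) (test_contrast t i) \<le> adj_prod n p y y"
    proof (rule info_form_le_adj_prod[OF n p0])
      show "y k u = direct_comb t d (test_contrast t i) k u + carry_comb t d (\<lambda>j. c * test_contrast t i j) k u" for k u
        unfolding y_def direct_comb_def carry_comb_def mult.assoc sum_distrib_left[symmetric] comb s_def h_def
        by (simp add: sum.distrib sum_distrib_left[symmetric] algebra_simps)
    qed
    also have "\<dots> = adj_prod n p (h i) (h i) - 2 / T * adj_prod n p (h i) s + 1 / T\<^sup>2 * adj_prod n p s s"
      unfolding y_def adj_prod_combine_left[OF n p0] adj_prod_combine_right[OF n p0]
        adj_prod_commute[OF n p0, of s "h i"]
      by (simp add: power2_eq_square algebra_simps)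
    finally show ?thesis .
  qed
  have "(\<Sum>i = 1..t. info_form t n p d (test_contrast t i) (test_contrast t i))
      \<le> (\<Sum>i = 1..t. adj_prod n p (h i) (h i) - 2 / T * adj_prod n p (h i) s + 1 / T\<^sup>2 * adj_prod n p s s)"
    by (intro sum_mono v_le)
  also have "\<dots> = (\<Sum>i = 1..t. adj_prod n p (h i) (h i)) - 2 / T * (\<Sum>i = 1..t. adj_prod n p (h i) s)
      + T * (1 / T\<^sup>2 * adj_prod n p s s)"
    by (simp add: sum.distrib sum_subtractf sum_distrib_left T_def)
  also have "(\<Sum>i = 1..t. adj_prod n p (h i) s) = adj_prod n p s s"
    unfolding adj_prod_sum_left[OF n p0, symmetric] s_def ..
  also have "(\<Sum>i = 1..t. adj_prod n p (h i) (h i)) - 2 / T * adj_prod n p s s + T * (1 / T\<^sup>2 * adj_prod n p s s)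
      = (\<Sum>i = 1..t. adj_prod n p (h i) (h i)) - adj_prod n p s s / T"
    using T by (simp add: power2_eq_square field_simps)
  \<comment> \<open>All treatment indicators add up to period effects, so the tests together mirror the control.\<close>
  also have "adj_prod n p s s = adj_prod n p (h 0) (h 0)"
  proof -
    define \<alpha> where "\<alpha> = (\<lambda>k::nat. if 0 < k then 1 + c else 1)"
    have s_eq: "s k u = (1 * (- h 0 k u)) + \<alpha> k + (\<lambda>_. 0) u" if "k < p" "u < n" for k u
    proof -
      have "(\<Sum>j\<le>t. h j k u) = \<alpha> k"
        unfolding h_def \<alpha>_def using direct_ind_total[OF Lambda_designs[OF d n p t] that]
          carry_ind_total[OF Lambda_designs[OF d n p t] that]
        by (simp add: sum.distrib sum_distrib_left[symmetric])
      thus ?thesis unfolding s_def sum_atMost_split by simp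
    qed
    have drop: "adj_prod n p s z = adj_prod n p (\<lambda>k u. - h 0 k u) z" for z
    proof -
      have "adj_prod n p s z = adj_prod n p (\<lambda>k u. - h 0 k u + \<alpha> k + (\<lambda>_. 0) u) z"
        using s_eq by (intro adj_prod_cong) auto
      thus ?thesis unfolding adj_prod_add_effects[OF n p0] .
    qed
    have neg: "adj_prod n p (\<lambda>k u. - y k u) z = - adj_prod n p y z" for y z
      unfolding adj_prod_def by (simp add: sum_negf)
    have "adj_prod n p s s = adj_prod n p s (\<lambda>k u. - h 0 k u)"
      unfolding drop[of s] by (rule adj_prod_commute[OF n p0])
    also have "\<dots> = - adj_prod n p (h 0) (\<lambda>k u. - h 0 k u)" by (simp only: drop neg)
    also have "\<dots> = adj_prod n p (h 0) (h 0)"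
      using neg[of "h 0" "h 0"] adj_prod_commute[OF n p0, of "h 0" "\<lambda>k u. - h 0 k u"] by simp
    finally show ?thesis .
  qed
  finally have "(\<Sum>i = 1..t. info_form t n p d (test_contrast t i) (test_contrast t i))
      \<le> (\<Sum>i = 1..t. adj_prod n p (h i) (h i)) - adj_prod n p (h 0) (h 0) / T" .
  also have "\<dots> \<le> ((1 - 1 / P) * (N * P - r) + c\<^sup>2 * S * (1 - 1 / P) - 2 * c * S / P
      - c\<^sup>2 * S\<^sup>2 / (N * T * P * (P - 1))) - adj_prod n p (h 0) (h 0) / T"
    using test_effects_dispersion[OF c]
    unfolding h_def S_def N_def P_def T_def r_def rt_def by (intro diff_right_mono) simp
  finally have "contrast_info t n p d \<le> T * P * (((1 - 1 / P) * (N * P - r) + c\<^sup>2 * S * (1 - 1 / P) - 2 * c * S / P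
      - c\<^sup>2 * S\<^sup>2 / (N * T * P * (P - 1))) - adj_prod n p (h 0) (h 0) / T)"
    unfolding contrast_info_def T_def[symmetric] P_def[symmetric] using T P by (intro mult_left_mono) auto
  also have "\<dots> = T * (P - 1) * (N * P - r) + c\<^sup>2 * (T * (P - 1) * S) - 2 * c * (T * S)
      - c\<^sup>2 * (S\<^sup>2 / (N * (P - 1))) - P * adj_prod n p (h 0) (h 0)"
    using T P N by (simp add: field_simps)
  also have "P * adj_prod n p (h 0) (h 0) = (P * r - A) - 2 * c * B + c\<^sup>2 * (P * rt - rt\<^sup>2 / (N * (P - 1)) - C)"
  proof -
    have "adj_prod n p (h 0) (h 0) = adj_prod n p (direct_ind d 0) (direct_ind d 0)
      + 2 * c * adj_prod n p (direct_ind d 0) (carry_ind d 0) + c\<^sup>2 * adj_prod n p (carry_ind d 0) (carry_ind d 0)"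
      using adj_prod_combine_left[OF n p0, of 1 "direct_ind d 0" c "carry_ind d 0"]
        adj_prod_combine_right[OF n p0, of _ 1 "direct_ind d 0" c "carry_ind d 0"]
        adj_prod_commute[OF n p0, of "carry_ind d 0" "direct_ind d 0"]
      unfolding h_def by (simp add: power2_eq_square algebra_simps)
    hence "P * adj_prod n p (h 0) (h 0) = P * adj_prod n p (direct_ind d 0) (direct_ind d 0)
      + 2 * c * (P * adj_prod n p (direct_ind d 0) (carry_ind d 0))
      + c\<^sup>2 * (P * adj_prod n p (carry_ind d 0) (carry_ind d 0))"
      by (simp add: distrib_left mult.left_commute)
    thus ?thesis
      unfolding P_def adj_control_direct[OF d n p t] adj_control_cross[OF d n p t] adj_control_carry[OF d n p t]
        A_def B_def C_def r_def rt_def N_def by simp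
  qed
  also have "S\<^sup>2 / (N * (P - 1)) = N * (P - 1) - 2 * rt + rt\<^sup>2 / (N * (P - 1))"
    unfolding S_def using N P by (simp add: power2_eq_square field_simps)
  finally show ?thesis unfolding S_def by (simp add: algebra_simps)
qed

end

section \<open>The criterion bounds every design\<close>

context
  fixes t n p :: nat and d :: design
  assumes d: "d \<in> Lambda_class t n p" and n: "0 < n" and p: "2 \<le> p" and t: "0 < t"
begin

lemma control_not_adjacent:
  assumes "Suc k < p" "u < n"
  shows "d (Suc k, Suc u) \<noteq> 0 \<or> d (Suc (Suc k), Suc u) \<noteq> 0"
proof (rule ccontr)
  assume adj: "\<not> ?thesis"
  let ?S = "{(k, u). k \<in> {2..p} \<and> u \<in> {1..n} \<and> d (k, u) = 0 \<and> d (k - 1, u) = 0}"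
  have "finite ?S" by (rule finite_subset[of _ "{2..p} \<times> {1..n}"]) auto
  moreover have "(Suc (Suc k), Suc u) \<in> ?S" using assms adj by simp
  ultimately have "card ?S \<noteq> 0" using card_0_eq by blast
  thus False using Lambda_preceded[OF d n p t, of 0] unfolding preceded_count_def by simp
qed

lemma control_unit_count_less:
  assumes "2 \<le> q" "q \<le> p" "u \<in> {1..n}"
  shows "unit_count q d 0 u \<le> q - 1"
proof -
  obtain w where w: "u = Suc w" "w < n" using assms(3) by (cases u) auto
  have "d (1, u) \<noteq> 0 \<or> d (2, u) \<noteq> 0"
    using control_not_adjacent[of 0 w] assms w by (simp add: numeral_2_eq_2)
  moreover define k :: nat where "k = (if d (1, u) = 0 then 2 else 1)"
  ultimately have k: "k \<in> {1..q}" "d (k, u) \<noteq> 0" using assms by auto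
  have "{k \<in> {1..q}. d (k, u) = 0} \<noteq> {1..q}"
  proof
    assume eq: "{k \<in> {1..q}. d (k, u) = 0} = {1..q}"
    have "k \<in> {k \<in> {1..q}. d (k, u) = 0}" unfolding eq by (rule k(1))
    thus False using k(2) by simp
  qed
  hence "{k \<in> {1..q}. d (k, u) = 0} \<subset> {1..q}" by blast
  hence "card {k \<in> {1..q}. d (k, u) = 0} < card {1..q}" by (intro psubset_card_mono) auto
  thus ?thesis unfolding unit_count_def by simp
qed

text \<open>The units with the control in the first and in the second period are disjoint and equally many.\<close>

lemma control_at_most_half: "2 * real (replication n p d 0) \<le> real n * real p"
proof -
  have "period_count n d 0 1 + period_count n d 0 2
      = card ({u \<in> {1..n}. d (1, u) = 0} \<union> {u \<in> {1..n}. d (2, u) = 0})"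
    unfolding period_count_def
  proof (rule card_Un_disjoint[symmetric])
    show "{u \<in> {1..n}. d (1, u) = 0} \<inter> {u \<in> {1..n}. d (2, u) = 0} = {}"
    proof (intro equals0I)
      fix u assume u: "u \<in> {u \<in> {1..n}. d (1, u) = 0} \<inter> {u \<in> {1..n}. d (2, u) = 0}"
      then obtain w where "u = Suc w" "w < n" by (cases u) auto
      thus False using control_not_adjacent[of 0 w] p u by (auto simp: numeral_2_eq_2)
    qed
  qed auto
  also have "\<dots> \<le> card {1..n}" by (intro card_mono) auto
  finally have "real (period_count n d 0 (Suc 0)) + real (period_count n d 0 (Suc 1)) \<le> n"
    by (simp add: numeral_2_eq_2)
  thus ?thesis
    using Lambda_period_count[OF d n p t, of 0] Lambda_period_count[OF d n p t, of 1] p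
    by (simp add: field_simps)
qed

lemma unit_count_tilde_le: "unit_count (p - 1) d i u \<le> unit_count p d i u"
  unfolding unit_count_def by (intro card_mono) auto

text \<open>
  The lower bounds compare integers with their squares. The upper ones hold because a unit cannot
  receive the control in each of two or more consecutive periods.
\<close>

lemma unit_inner_bounds:
  "replication n p d 0 \<le> unit_inner n p p d"
  "replication n (p - 1) d 0 \<le> unit_inner n p (p - 1) d"
  "unit_inner n p (p - 1) d \<le> (p - 1) * replication n (p - 1) d 0"
  "replication n (p - 1) d 0 \<le> unit_inner n (p - 1) (p - 1) d"
  "3 \<le> p \<Longrightarrow> unit_inner n (p - 1) (p - 1) d \<le> (p - 2) * replication n (p - 1) d 0"
proof -
  show "replication n p d 0 \<le> unit_inner n p p d"
    "replication n (p - 1) d 0 \<le> unit_inner n (p - 1) (p - 1) d"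
    unfolding replication_def unit_inner_def by (auto intro!: sum_mono le_square)
  show "replication n (p - 1) d 0 \<le> unit_inner n p (p - 1) d"
    unfolding replication_def unit_inner_def
  proof (rule sum_mono)
    fix u
    show "unit_count (p - 1) d 0 u \<le> unit_count p d 0 u * unit_count (p - 1) d 0 u"
      using unit_count_tilde_le[of 0 u] by (cases "unit_count (p - 1) d 0 u") auto
  qed
  show "unit_inner n p (p - 1) d \<le> (p - 1) * replication n (p - 1) d 0"
    unfolding replication_def unit_inner_def sum_distrib_left
    using control_unit_count_less[of p] p by (intro sum_mono mult_right_mono) auto
  show "unit_inner n (p - 1) (p - 1) d \<le> (p - 2) * replication n (p - 1) d 0" if "3 \<le> p"
    unfolding replication_def unit_inner_def sum_distrib_left
    using control_unit_count_less[of "p - 1"] that by (intro sum_mono mult_right_mono) fastforce+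
qed

text \<open>The last period decides whether the two counts of a unit differ by one, which ties the three sums together.\<close>

lemma unit_inner_relation:
  "real (unit_inner n p p d) - 2 * real (unit_inner n p (p - 1) d) + real (unit_inner n (p - 1) (p - 1) d)
   = real (replication n p d 0) / p"
proof -
  have last: "unit_count p d 0 u = unit_count (p - 1) d 0 u + (if d (p, u) = 0 then 1 else 0)" for u
  proof -
    have set: "{k \<in> {1..p}. d (k, u) = 0} = {k \<in> {1..p - 1}. d (k, u) = 0} \<union> (if d (p, u) = 0 then {p} else {})"
    proof (rule Set.set_eqI)
      fix k
      show "k \<in> {k \<in> {1..p}. d (k, u) = 0}
          \<longleftrightarrow> k \<in> {k \<in> {1..p - 1}. d (k, u) = 0} \<union> (if d (p, u) = 0 then {p} else {})"
        using p by (cases "k = p") auto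
    qed
    show ?thesis unfolding unit_count_def set using p by (cases "d (p, u) = 0") (simp_all add: card_insert_if)
  qed
  have "real (unit_inner n p p d) - 2 * real (unit_inner n p (p - 1) d) + real (unit_inner n (p - 1) (p - 1) d)
      = (\<Sum>u = 1..n. (real (unit_count p d 0 u) - real (unit_count (p - 1) d 0 u))\<^sup>2)"
    unfolding unit_inner_def
    by (simp add: sum.distrib sum_subtractf sum_distrib_left power2_eq_square algebra_simps)
  also have "\<dots> = (\<Sum>u = 1..n. if d (p, u) = 0 then 1 else 0)"
    by (intro sum.cong) (auto simp: last)
  also have "\<dots> = real (period_count n d 0 p)"
    unfolding period_count_def by (rule real_card_eq_sum[symmetric]) simp
  also have "\<dots> = real (replication n p d 0) / p"
    using Lambda_period_count[OF d n p t, of "p - 1"] p by simp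
  finally show ?thesis .
qed

end

definition designs_with :: "nat \<Rightarrow> nat \<Rightarrow> nat \<Rightarrow> nat \<Rightarrow> design set" where
  "designs_with t n p r = {d \<in> Lambda_class t n p. replication n p d 0 = r}"

lemma finite_designs_with: "finite (designs_with t n p r)"
proof -
  have "finite (designs t n p)" unfolding designs_def by (intro finite_PiE) auto
  thus ?thesis unfolding designs_with_def Lambda_class_def by (auto intro: finite_subset)
qed

lemma mins_eq:
  "A_min t n p r = Min (unit_inner n p p ` designs_with t n p r)"
  "B_min t n p r = Min (unit_inner n p (p - 1) ` designs_with t n p r)"
  "C_min t n p r = Min (unit_inner n (p - 1) (p - 1) ` designs_with t n p r)"
  unfolding A_min_def B_min_def C_min_def unit_inner_def designs_with_def power2_eq_square by simp_all

lemma mins_le: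
  assumes "d \<in> Lambda_class t n p"
  shows "A_min t n p (replication n p d 0) \<le> unit_inner n p p d"
    "B_min t n p (replication n p d 0) \<le> unit_inner n p (p - 1) d"
    "C_min t n p (replication n p d 0) \<le> unit_inner n (p - 1) (p - 1) d"
  unfolding mins_eq using assms finite_designs_with
  by (auto intro!: Min_le simp: designs_with_def)

lemma Min_image_attained:
  assumes "finite S" "S \<noteq> {}"
  shows "\<exists>x\<in>S. Min (f ` S) = f x"
proof -
  have "Min (f ` S) \<in> f ` S" using assms by (intro Min_in) auto
  thus ?thesis by blast
qed

text \<open>
  The parameters of \<open>criterion_arith\<close> in terms of the design: the replications of all tests in the first
  \<open>p - 1\<close> periods, and the polynomials in \<open>A\<close>, \<open>B\<close>, \<open>C\<close> of which \<open>x\<^sub>1\<close> and \<open>y\<^sub>1\<close> are composed.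
\<close>

abbreviation (input) "S_par N P rt \<equiv> N * (P - 1) - rt"
abbreviation (input) "v_par N P T rt C \<equiv> N * (P - 1) * (P * T - T - 1) - (P * T - T + P - 2) * rt + C"
abbreviation (input) "w_par N P rt C \<equiv> P * rt - rt\<^sup>2 / (N * (P - 1)) - C"
abbreviation (input) "X_par N P T r A \<equiv> T * (P - 1) * (N * P - r) - (P * r - A)"

lemma criterion_arith_mins:
  fixes t n p r :: nat
  assumes p3: "3 \<le> p" and pt: "p \<le> t + 1" and n: "1 \<le> n" and r: "r \<in> R_set t n p"
  defines "T \<equiv> real t" and "P \<equiv> real p" and "N \<equiv> real n" and "rt \<equiv> (real p - 1) / real p * real r"
    and "A \<equiv> real (A_min t n p r)" and "B \<equiv> real (B_min t n p r)" and "C \<equiv> real (C_min t n p r)"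
  shows "criterion_arith T P N (real r) A B C rt (S_par N P rt) (T * S_par N P rt - B) (v_par N P T rt C)
    (w_par N P rt C) (X_par N P T (real r) A) (P * real r - A) (N * (P - 1)) (rt / (N * (P - 1)))"
proof -
  have n0: "0 < n" and p2: "2 \<le> p" and t0: "0 < t" using n p3 pt by auto
  let ?D = "designs_with t n p r"
  have ne: "?D \<noteq> {}" using r unfolding R_set_def designs_with_def by auto
  have D: "e \<in> Lambda_class t n p" "replication n p e 0 = r" "real (replication n (p - 1) e 0) = rt"
    if "e \<in> ?D" for e
    using that replication_tilde[of e t n p] n0 p2 t0 unfolding designs_with_def rt_def by auto
  obtain a where a: "a \<in> ?D" "A = unit_inner n p p a"
    using Min_image_attained[OF finite_designs_with ne] unfolding A_def mins_eq by metis
  obtain b where b: "b \<in> ?D" "B = unit_inner n p (p - 1) b"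
    using Min_image_attained[OF finite_designs_with ne] unfolding B_def mins_eq by metis
  obtain c where c: "c \<in> ?D" "C = unit_inner n (p - 1) (p - 1) c"
    using Min_image_attained[OF finite_designs_with ne] unfolding C_def mins_eq by metis
  note bounds = unit_inner_bounds[OF _ n0 p2 t0]
  show ?thesis
  proof
    show "3 \<le> P" "P - 1 \<le> T" "0 < N" "0 < real r"
      using p3 pt n r unfolding P_def T_def N_def R_set_def by auto
    show "2 * real r \<le> N * P"
      using control_at_most_half[OF D(1)[OF a(1)] n0 p2 t0] D(2)[OF a(1)] unfolding N_def P_def by simp
    show "rt = (P - 1) / P * real r" unfolding rt_def P_def ..
    show "real r \<le> A" using bounds(1)[OF D(1)[OF a(1)]] D(2)[OF a(1)] a(2) by simp
    show "rt \<le> B" using bounds(2)[OF D(1)[OF b(1)]] D(3)[OF b(1)] b(2) by linarith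
    have "real (unit_inner n p (p - 1) b) \<le> real ((p - 1) * replication n (p - 1) b 0)"
      using bounds(3)[OF D(1)[OF b(1)]] by (simp only: of_nat_le_iff)
    thus "B \<le> (P - 1) * rt" using D(3)[OF b(1)] b(2) p2 unfolding P_def by (simp add: of_nat_diff)
    show "rt \<le> C" using bounds(4)[OF D(1)[OF c(1)]] D(3)[OF c(1)] c(2) by linarith
    have "real (unit_inner n (p - 1) (p - 1) c) \<le> real ((p - 2) * replication n (p - 1) c 0)"
      using bounds(5)[OF D(1)[OF c(1)] p3] by (simp only: of_nat_le_iff)
    thus "C \<le> (P - 2) * rt" using D(3)[OF c(1)] c(2) p2 unfolding P_def by (simp add: of_nat_diff)
  qed (rule refl)+
qed

lemma x1_y1_eq:
  fixes t n p r :: nat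
  assumes p: "2 \<le> p" and n: "0 < n"
  defines "T \<equiv> real t" and "P \<equiv> real p" and "N \<equiv> real n" and "rt \<equiv> (real p - 1) / real p * real r"
    and "A \<equiv> real (A_min t n p r)" and "B \<equiv> real (B_min t n p r)" and "C \<equiv> real (C_min t n p r)"
  shows "x1 t n p r = X_par N P T (real r) A - (T * S_par N P rt - B)\<^sup>2 / v_par N P T rt C"
    and "y1 t n p r = P * real r - A - B\<^sup>2 / w_par N P rt C"
proof -
  have P: "1 < P" and N: "0 < N" using p n by (auto simp: P_def N_def)
  have "P * (real r - 1 / P * A) = P * real r - A" using P by (simp add: field_simps)
  moreover have "N * T * (P - 1) - T * rt - B = T * S_par N P rt - B" by (simp add: algebra_simps)
  ultimately show "x1 t n p r = X_par N P T (real r) A - (T * S_par N P rt - B)\<^sup>2 / v_par N P T rt C"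
    unfolding x1_def Let_def T_def P_def N_def rt_def A_def B_def C_def by simp
  have q: "0 < N * (P - 1)" using P N by simp
  have "q * (P * rt - rt\<^sup>2 / q - C) = q * P * rt - rt\<^sup>2 - q * C" if "0 < q" for q
    using that by (simp add: right_diff_distrib)
  from this[OF q] have den: "N * P * (P - 1) * rt - rt\<^sup>2 - N * (P - 1) * C = (N * (P - 1)) * w_par N P rt C"
    by (simp add: mult.commute mult.left_commute)
  have "N * (P - 1) * B\<^sup>2 / (N * P * (P - 1) * rt - rt\<^sup>2 - N * (P - 1) * C) = B\<^sup>2 / w_par N P rt C"
    unfolding den using P N by simp
  thus "y1 t n p r = P * real r - A - B\<^sup>2 / w_par N P rt C"
    using \<open>P * (real r - 1 / P * A) = P * real r - A\<close>
    unfolding y1_def Let_def T_def P_def N_def rt_def A_def B_def C_def by simp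
qed

text \<open>Without information on the control the tangent bound grows without limit in \<open>m0\<close>.\<close>

lemma singular_if_no_control_info:
  assumes d: "d \<in> designs t n p" and n: "0 < n" and p: "0 < p" and t: "0 < t"
    and c: "control_info t n p d \<le> 0"
  shows "mat_inverse (control_info_mat t n p d) = None"
proof (rule ccontr)
  assume "mat_inverse (control_info_mat t n p d) \<noteq> None"
  then obtain V where V: "mat_inverse (control_info_mat t n p d) = Some V" by auto
  define m where "m = \<bar>\<Sum>i<t. V $$ (i, i)\<bar> + 1"
  have "2 * m - m\<^sup>2 * control_info t n p d / (real t * real p) \<le> (\<Sum>i<t. V $$ (i, i))"
    using trace_inverse_tangent[OF d n p t V, of 0 m] by simp
  moreover have "m\<^sup>2 * control_info t n p d / (real t * real p) \<le> 0"
    using c by (intro divide_nonpos_nonneg mult_nonneg_nonpos) auto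
  moreover have "(\<Sum>i<t. V $$ (i, i)) < m" "0 < m" unfolding m_def by linarith+
  ultimately show False by linarith
qed

context
  fixes t n p :: nat
  assumes p3: "3 \<le> p" and pt: "p \<le> t + 1" and n1: "1 \<le> n"
begin

lemma criterion_positive:
  assumes "r \<in> R_set t n p"
  shows "0 < x1 t n p r"
    and "0 < v_par (real n) (real p) (real t) ((real p - 1) / real p * real r) (real (C_min t n p r))"
    and "0 < w_par (real n) (real p) ((real p - 1) / real p * real r) (real (C_min t n p r))"
proof -
  interpret criterion_arith "real t" "real p" "real n" "real r" "real (A_min t n p r)" "real (B_min t n p r)"
    "real (C_min t n p r)" "(real p - 1) / real p * real r"
    "S_par (real n) (real p) ((real p - 1) / real p * real r)"
    "real t * S_par (real n) (real p) ((real p - 1) / real p * real r) - real (B_min t n p r)"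
    "v_par (real n) (real p) (real t) ((real p - 1) / real p * real r) (real (C_min t n p r))"
    "w_par (real n) (real p) ((real p - 1) / real p * real r) (real (C_min t n p r))"
    "X_par (real n) (real p) (real t) (real r) (real (A_min t n p r))"
    "real p * real r - real (A_min t n p r)" "real n * (real p - 1)"
    "(real p - 1) / real p * real r / (real n * (real p - 1))"
    by (rule criterion_arith_mins[OF p3 pt n1 assms])
  show "0 < x1 t n p r" using x_pos x1_y1_eq(1)[of p n t r] p3 n1 unfolding x_def by simp
  show "0 < v_par (real n) (real p) (real t) ((real p - 1) / real p * real r) (real (C_min t n p r))" by (rule v_pos)
  show "0 < w_par (real n) (real p) ((real p - 1) / real p * real r) (real (C_min t n p r))" by (rule w_bounds(1))
qed

text \<open>
  The three minima may be attained by different designs, so the bounds of a design are compared with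
  those at the minima through the differences of the three sums.
\<close>

lemma control_info_le_y1:
  assumes d: "d \<in> Lambda_class t n p" and r: "0 < replication n p d 0"
  shows "control_info t n p d \<le> y1 t n p (replication n p d 0)"
    and "0 < y1 t n p (replication n p d 0) \<Longrightarrow> mat_inverse (control_info_mat t n p d) = Some V \<Longrightarrow>
      real t * (real t - 1)\<^sup>2 * real p / x1 t n p (replication n p d 0)
        + real t * real p / y1 t n p (replication n p d 0) \<le> (\<Sum>i<t. V $$ (i, i))"
proof -
  have n0: "0 < n" and p2: "2 \<le> p" and p0: "0 < p" and t0: "0 < t" using n1 p3 pt by auto
  define r where "r = replication n p d 0"
  define rt where "rt = (real p - 1) / real p * real r"
  have rR: "r \<in> R_set t n p" unfolding R_set_def r_def using d assms(2) by auto
  have rt_eq: "real (replication n (p - 1) d 0) = rt"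
    unfolding rt_def r_def by (rule replication_tilde[OF d n0 p2 t0])
  have control_le: "control_info t n p d \<le> (real p * real r - A - (real (unit_inner n p p d) - A))
      - 2 * e * real (unit_inner n p (p - 1) d)
      + e\<^sup>2 * (w_par (real n) (real p) rt C - (real (unit_inner n (p - 1) (p - 1) d) - C))" for e A C
    using control_info_le[OF d n0 p2 t0, of e] unfolding rt_eq r_def[symmetric] by (simp add: algebra_simps)
  have contrast_le: "contrast_info t n p d \<le> (X_par (real n) (real p) (real t) (real r) A + (real (unit_inner n p p d) - A))
      - 2 * c * (real t * S_par (real n) (real p) rt - B - (real (unit_inner n p (p - 1) d) - B))
      + c\<^sup>2 * (v_par (real n) (real p) (real t) rt C + (real (unit_inner n (p - 1) (p - 1) d) - C))"
    if "0 \<le> c" for c A B C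
    using contrast_info_le[OF d n0 p2 t0 that] unfolding rt_eq r_def[symmetric] by (simp add: algebra_simps)
  interpret criterion_arith "real t" "real p" "real n" "real r" "real (A_min t n p r)" "real (B_min t n p r)"
    "real (C_min t n p r)" rt "S_par (real n) (real p) rt"
    "real t * S_par (real n) (real p) rt - real (B_min t n p r)"
    "v_par (real n) (real p) (real t) rt (real (C_min t n p r))"
    "w_par (real n) (real p) rt (real (C_min t n p r))"
    "X_par (real n) (real p) (real t) (real r) (real (A_min t n p r))"
    "real p * real r - real (A_min t n p r)" "real n * (real p - 1)" "rt / (real n * (real p - 1))"
    unfolding rt_def by (rule criterion_arith_mins[OF p3 pt n1 rR])
  have xy: "x1 t n p r = x" "y1 t n p r = y"
    using x1_y1_eq[OF p2 n0, of t r] unfolding x_def y_def rt_def[symmetric] by simp_all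
  have mins: "real (A_min t n p r) \<le> real (unit_inner n p p d)"
    "real (B_min t n p r) \<le> real (unit_inner n p (p - 1) d)"
    "real (C_min t n p r) \<le> real (unit_inner n (p - 1) (p - 1) d)"
    using mins_le[OF d] unfolding r_def by (simp_all only: of_nat_le_iff)
  have yd: "control_info t n p d \<le> (real p * real r - real (A_min t n p r)
      - (real (unit_inner n p p d) - real (A_min t n p r))) - 2 * e * real (unit_inner n p (p - 1) d)
      + e\<^sup>2 * (w_par (real n) (real p) rt (real (C_min t n p r))
        - (real (unit_inner n (p - 1) (p - 1) d) - real (C_min t n p r)))"
    by (rule control_le)
  show "control_info t n p d \<le> y1 t n p (replication n p d 0)"
    using control_bound(2)[OF mins yd] unfolding r_def[symmetric] xy(2) .
  assume y_pos: "0 < y1 t n p (replication n p d 0)" and V: "mat_inverse (control_info_mat t n p d) = Some V"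
  have y0: "0 < y" using y_pos xy(2) r_def by simp
  have xd: "contrast_info t n p d \<le> (X_par (real n) (real p) (real t) (real r) (real (A_min t n p r))
        + (real (unit_inner n p p d) - real (A_min t n p r)))
      - 2 * c * (real t * S_par (real n) (real p) rt - real (B_min t n p r)
        - (real (unit_inner n p (p - 1) d) - real (B_min t n p r)))
      + c\<^sup>2 * (v_par (real n) (real p) (real t) rt (real (C_min t n p r))
        + (real (unit_inner n (p - 1) (p - 1) d) - real (C_min t n p r)))"
    by (rule contrast_le[OF c_bounds(1)])
  define m1 where "m1 = real t * real p * (real t - 1) / x"
  define m0 where "m0 = real t * real p / y"
  have "(real t - 1) * m1 + m0 \<le> (\<Sum>i<t. V $$ (i, i))"
    using tangent_bound[OF y0 mins xd yd m1_def m0_def]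
      trace_inverse_tangent[OF Lambda_designs[OF d n0 p2 t0] n0 p0 t0 V, of m1 m0] by linarith
  moreover have "real t * (real t - 1)\<^sup>2 * real p / x = (real t - 1) * m1"
    unfolding m1_def by (simp add: power2_eq_square)
  ultimately show "real t * (real t - 1)\<^sup>2 * real p / x1 t n p (replication n p d 0)
        + real t * real p / y1 t n p (replication n p d 0) \<le> (\<Sum>i<t. V $$ (i, i))"
    unfolding r_def[symmetric] xy m0_def by simp
qed

lemma control_info_nonneg: "0 \<le> control_info t n p d"
  unfolding control_info_def by (simp add: info_form_nonneg)

lemma y1_nonneg:
  assumes "r \<in> R_set t n p"
  shows "0 \<le> y1 t n p r"
proof -
  obtain d where "d \<in> Lambda_class t n p" "replication n p d 0 = r" "0 < r"
    using assms unfolding R_set_def by auto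
  thus ?thesis using control_info_le_y1(1)[of d] control_info_nonneg[of d] by auto
qed

lemma inverse_some_imp:
  assumes d: "d \<in> Lambda_class t n p" and V: "mat_inverse (control_info_mat t n p d) = Some V"
  shows "replication n p d 0 \<in> R_set t n p" "0 < y1 t n p (replication n p d 0)"
proof -
  have n0: "0 < n" and p2: "2 \<le> p" and p0: "0 < p" and t0: "0 < t" using n1 p3 pt by auto
  have pos: "0 < control_info t n p d"
    using singular_if_no_control_info[OF Lambda_designs[OF d n0 p2 t0] n0 p0 t0] V by force
  have r: "0 < replication n p d 0"
  proof (rule ccontr)
    assume "\<not> ?thesis"
    hence "control_info t n p d \<le> 0" using control_info_le[OF d n0 p2 t0, of 0] by simp
    thus False using pos by simp
  qed
  show "replication n p d 0 \<in> R_set t n p" using d r unfolding R_set_def by auto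
  show "0 < y1 t n p (replication n p d 0)" using control_info_le_y1(1)[OF d r] pos by linarith
qed

end

section \<open>Arrays that do not distinguish the test treatments\<close>

text \<open>
  An entry may depend only on which of its indices are the control and on whether they coincide. In
  this form, invariance under permutations of the tests passes to all arithmetic combinations.
\<close>

definition test_symmetric :: "nat \<Rightarrow> (nat \<Rightarrow> nat \<Rightarrow> real) \<Rightarrow> bool" where
  "test_symmetric t K \<longleftrightarrow> (\<exists>\<phi> :: bool \<Rightarrow> bool \<Rightarrow> bool \<Rightarrow> real. \<forall>i\<le>t. \<forall>j\<le>t. K i j = \<phi> (i = 0) (j = 0) (i = j))"

lemma test_symmetric_binary:
  assumes "test_symmetric t K" "test_symmetric t K'"
  shows "test_symmetric t (\<lambda>i j. f (K i j) (K' i j))"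
proof -
  obtain \<phi> \<psi> where \<phi>: "\<And>i j. i \<le> t \<Longrightarrow> j \<le> t \<Longrightarrow> K i j = \<phi> (i = 0) (j = 0) (i = j)"
    and \<psi>: "\<And>i j. i \<le> t \<Longrightarrow> j \<le> t \<Longrightarrow> K' i j = \<psi> (i = 0) (j = 0) (i = j)"
    using assms unfolding test_symmetric_def by metis
  show ?thesis
    unfolding test_symmetric_def
    by (rule exI[of _ "\<lambda>a b c. f (\<phi> a b c) (\<psi> a b c)"]) (auto simp: \<phi> \<psi>)
qed

lemma test_symmetric_const: "test_symmetric t (\<lambda>_ _. a)"
  unfolding test_symmetric_def by (rule exI[of _ "\<lambda>_ _ _. a"]) simp

lemma test_symmetric_unary: "test_symmetric t K \<Longrightarrow> test_symmetric t (\<lambda>i j. f (K i j))"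
  using test_symmetric_binary[of t K K "\<lambda>a _. f a"] by simp

lemma test_symmetric_sum:
  assumes "\<And>x. x \<in> S \<Longrightarrow> test_symmetric t (K x)"
  shows "test_symmetric t (\<lambda>i j. \<Sum>x\<in>S. K x i j)"
  using assms
proof (induction S rule: infinite_finite_induct)
  case (insert x S)
  have "test_symmetric t (K x)" by (rule insert.prems) simp
  moreover have "test_symmetric t (\<lambda>i j. \<Sum>x\<in>S. K x i j)"
    by (rule insert.IH) (rule insert.prems, simp)
  ultimately have "test_symmetric t (\<lambda>i j. K x i j + (\<Sum>x\<in>S. K x i j))"
    by (rule test_symmetric_binary)
  thus ?case using insert.hyps by simp
qed (auto intro: test_symmetric_const)

lemma test_symmetric_product:
  assumes "\<And>i. i \<in> {1..t} \<Longrightarrow> f i = a" "\<And>i. i \<in> {1..t} \<Longrightarrow> g i = b"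
  shows "test_symmetric t (\<lambda>i j. f i * g j)"
  unfolding test_symmetric_def
  by (rule exI[of _ "\<lambda>x y _. (if x then f 0 else a) * (if y then g 0 else b)"]) (auto simp: assms)

lemma test_symmetric_diagonal:
  assumes "\<And>i. i \<in> {1..t} \<Longrightarrow> f i = a"
  shows "test_symmetric t (\<lambda>i j. if i = j then f i else 0)"
  unfolding test_symmetric_def
  by (rule exI[of _ "\<lambda>x _ z. if z then (if x then f 0 else a) else 0"]) (auto simp: assms)

lemma test_symmetricI:
  assumes "\<And>i. i \<in> {1..t} \<Longrightarrow> K i i = a" "\<And>i. i \<in> {1..t} \<Longrightarrow> K i 0 = b" "\<And>i. i \<in> {1..t} \<Longrightarrow> K 0 i = c"
    "\<And>i j. i \<in> {1..t} \<Longrightarrow> j \<in> {1..t} \<Longrightarrow> i \<noteq> j \<Longrightarrow> K i j = e"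
  shows "test_symmetric t K"
  unfolding test_symmetric_def
proof (rule exI[of _ "\<lambda>x y z. if x then (if y then K 0 0 else c) else if y then b else if z then a else e"],
    intro allI impI)
  fix i j assume "i \<le> t" "j \<le> t"
  then consider "i = 0" "j = 0" | "i = 0" "j \<in> {1..t}" | "i \<in> {1..t}" "j = 0"
    | "i \<in> {1..t}" "j \<in> {1..t}" "i = j" | "i \<in> {1..t}" "j \<in> {1..t}" "i \<noteq> j"
    by (cases "i = 0"; cases "j = 0") auto
  thus "K i j = (if i = 0 then (if j = 0 then K 0 0 else c) else if j = 0 then b else if i = j then a else e)"
  proof cases
    case 2
    thus ?thesis using assms(3)[of j] by simp
  next
    case 3
    thus ?thesis using assms(2)[of i] by simp
  next
    case 4
    thus ?thesis using assms(1)[of i] by simp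
  next
    case 5
    thus ?thesis using assms(4)[of i j] by simp
  qed simp
qed

text \<open>
  Such an array with zero row and column sums has only two free entries, one on the diagonal for the
  control and one for the tests.
\<close>

lemma test_symmetric_entries:
  assumes K: "test_symmetric t K" and t: "0 < t"
    and rows: "\<And>i. i \<le> t \<Longrightarrow> (\<Sum>j\<le>t. K i j) = 0" and cols: "\<And>j. j \<le> t \<Longrightarrow> (\<Sum>i\<le>t. K i j) = 0"
  shows "i \<in> {1..t} \<Longrightarrow> real t * K i 0 = - K 0 0" "i \<in> {1..t} \<Longrightarrow> real t * K 0 i = - K 0 0"
    "i \<in> {1..t} \<Longrightarrow> j \<in> {1..t} \<Longrightarrow> i \<noteq> j \<Longrightarrow> real t * (real t - 1) * (K i i - K i j) = (real t)\<^sup>2 * K i i - K 0 0"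
proof -
  obtain \<phi> where \<phi>: "\<And>i j. i \<le> t \<Longrightarrow> j \<le> t \<Longrightarrow> K i j = \<phi> (i = 0) (j = 0) (i = j)"
    using K unfolding test_symmetric_def by metis
  have "K 0 0 + (\<Sum>i = 1..t. K i 0) = 0" using cols[of 0] unfolding sum_atMost_split by simp
  also have "(\<Sum>i = 1..t. K i 0) = (\<Sum>i = 1..t. \<phi> False True False)" by (intro sum.cong) (auto simp: \<phi>)
  finally have k: "real t * \<phi> False True False = - K 0 0" by simp
  have "K 0 0 + (\<Sum>j = 1..t. K 0 j) = 0" using rows[of 0] unfolding sum_atMost_split by simp
  also have "(\<Sum>j = 1..t. K 0 j) = (\<Sum>j = 1..t. \<phi> True False False)" by (intro sum.cong) (auto simp: \<phi>)
  finally have k': "real t * \<phi> True False False = - K 0 0" by simp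
  show i0: "real t * K i 0 = - K 0 0" if "i \<in> {1..t}" for i using k that by (simp add: \<phi>)
  show "real t * K 0 i = - K 0 0" if "i \<in> {1..t}" for i using k' that by (simp add: \<phi>)
  show "real t * (real t - 1) * (K i i - K i j) = (real t)\<^sup>2 * K i i - K 0 0"
    if ij: "i \<in> {1..t}" "j \<in> {1..t}" "i \<noteq> j" for i j
  proof -
    have "0 = K i 0 + (\<Sum>k = 1..t. K i k)" using rows[of i] ij unfolding sum_atMost_split by simp
    also have "(\<Sum>k = 1..t. K i k) = (\<Sum>k = 1..t. (if k = i then K i i - K i j else 0) + K i j)"
      using ij by (intro sum.cong) (auto simp: \<phi>)
    also have "\<dots> = (K i i - K i j) + t * K i j" using ij by (simp add: sum.distrib)
    finally have "real t * (K i i - K i j) = real t * K i i + K i 0 + (K i i - K i j)"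
      by (simp add: algebra_simps)
    hence "(real t - 1) * (K i i - K i j) = real t * K i i + K i 0" by (simp add: algebra_simps)
    hence "real t * ((real t - 1) * (K i i - K i j)) = real t * (real t * K i i) + real t * K i 0"
      by (simp add: distrib_left)
    thus ?thesis using i0[OF ij(1)] by (simp add: power2_eq_square mult.assoc)
  qed
qed

lemma test_symmetric_column_diff:
  assumes K: "test_symmetric t K" and ij: "i \<in> {1..t}" "j \<in> {1..t}" "i \<noteq> j" and k: "k \<le> t"
  shows "K k i - K k j = ((if k = i then 1 else 0) - (if k = j then 1 else 0)) * (K i i - K i j)"
    and "K i k - K j k = ((if k = i then 1 else 0) - (if k = j then 1 else 0)) * (K i i - K i j)"
proof -
  obtain \<phi> where "\<And>i j. i \<le> t \<Longrightarrow> j \<le> t \<Longrightarrow> K i j = \<phi> (i = 0) (j = 0) (i = j)"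
    using K unfolding test_symmetric_def by metis
  thus "K k i - K k j = ((if k = i then 1 else 0) - (if k = j then 1 else 0)) * (K i i - K i j)"
    "K i k - K j k = ((if k = i then 1 else 0) - (if k = j then 1 else 0)) * (K i i - K i j)"
    using ij k by auto
qed


section \<open>Totally balanced designs attain the bound\<close>

lemma sum_binary_product:
  fixes a b :: "nat \<Rightarrow> nat"
  assumes "\<And>u. u \<in> {1..n} \<Longrightarrow> a u \<le> 1" "\<And>u. u \<in> {1..n} \<Longrightarrow> b u \<le> 1"
  shows "(\<Sum>u = 1..n. real (a u) * real (b u)) = real (card {u \<in> {1..n}. 1 \<le> a u \<and> 1 \<le> b u})"
  unfolding real_card_eq_sum[OF finite_atLeastAtMost]
proof (rule sum.cong[OF refl])
  fix u assume "u \<in> {1..n}"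
  hence "a u = 0 \<or> a u = 1" "b u = 0 \<or> b u = 1" using assms by (auto simp: le_Suc_eq)
  thus "real (a u) * real (b u) = (if 1 \<le> a u \<and> 1 \<le> b u then 1 else 0)" by auto
qed

text \<open>
  The design conditions count the units in which \<open>a\<close> takes the smaller of its two values; this recovers
  the inner product with a binary count from them.
\<close>

lemma sum_two_valued_product:
  fixes a b :: "nat \<Rightarrow> nat"
  assumes "\<And>u. u \<in> {1..n} \<Longrightarrow> a u = \<kappa> \<or> a u = \<kappa> + 1" "\<And>u. u \<in> {1..n} \<Longrightarrow> b u \<le> 1"
  shows "(\<Sum>u = 1..n. real (a u) * real (b u))
    = (real \<kappa> + 1) * (\<Sum>u = 1..n. real (b u)) - real (card {u \<in> {1..n}. a u = \<kappa> \<and> 1 \<le> b u})"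
  unfolding real_card_eq_sum[OF finite_atLeastAtMost] sum_distrib_left sum_subtractf[symmetric]
proof (rule sum.cong[OF refl])
  fix u assume "u \<in> {1..n}"
  hence "a u = \<kappa> \<or> a u = \<kappa> + 1" "b u = 0 \<or> b u = 1" using assms by (auto simp: le_Suc_eq)
  thus "real (a u) * real (b u) = (real \<kappa> + 1) * real (b u) - (if a u = \<kappa> \<and> 1 \<le> b u then 1 else 0)"
    by auto
qed

lemma test_symmetric_unit_sums:
  fixes a b :: "nat \<Rightarrow> nat \<Rightarrow> nat"
  assumes bin: "\<And>i u. i \<in> {1..t} \<Longrightarrow> u \<in> {1..n} \<Longrightarrow> a i u \<le> 1" "\<And>i u. i \<in> {1..t} \<Longrightarrow> u \<in> {1..n} \<Longrightarrow> b i u \<le> 1"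
    and two: "\<And>u. u \<in> {1..n} \<Longrightarrow> a 0 u = \<kappa> \<or> a 0 u = \<kappa> + 1" "\<And>u. u \<in> {1..n} \<Longrightarrow> b 0 u = \<kappa>' \<or> b 0 u = \<kappa>' + 1"
    and reps: "\<And>i. i \<in> {1..t} \<Longrightarrow> (\<Sum>u = 1..n. a i u) = r" "\<And>i. i \<in> {1..t} \<Longrightarrow> (\<Sum>u = 1..n. b i u) = r'"
    and diag: "\<And>i. i \<in> {1..t} \<Longrightarrow> (\<Sum>u = 1..n. real (a i u) * real (b i u)) = m"
    and pairs: "\<forall>i\<in>{1..t}. \<forall>j\<in>{1..t}. i \<noteq> j \<longrightarrow> card {u \<in> {1..n}. 1 \<le> a i u \<and> 1 \<le> b j u} = x"
    and control: "\<forall>i\<in>{1..t}. card {u \<in> {1..n}. a 0 u = \<kappa> \<and> 1 \<le> b i u} = y"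
      "\<forall>i\<in>{1..t}. card {u \<in> {1..n}. b 0 u = \<kappa>' \<and> 1 \<le> a i u} = z"
  shows "test_symmetric t (\<lambda>i j. \<Sum>u = 1..n. real (a i u) * real (b j u))"
proof (rule test_symmetricI)
  fix i assume i: "i \<in> {1..t}"
  show "(\<Sum>u = 1..n. real (a i u) * real (b i u)) = m" by (rule diag[OF i])
  show "(\<Sum>u = 1..n. real (a 0 u) * real (b i u)) = (real \<kappa> + 1) * real r' - real y"
    using sum_two_valued_product[of n "a 0" \<kappa> "b i"] two(1) bin(2)[OF i] bspec[OF control(1) i]
    unfolding reps(2)[OF i, symmetric] of_nat_sum by simp
  show "(\<Sum>u = 1..n. real (a i u) * real (b 0 u)) = (real \<kappa>' + 1) * real r - real z"
    using sum_two_valued_product[of n "b 0" \<kappa>' "a i"] two(2) bin(1)[OF i] bspec[OF control(2) i]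
    unfolding reps(1)[OF i, symmetric] of_nat_sum by (simp add: mult.commute)
  fix j assume j: "j \<in> {1..t}" "i \<noteq> j"
  show "(\<Sum>u = 1..n. real (a i u) * real (b j u)) = real x"
    using sum_binary_product[of n "a i" "b j"] bin(1)[OF i] bin(2)[OF j(1)] bspec[OF bspec[OF pairs i] j(1)] j(2)
    by simp
qed

text \<open>
  A balanced distribution of a fixed total over the units minimizes the sum of squares, since
  \<open>(a - \<kappa>) (a - \<kappa> - 1)\<close> is never negative on integers and vanishes at the two admitted values.
\<close>

lemma two_valued_minimizes_squares:
  fixes a b :: "nat \<Rightarrow> nat"
  assumes "\<And>u. u \<in> {1..n} \<Longrightarrow> a u = \<kappa> \<or> a u = \<kappa> + 1" "(\<Sum>u = 1..n. a u) = (\<Sum>u = 1..n. b u)"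
  shows "(\<Sum>u = 1..n. a u * a u) \<le> (\<Sum>u = 1..n. b u * b u)"
proof -
  have eq: "(\<Sum>u = 1..n. int (a u) * int (a u)) = (2 * int \<kappa> + 1) * (\<Sum>u = 1..n. int (a u)) - (\<Sum>u = 1..n. int \<kappa> * (int \<kappa> + 1))"
    unfolding sum_distrib_left sum_subtractf[symmetric]
  proof (rule sum.cong[OF refl])
    fix u assume "u \<in> {1..n}"
    thus "int (a u) * int (a u) = (2 * int \<kappa> + 1) * int (a u) - int \<kappa> * (int \<kappa> + 1)"
      using assms(1)[of u] by (auto simp: algebra_simps)
  qed
  have le: "(2 * int \<kappa> + 1) * (\<Sum>u = 1..n. int (b u)) - (\<Sum>u = 1..n. int \<kappa> * (int \<kappa> + 1)) \<le> (\<Sum>u = 1..n. int (b u) * int (b u))"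
    unfolding sum_distrib_left sum_subtractf[symmetric]
  proof (rule sum_mono)
    fix u
    have "0 \<le> (int (b u) - int \<kappa>) * (int (b u) - int \<kappa> - 1)"
      by (cases "int (b u) \<le> int \<kappa>") (auto intro: mult_nonneg_nonneg mult_nonpos_nonpos)
    thus "(2 * int \<kappa> + 1) * int (b u) - int \<kappa> * (int \<kappa> + 1) \<le> int (b u) * int (b u)"
      by (simp add: algebra_simps)
  qed
  have "(\<Sum>u = 1..n. int (a u)) = (\<Sum>u = 1..n. int (b u))"
    using assms(2) by (metis of_nat_sum)
  hence "(\<Sum>u = 1..n. int (a u) * int (a u)) \<le> (\<Sum>u = 1..n. int (b u) * int (b u))"
    using eq le by simp
  hence "int (\<Sum>u = 1..n. a u * a u) \<le> int (\<Sum>u = 1..n. b u * b u)" by simp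
  thus ?thesis by (simp only: of_nat_le_iff)
qed

lemma restrict_counts:
  assumes "q \<le> p"
  shows "u \<in> {1..n} \<Longrightarrow> unit_count q (restrict d ({1..q} \<times> {1..n})) i u = unit_count q d i u"
    and "replication n q (restrict d ({1..q} \<times> {1..n})) i = replication n q d i"
proof -
  show *: "unit_count q (restrict d ({1..q} \<times> {1..n})) i u = unit_count q d i u" if "u \<in> {1..n}" for u
    unfolding unit_count_def using that by (intro arg_cong[of _ _ card]) auto
  show "replication n q (restrict d ({1..q} \<times> {1..n})) i = replication n q d i"
    unfolding replication_def using * by (intro sum.cong) auto
qed

context
  fixes t n p :: nat and d :: design
  assumes tb: "totally_balanced t n p d" and p3: "3 \<le> p" and pt: "p \<le> t + 1" and n1: "1 \<le> n"
begin

lemma balanced_Lambda: "d \<in> Lambda_class t n p"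
  using tb unfolding totally_balanced_def Lambda_class_def balanced_precedence_def proportional_periods_def
  by auto

lemma balanced_direct_facts:
  "\<exists>c. \<forall>i\<in>{1..t}. replication n p d i = c"
  "i \<in> {1..t} \<Longrightarrow> u \<in> {1..n} \<Longrightarrow> unit_count p d i u \<le> 1"
  "\<exists>c. \<forall>i\<in>{1..t}. \<forall>j\<in>{1..t}. i \<noteq> j \<longrightarrow> card {u \<in> {1..n}. 1 \<le> unit_count p d i u \<and> 1 \<le> unit_count p d j u} = c"
  "u \<in> {1..n} \<Longrightarrow> unit_count p d 0 u = replication n p d 0 div n \<or> unit_count p d 0 u = replication n p d 0 div n + 1"
  "\<exists>c. \<forall>i\<in>{1..t}. card {u \<in> {1..n}. unit_count p d 0 u = replication n p d 0 div n \<and> 1 \<le> unit_count p d i u} = c"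
proof -
  have b: "balanced_direct t n p d" using tb unfolding totally_balanced_def by (elim conjE)
  show "\<exists>c. \<forall>i\<in>{1..t}. replication n p d i = c"
    using b unfolding balanced_direct_def by (elim conjE)
  show "\<exists>c. \<forall>i\<in>{1..t}. \<forall>j\<in>{1..t}. i \<noteq> j \<longrightarrow> card {u \<in> {1..n}. 1 \<le> unit_count p d i u \<and> 1 \<le> unit_count p d j u} = c"
    using b unfolding balanced_direct_def by (elim conjE)
  show "\<exists>c. \<forall>i\<in>{1..t}. card {u \<in> {1..n}. unit_count p d 0 u = replication n p d 0 div n \<and> 1 \<le> unit_count p d i u} = c"
    using b unfolding balanced_direct_def by (elim conjE)
  have "\<forall>i\<in>{1..t}. \<forall>u\<in>{1..n}. unit_count p d i u \<le> 1"
    using b unfolding balanced_direct_def by (elim conjE)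
  thus "i \<in> {1..t} \<Longrightarrow> u \<in> {1..n} \<Longrightarrow> unit_count p d i u \<le> 1" by (elim ballE) auto
  have "\<forall>u\<in>{1..n}. unit_count p d 0 u = replication n p d 0 div n \<or> unit_count p d 0 u = replication n p d 0 div n + 1"
    using b unfolding balanced_direct_def by (elim conjE)
  thus "u \<in> {1..n} \<Longrightarrow> unit_count p d 0 u = replication n p d 0 div n \<or> unit_count p d 0 u = replication n p d 0 div n + 1"
    by (rule bspec)
qed

lemma balanced_carryover_facts:
  "\<exists>c. \<forall>i\<in>{1..t}. replication n (p - 1) d i = c"
  "i \<in> {1..t} \<Longrightarrow> u \<in> {1..n} \<Longrightarrow> unit_count (p - 1) d i u \<le> 1"
  "\<exists>c. \<forall>i\<in>{1..t}. \<forall>j\<in>{1..t}. i \<noteq> j \<longrightarrow>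
      card {u \<in> {1..n}. 1 \<le> unit_count (p - 1) d i u \<and> 1 \<le> unit_count (p - 1) d j u} = c"
  "u \<in> {1..n} \<Longrightarrow> unit_count (p - 1) d 0 u = replication n (p - 1) d 0 div n
      \<or> unit_count (p - 1) d 0 u = replication n (p - 1) d 0 div n + 1"
  "\<exists>c. \<forall>i\<in>{1..t}. card {u \<in> {1..n}. unit_count (p - 1) d 0 u = replication n (p - 1) d 0 div n
      \<and> 1 \<le> unit_count (p - 1) d i u} = c"
proof -
  let ?d = "restrict d ({1..p - 1} \<times> {1..n})"
  have set_cong: "{u \<in> {1..n}. Q (\<lambda>i. unit_count (p - 1) ?d i u)} = {u \<in> {1..n}. Q (\<lambda>i. unit_count (p - 1) d i u)}"
    for Q :: "(nat \<Rightarrow> nat) \<Rightarrow> bool"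
    by (rule Collect_cong) (use restrict_counts(1)[OF order_refl] in \<open>simp cong: conj_cong\<close>)
  note set_eqs = set_cong[of "\<lambda>f. 1 \<le> f i \<and> 1 \<le> f j" for i j] set_cong[of "\<lambda>f. f 0 = q \<and> 1 \<le> f i" for i q]
  have "balanced_direct t n (p - 1) ?d"
    using tb unfolding totally_balanced_def balanced_carryover_def by (elim conjE)
  note b = this[unfolded balanced_direct_def restrict_counts(2)[OF order_refl] set_eqs]
  show "\<exists>c. \<forall>i\<in>{1..t}. replication n (p - 1) d i = c"
    using b by (elim conjE)
  show "\<exists>c. \<forall>i\<in>{1..t}. \<forall>j\<in>{1..t}. i \<noteq> j \<longrightarrow>
      card {u \<in> {1..n}. 1 \<le> unit_count (p - 1) d i u \<and> 1 \<le> unit_count (p - 1) d j u} = c"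
    using b by (elim conjE)
  show "\<exists>c. \<forall>i\<in>{1..t}. card {u \<in> {1..n}. unit_count (p - 1) d 0 u = replication n (p - 1) d 0 div n
      \<and> 1 \<le> unit_count (p - 1) d i u} = c"
    using b by (elim conjE)
  have b2: "\<forall>i\<in>{1..t}. \<forall>u\<in>{1..n}. unit_count (p - 1) ?d i u \<le> 1" using b by (elim conjE)
  show "unit_count (p - 1) d i u \<le> 1" if "i \<in> {1..t}" "u \<in> {1..n}" for i u
    using bspec[OF bspec[OF b2 that(1)] that(2)] unfolding restrict_counts(1)[OF order_refl that(2)] .
  have b4: "\<forall>u\<in>{1..n}. unit_count (p - 1) ?d 0 u = replication n (p - 1) d 0 div n
      \<or> unit_count (p - 1) ?d 0 u = replication n (p - 1) d 0 div n + 1" using b by (elim conjE)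
  show "unit_count (p - 1) d 0 u = replication n (p - 1) d 0 div n
      \<or> unit_count (p - 1) d 0 u = replication n (p - 1) d 0 div n + 1" if "u \<in> {1..n}" for u
    using bspec[OF b4 that] unfolding restrict_counts(1)[OF order_refl that] .
qed

text \<open>
  The sums of squares are minimal because the counts are balanced. The mixed sum is then minimal as
  well, being determined by the other two and \<open>r\<close>.
\<close>

lemma balanced_attains_mins:
  "A_min t n p (replication n p d 0) = unit_inner n p p d"
  "B_min t n p (replication n p d 0) = unit_inner n p (p - 1) d"
  "C_min t n p (replication n p d 0) = unit_inner n (p - 1) (p - 1) d"
proof -
  have n0: "0 < n" and p2: "2 \<le> p" and t0: "0 < t" using n1 p3 pt by auto
  let ?D = "designs_with t n p (replication n p d 0)"
  have dD: "d \<in> ?D" unfolding designs_with_def using balanced_Lambda by simp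
  have A: "unit_inner n p p d \<le> unit_inner n p p d'" if "d' \<in> ?D" for d'
    unfolding unit_inner_def
  proof (rule two_valued_minimizes_squares)
    show "(\<Sum>u = 1..n. unit_count p d 0 u) = (\<Sum>u = 1..n. unit_count p d' 0 u)"
      using that unfolding designs_with_def replication_def by simp
  qed (rule balanced_direct_facts(4))
  have C: "unit_inner n (p - 1) (p - 1) d \<le> unit_inner n (p - 1) (p - 1) d'" if "d' \<in> ?D" for d'
    unfolding unit_inner_def
  proof (rule two_valued_minimizes_squares)
    have "real (replication n (p - 1) d 0) = real (replication n (p - 1) d' 0)"
      using that replication_tilde[OF _ n0 p2 t0, of d] replication_tilde[OF _ n0 p2 t0, of d'] balanced_Lambda
      unfolding designs_with_def by simp
    thus "(\<Sum>u = 1..n. unit_count (p - 1) d 0 u) = (\<Sum>u = 1..n. unit_count (p - 1) d' 0 u)"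
      unfolding replication_def by (simp only: of_nat_eq_iff)
  qed (rule balanced_carryover_facts(4))
  have B: "unit_inner n p (p - 1) d \<le> unit_inner n p (p - 1) d'" if d': "d' \<in> ?D" for d'
  proof -
    have "real (unit_inner n p p d) \<le> real (unit_inner n p p d')"
      "real (unit_inner n (p - 1) (p - 1) d) \<le> real (unit_inner n (p - 1) (p - 1) d')"
      using A[OF d'] C[OF d'] by simp_all
    hence "real (unit_inner n p (p - 1) d) \<le> real (unit_inner n p (p - 1) d')"
      using unit_inner_relation[OF _ n0 p2 t0, of d] unit_inner_relation[OF _ n0 p2 t0, of d'] balanced_Lambda d'
      unfolding designs_with_def by simp
    thus ?thesis by simp
  qed
  show "A_min t n p (replication n p d 0) = unit_inner n p p d"
    unfolding mins_eq using A dD finite_designs_with by (intro Min_eqI) auto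
  show "B_min t n p (replication n p d 0) = unit_inner n p (p - 1) d"
    unfolding mins_eq using B dD finite_designs_with by (intro Min_eqI) auto
  show "C_min t n p (replication n p d 0) = unit_inner n (p - 1) (p - 1) d"
    unfolding mins_eq using C dD finite_designs_with by (intro Min_eqI) auto
qed

lemma balanced_period_count:
  assumes "i \<in> {1..t}" "k < p"
  shows "real (period_count n d i (Suc k)) = (real n * real p - real (replication n p d 0)) / (real t * real p)"
  using tb assms unfolding totally_balanced_def proportional_periods_def by auto

lemma unit_sums_diagonal:
  assumes "i \<in> {1..t}"
  shows "(\<Sum>u = 1..n. real (unit_count p d i u) * real (unit_count p d i u)) = real (replication n p d i)"
    and "(\<Sum>u = 1..n. real (unit_count p d i u) * real (unit_count (p - 1) d i u)) = real (replication n (p - 1) d i)"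
    and "(\<Sum>u = 1..n. real (unit_count (p - 1) d i u) * real (unit_count (p - 1) d i u)) = real (replication n (p - 1) d i)"
  proof -
  have unit: "real (unit_count p d i u) * real (unit_count p d i u) = real (unit_count p d i u)"
    "real (unit_count p d i u) * real (unit_count (p - 1) d i u) = real (unit_count (p - 1) d i u)"
    "real (unit_count (p - 1) d i u) * real (unit_count (p - 1) d i u) = real (unit_count (p - 1) d i u)"
    if u: "u \<in> {1..n}" for u
  proof -
    have "unit_count (p - 1) d i u \<le> unit_count p d i u" unfolding unit_count_def by (intro card_mono) auto
    moreover have "unit_count p d i u = 0 \<or> unit_count p d i u = 1"
      "unit_count (p - 1) d i u = 0 \<or> unit_count (p - 1) d i u = 1"
      using balanced_direct_facts(2)[OF assms u] balanced_carryover_facts(2)[OF assms u] by auto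
    ultimately show "real (unit_count p d i u) * real (unit_count p d i u) = real (unit_count p d i u)"
      "real (unit_count p d i u) * real (unit_count (p - 1) d i u) = real (unit_count (p - 1) d i u)"
      "real (unit_count (p - 1) d i u) * real (unit_count (p - 1) d i u) = real (unit_count (p - 1) d i u)"
      by auto
  qed
  show "(\<Sum>u = 1..n. real (unit_count p d i u) * real (unit_count p d i u)) = real (replication n p d i)"
    "(\<Sum>u = 1..n. real (unit_count p d i u) * real (unit_count (p - 1) d i u)) = real (replication n (p - 1) d i)"
    "(\<Sum>u = 1..n. real (unit_count (p - 1) d i u) * real (unit_count (p - 1) d i u)) = real (replication n (p - 1) d i)"
    unfolding replication_def of_nat_sum by (intro sum.cong refl unit; assumption)+
qed

lemma unit_sums_symmetric:
  "test_symmetric t (\<lambda>i j. \<Sum>u = 1..n. real (unit_count p d i u) * real (unit_count p d j u))"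
  "test_symmetric t (\<lambda>i j. \<Sum>u = 1..n. real (unit_count p d i u) * real (unit_count (p - 1) d j u))"
  "test_symmetric t (\<lambda>i j. \<Sum>u = 1..n. real (unit_count (p - 1) d i u) * real (unit_count (p - 1) d j u))"
proof -
  let ?c = "\<lambda>i u. unit_count p d i u" and ?k = "replication n p d 0 div n"
  let ?c' = "\<lambda>i u. unit_count (p - 1) d i u" and ?k' = "replication n (p - 1) d 0 div n"
  note facts = balanced_direct_facts and facts' = balanced_carryover_facts
  obtain r where r: "\<forall>i\<in>{1..t}. replication n p d i = r" using facts(1) by (elim exE)
  obtain r' where r': "\<forall>i\<in>{1..t}. replication n (p - 1) d i = r'" using facts'(1) by (elim exE)
  note reps = bspec[OF r, unfolded replication_def] bspec[OF r', unfolded replication_def]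
  have diag: "i \<in> {1..t} \<Longrightarrow> (\<Sum>u = 1..n. real (?c i u) * real (?c i u)) = real r"
    "i \<in> {1..t} \<Longrightarrow> (\<Sum>u = 1..n. real (?c i u) * real (?c' i u)) = real r'"
    "i \<in> {1..t} \<Longrightarrow> (\<Sum>u = 1..n. real (?c' i u) * real (?c' i u)) = real r'" for i
    using unit_sums_diagonal[of i] bspec[OF r, of i] bspec[OF r', of i] by simp_all
  obtain x where x: "\<forall>i\<in>{1..t}. \<forall>j\<in>{1..t}. i \<noteq> j \<longrightarrow> card {u \<in> {1..n}. 1 \<le> ?c i u \<and> 1 \<le> ?c j u} = x"
    using facts(3) by (elim exE)
  obtain y where y: "\<forall>i\<in>{1..t}. card {u \<in> {1..n}. ?c 0 u = ?k \<and> 1 \<le> ?c i u} = y" using facts(5) by (elim exE)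
  show "test_symmetric t (\<lambda>i j. \<Sum>u = 1..n. real (?c i u) * real (?c j u))"
    by (rule test_symmetric_unit_sums[where a = ?c and b = ?c, OF facts(2) facts(2) facts(4) facts(4) reps(1) reps(1) diag(1) x y y])
  obtain x' where x': "\<forall>i\<in>{1..t}. \<forall>j\<in>{1..t}. i \<noteq> j \<longrightarrow> card {u \<in> {1..n}. 1 \<le> ?c' i u \<and> 1 \<le> ?c' j u} = x'"
    using facts'(3) by (elim exE)
  obtain y' where y': "\<forall>i\<in>{1..t}. card {u \<in> {1..n}. ?c' 0 u = ?k' \<and> 1 \<le> ?c' i u} = y'" using facts'(5) by (elim exE)
  show "test_symmetric t (\<lambda>i j. \<Sum>u = 1..n. real (?c' i u) * real (?c' j u))"
    by (rule test_symmetric_unit_sums[where a = ?c' and b = ?c', OF facts'(2) facts'(2) facts'(4) facts'(4) reps(2) reps(2) diag(3) x' y' y'])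
  have "balanced_direct_carryover t n p d" using tb unfolding totally_balanced_def by (elim conjE)
  then obtain a b c where
      a: "\<forall>i\<in>{1..t}. \<forall>j\<in>{1..t}. i \<noteq> j \<longrightarrow> card {u \<in> {1..n}. ?c' j u = 1 \<and> ?c i u = 1} = a"
      and b: "\<forall>i\<in>{1..t}. card {u \<in> {1..n}. ?c' 0 u = ?k' \<and> ?c i u = 1} = b"
      and c: "\<forall>i\<in>{1..t}. card {u \<in> {1..n}. ?c' i u = 1 \<and> ?c 0 u = ?k} = c"
    unfolding balanced_direct_carryover_def by (elim conjE exE)
  have one: "?c i u = 1 \<longleftrightarrow> 1 \<le> ?c i u" "?c' i u = 1 \<longleftrightarrow> 1 \<le> ?c' i u" if "i \<in> {1..t}" "u \<in> {1..n}" for i u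
    using facts(2)[OF that] facts'(2)[OF that] by auto
  have mixed: "\<forall>i\<in>{1..t}. \<forall>j\<in>{1..t}. i \<noteq> j \<longrightarrow> card {u \<in> {1..n}. 1 \<le> ?c i u \<and> 1 \<le> ?c' j u} = a"
  proof (intro ballI impI)
    fix i j assume ij: "i \<in> {1..t}" "j \<in> {1..t}" "i \<noteq> j"
    have "{u \<in> {1..n}. 1 \<le> ?c i u \<and> 1 \<le> ?c' j u} = {u \<in> {1..n}. ?c' j u = 1 \<and> ?c i u = 1}"
      using one(1)[OF ij(1)] one(2)[OF ij(2)] by auto
    thus "card {u \<in> {1..n}. 1 \<le> ?c i u \<and> 1 \<le> ?c' j u} = a" using bspec[OF bspec[OF a ij(1)] ij(2)] ij(3) by simp
  qed
  have control: "\<forall>i\<in>{1..t}. card {u \<in> {1..n}. ?c 0 u = ?k \<and> 1 \<le> ?c' i u} = c"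
  proof
    fix i assume i: "i \<in> {1..t}"
    have "{u \<in> {1..n}. ?c 0 u = ?k \<and> 1 \<le> ?c' i u} = {u \<in> {1..n}. ?c' i u = 1 \<and> ?c 0 u = ?k}"
      using one(2)[OF i] by auto
    thus "card {u \<in> {1..n}. ?c 0 u = ?k \<and> 1 \<le> ?c' i u} = c" using bspec[OF c i] by simp
  qed
  have control': "\<forall>i\<in>{1..t}. card {u \<in> {1..n}. ?c' 0 u = ?k' \<and> 1 \<le> ?c i u} = b"
  proof
    fix i assume i: "i \<in> {1..t}"
    have "{u \<in> {1..n}. ?c' 0 u = ?k' \<and> 1 \<le> ?c i u} = {u \<in> {1..n}. ?c' 0 u = ?k' \<and> ?c i u = 1}"
      using one(1)[OF i] by auto
    thus "card {u \<in> {1..n}. ?c' 0 u = ?k' \<and> 1 \<le> ?c i u} = b" using bspec[OF b i] by simp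
  qed
  show "test_symmetric t (\<lambda>i j. \<Sum>u = 1..n. real (?c i u) * real (?c' j u))"
    by (rule test_symmetric_unit_sums[where a = ?c and b = ?c', OF facts(2) facts'(2) facts(4) facts'(4) reps(1) reps(2)
          diag(2) mixed control control'])
qed

lemma replication_const:
  "i \<in> {1..t} \<Longrightarrow> real (replication n p d i) = (real n * real p - real (replication n p d 0)) / real t"
  "i \<in> {1..t} \<Longrightarrow> real (replication n (p - 1) d i) = (real p - 1) * ((real n * real p - real (replication n p d 0)) / (real t * real p))"
proof -
  have P: "0 < real p" "1 \<le> p" using p3 by auto
  show "real (replication n p d i) = (real n * real p - real (replication n p d 0)) / real t" if "i \<in> {1..t}"
  proof -
    have "real (replication n p d i) = (\<Sum>k<p. real (period_count n d i (Suc k)))"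
      by (rule replication_by_periods)
    also have "\<dots> = (\<Sum>k<p. (real n * real p - real (replication n p d 0)) / (real t * real p))"
      using balanced_period_count[OF that] by (intro sum.cong) auto
    finally show ?thesis using P(1) by simp
  qed
  show "real (replication n (p - 1) d i) = (real p - 1) * ((real n * real p - real (replication n p d 0)) / (real t * real p))"
    if "i \<in> {1..t}"
  proof -
    have "real (replication n (p - 1) d i) = (\<Sum>k<p - 1. (real n * real p - real (replication n p d 0)) / (real t * real p))"
      unfolding replication_by_periods[of n "p - 1" d i] using balanced_period_count[OF that] by (intro sum.cong) auto
    thus ?thesis using P by (simp add: of_nat_diff)
  qed
qed

text \<open>Each part of total balance makes one kind of term in the adjusted products independent of the tests.\<close>

lemma adj_prods_symmetric:
  "test_symmetric t (\<lambda>i j. adj_prod n p (direct_ind d i) (direct_ind d j))"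
  "test_symmetric t (\<lambda>i j. adj_prod n p (direct_ind d i) (carry_ind d j))"
  "test_symmetric t (\<lambda>i j. adj_prod n p (carry_ind d i) (carry_ind d j))"
proof -
  have n0: "0 < n" and p0: "0 < p" using n1 p3 by auto
  define l where "l = (real n * real p - real (replication n p d 0)) / (real t * real p)"
  have pc: "real (period_count n d i (Suc k)) = l" if "i \<in> {1..t}" "k < p" for i k
    unfolding l_def by (rule balanced_period_count[OF that])
  have pc': "(if 0 < k then real (period_count n d i k) else 0) = (if 0 < k then l else 0)" if "i \<in> {1..t}" "k < p" for i k
    using pc[OF that(1), of "k - 1"] that by auto
  have prec: "test_symmetric t (\<lambda>i j. real (preceded_count n p d i j))"
  proof -
    have bp: "balanced_precedence t n p d" using tb unfolding totally_balanced_def by (elim conjE)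
    obtain a b c where
        "\<forall>i\<in>{1..t}. \<forall>j\<in>{1..t}. i \<noteq> j \<longrightarrow> preceded_count n p d i j = a"
        "\<forall>j\<in>{1..t}. preceded_count n p d 0 j = b" "\<forall>i\<in>{1..t}. preceded_count n p d i 0 = c"
        "\<forall>i\<in>{0..t}. preceded_count n p d i i = 0"
      using bp unfolding balanced_precedence_def by (elim conjE exE)
    note a = this(1)[rule_format] and b = this(2)[rule_format] and c = this(3)[rule_format]
      and this(4)[rule_format]
    hence z: "preceded_count n p d i i = 0" if "i \<in> {1..t}" for i using that by simp
    show ?thesis
      by (rule test_symmetricI[of t _ 0 "real c" "real b" "real a"]) (simp_all add: a b c z del: atLeastAtMost_iff One_nat_def)
  qed
  show "test_symmetric t (\<lambda>i j. adj_prod n p (direct_ind d i) (direct_ind d j))"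
  proof -
    have units: "test_symmetric t (\<lambda>i j. \<Sum>u<n. real (unit_count p d i (Suc u)) * real (unit_count p d j (Suc u)))"
      using unit_sums_symmetric(1) unfolding sum_shift_1 .
    have periods: "test_symmetric t (\<lambda>i j. \<Sum>k<p. real (period_count n d i (Suc k)) * real (period_count n d j (Suc k)))"
      by (rule test_symmetric_sum, rule test_symmetric_product[OF pc pc]) auto
    show ?thesis
      unfolding adj_prod_direct_direct[OF n0 p0]
      by (intro test_symmetric_binary[of t _ _ "(+)"] test_symmetric_binary[of t _ _ "(-)"]
          test_symmetric_unary[of t _ "\<lambda>x. x / _"] units periods
          test_symmetric_diagonal[OF replication_const(1)]
          test_symmetric_product[OF replication_const(1) replication_const(1)])
  qed
  show "test_symmetric t (\<lambda>i j. adj_prod n p (direct_ind d i) (carry_ind d j))"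
  proof -
    have units: "test_symmetric t (\<lambda>i j. \<Sum>u<n. real (unit_count p d i (Suc u)) * real (unit_count (p - 1) d j (Suc u)))"
      using unit_sums_symmetric(2) unfolding sum_shift_1 .
    have periods: "test_symmetric t (\<lambda>i j. \<Sum>k<p. real (period_count n d i (Suc k)) * (if 0 < k then real (period_count n d j k) else 0))"
      by (rule test_symmetric_sum, rule test_symmetric_product[OF pc pc']) auto
    show ?thesis
      unfolding adj_prod_direct_carry[OF n0 p0]
      by (intro test_symmetric_binary[of t _ _ "(+)"] test_symmetric_binary[of t _ _ "(-)"]
          test_symmetric_unary[of t _ "\<lambda>x. x / _"] units periods
          prec
          test_symmetric_product[OF replication_const(1) replication_const(2)])
  qed
  show "test_symmetric t (\<lambda>i j. adj_prod n p (carry_ind d i) (carry_ind d j))"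
  proof -
    have units: "test_symmetric t (\<lambda>i j. \<Sum>u<n. real (unit_count (p - 1) d i (Suc u)) * real (unit_count (p - 1) d j (Suc u)))"
      using unit_sums_symmetric(3) unfolding sum_shift_1 .
    have periods: "test_symmetric t (\<lambda>i j. \<Sum>k<p. (if 0 < k then real (period_count n d i k) else 0) * (if 0 < k then real (period_count n d j k) else 0))"
      by (rule test_symmetric_sum, rule test_symmetric_product[OF pc' pc']) auto
    show ?thesis
      unfolding adj_prod_carry_carry[OF n0 p0]
      by (intro test_symmetric_binary[of t _ _ "(+)"] test_symmetric_binary[of t _ _ "(-)"]
          test_symmetric_unary[of t _ "\<lambda>x. x / _"] units periods
          test_symmetric_diagonal[OF replication_const(2)]
          test_symmetric_product[OF replication_const(2) replication_const(2)])
  qed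
qed

end

lemma adj_prod_sums:
  assumes d: "d \<in> designs t n p" and n: "0 < n" and p: "0 < p"
  shows "(\<Sum>j\<le>t. adj_prod n p z (direct_ind d j)) = 0" "(\<Sum>j\<le>t. adj_prod n p z (carry_ind d j)) = 0"
    "(\<Sum>j\<le>t. adj_prod n p (direct_ind d j) z) = 0" "(\<Sum>j\<le>t. adj_prod n p (carry_ind d j) z) = 0"
proof -
  have zero: "adj_prod n p y z = 0" if "\<And>k u. k < p \<Longrightarrow> u < n \<Longrightarrow> y k u = \<alpha> k" for y z and \<alpha> :: "nat \<Rightarrow> real"
  proof -
    have "adj_prod n p y z = adj_prod n p (\<lambda>k u. 0 + \<alpha> k + (\<lambda>_. 0) u) z"
      using that by (intro adj_prod_cong) auto
    also have "\<dots> = 0" unfolding adj_prod_add_effects[OF n p] by (simp add: adj_prod_def)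
    finally show ?thesis .
  qed
  show D: "(\<Sum>j\<le>t. adj_prod n p (direct_ind d j) z) = 0" for z
    unfolding adj_prod_sum_left[OF n p, symmetric] using direct_ind_total[OF d] by (rule zero)
  show F: "(\<Sum>j\<le>t. adj_prod n p (carry_ind d j) z) = 0" for z
    unfolding adj_prod_sum_left[OF n p, symmetric] using carry_ind_total[OF d] by (rule zero)
  show "(\<Sum>j\<le>t. adj_prod n p z (direct_ind d j)) = 0" "(\<Sum>j\<le>t. adj_prod n p z (carry_ind d j)) = 0"
    unfolding adj_prod_commute[OF n p, of z] by (rule D F)+
qed

lemma mat_inverse_compound_symmetric:
  fixes M :: "real mat" and a b :: real
  assumes M: "M \<in> carrier_mat t t" and t: "0 < t" and a: "a \<noteq> 0" and b: "b \<noteq> 0"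
    and entries: "\<And>i j. i < t \<Longrightarrow> j < t \<Longrightarrow> M $$ (i, j) = (if i = j then a else 0) + (b - a) / t"
  shows "\<exists>V. mat_inverse M = Some V \<and> (\<forall>i<t. V $$ (i, i) = 1 / a + (1 / b - 1 / a) / t)"
proof -
  define W where "W = mat t t (\<lambda>(i, j). (if i = j then 1 / a else 0) + (1 / b - 1 / a) / t)"
  have W: "W \<in> carrier_mat t t" unfolding W_def by simp
  have product: "(\<Sum>k<t. ((if i = k then x else 0) + (y - x) / t) * ((if k = j then 1 / x else 0) + (1 / y - 1 / x) / t))
      = (if i = j then 1 else 0)" if "i < t" "j < t" "x \<noteq> 0" "y \<noteq> 0" for i j and x y :: real
  proof -
    have "(\<Sum>k<t. ((if i = k then x else 0) + (y - x) / t) * ((if k = j then 1 / x else 0) + (1 / y - 1 / x) / t))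
        = (\<Sum>k<t. (if k = i then (if i = j then 1 else 0) + x * ((1 / y - 1 / x) / t) else 0)
            + (if k = j then (y - x) / t * (1 / x) else 0) + (y - x) / t * ((1 / y - 1 / x) / t))"
      using that t by (intro sum.cong) (auto simp: field_simps)
    also have "\<dots> = (if i = j then 1 else 0) + x * ((1 / y - 1 / x) / t) + (y - x) / t * (1 / x)
        + t * ((y - x) / t * ((1 / y - 1 / x) / t))"
      using that by (simp add: sum.distrib)
    finally have sum: "(\<Sum>k<t. ((if i = k then x else 0) + (y - x) / t) * ((if k = j then 1 / x else 0) + (1 / y - 1 / x) / t))
        = (if i = j then 1 else 0) + x * ((1 / y - 1 / x) / t) + (y - x) / t * (1 / x)
          + t * ((y - x) / t * ((1 / y - 1 / x) / t))" .
    have "x * ((1 / y - 1 / x) / t) + ((y - x) / t * (1 / x) + t * ((y - x) / t * ((1 / y - 1 / x) / t))) = 0"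
      using that t by (simp add: field_simps)
    thus ?thesis unfolding sum by (simp only: add.assoc add_0_right)
  qed
  have MW: "M * W = 1\<^sub>m t"
  proof (rule eq_matI)
    fix i j assume "i < dim_row (1\<^sub>m t :: real mat)" "j < dim_col (1\<^sub>m t :: real mat)"
    hence ij: "i < t" "j < t" by auto
    have "(M * W) $$ (i, j) = (\<Sum>k<t. M $$ (i, k) * W $$ (k, j))"
      using ij M W by (auto simp: scalar_prod_def atLeast0LessThan intro!: sum.cong)
    also have "\<dots> = (\<Sum>k<t. ((if i = k then a else 0) + (b - a) / t) * ((if k = j then 1 / a else 0) + (1 / b - 1 / a) / t))"
      using ij by (intro sum.cong) (auto simp: entries W_def)
    finally show "(M * W) $$ (i, j) = 1\<^sub>m t $$ (i, j)" using product[OF ij a b] ij by simp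
  qed (use M W in auto)
  have WM: "W * M = 1\<^sub>m t"
  proof (rule eq_matI)
    fix i j assume "i < dim_row (1\<^sub>m t :: real mat)" "j < dim_col (1\<^sub>m t :: real mat)"
    hence ij: "i < t" "j < t" by auto
    have "(W * M) $$ (i, j) = (\<Sum>k<t. W $$ (i, k) * M $$ (k, j))"
      using ij M W by (auto simp: scalar_prod_def atLeast0LessThan intro!: sum.cong)
    also have "\<dots> = (\<Sum>k<t. ((if i = k then 1 / a else 0) + (1 / b - 1 / a) / t)
        * ((if k = j then 1 / (1 / a) else 0) + (1 / (1 / b) - 1 / (1 / a)) / t))"
      using ij by (intro sum.cong) (auto simp: entries W_def)
    finally show "(W * M) $$ (i, j) = 1\<^sub>m t $$ (i, j)" using product[OF ij, of "1 / a" "1 / b"] a b ij by simp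
  qed (use M W in auto)
  have "M \<in> Units (ring_mat TYPE(real) t ())"
    unfolding Units_def ring_mat_def using M W MW WM by auto
  then obtain V where V: "mat_inverse M = Some V" using mat_inverse(1)[OF M, where b = "()"] by (cases "mat_inverse M") auto
  have "M * V = 1\<^sub>m t" "V \<in> carrier_mat t t" using mat_inverse(2)[OF M V] by auto
  hence "V = W"
    using assoc_mult_mat[OF W M, of V t] WM W by simp
  thus ?thesis using V W_def by simp
qed

context
  fixes t n p :: nat and d :: design
  assumes tb: "totally_balanced t n p d" and p3: "3 \<le> p" and pt: "p \<le> t + 1" and n1: "1 \<le> n"
    and rR: "replication n p d 0 \<in> R_set t n p"
begin

text \<open>
  The fits by \<open>c\<close> and \<open>e\<close> that gave the upper bounds satisfy the normal equations here: by symmetry the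
  products of a residual with the carryover indicators are all multiples of a single number, which
  vanishes by the choice of the coefficient. They yield the entries in the control column and the
  differences within a row; the zero row sums fix the rest. The eigenvalue of the matrix on test
  contrasts is \<open>l1\<close>, and \<open>l0\<close> is the one on the constant vector.
\<close>

lemma balanced_info_entries:
  defines "l1 \<equiv> x1 t n p (replication n p d 0) / (real p * real t * (real t - 1))"
    and "l0 \<equiv> y1 t n p (replication n p d 0) / (real p * real t)"
  assumes ij: "i \<in> {1..t}" "j \<in> {1..t}"
  shows "info_mat t n p d $$ (i, j) = (if i = j then l1 else 0) + (l0 - l1) / real t"
proof -
  have n0: "0 < n" and p2: "2 \<le> p" and p0: "0 < p" and t0: "0 < t" using n1 p3 pt by auto
  have t2: "2 \<le> t" using p3 pt by simp
  have T: "1 < real t" "0 < real t" using t2 by auto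
  have P: "1 < real p" "0 < real p" and N: "0 < real n" using p3 n0 by auto
  have dL: "d \<in> Lambda_class t n p" by (rule balanced_Lambda[OF tb p3 pt n1])
  have dD: "d \<in> designs t n p" by (rule Lambda_designs[OF dL n0 p2 t0])
  note mins = balanced_attains_mins[OF tb p3 pt n1]
  define r where "r = replication n p d 0"
  define rt where "rt = (real p - 1) / real p * real r"
  have rt_eq: "real (replication n (p - 1) d 0) = rt"
    unfolding rt_def r_def by (rule replication_tilde[OF dL n0 p2 t0])
  let ?T = "direct_ind d" and ?F = "carry_ind d" and ?C = "info_mat t n p d"
  define K11 where "K11 = (\<lambda>i j. adj_prod n p (?T i) (?T j))"
  define K12 where "K12 = (\<lambda>i j. adj_prod n p (?T i) (?F j))"
  define K22 where "K22 = (\<lambda>i j. adj_prod n p (?F i) (?F j))"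
  have sym: "test_symmetric t K11" "test_symmetric t K12" "test_symmetric t K22"
    unfolding K11_def K12_def K22_def by (rule adj_prods_symmetric[OF tb p3 pt n1])+
  have K21: "adj_prod n p (?F i) (?T j) = K12 j i" for i j
    unfolding K12_def by (rule adj_prod_commute[OF n0 p0])
  note sums = adj_prod_sums[OF dD n0 p0]
  have E11: "k \<in> {1..t} \<Longrightarrow> real t * K11 k 0 = - K11 0 0"
    "k \<in> {1..t} \<Longrightarrow> l \<in> {1..t} \<Longrightarrow> k \<noteq> l \<Longrightarrow> real t * (real t - 1) * (K11 k k - K11 k l) = (real t)\<^sup>2 * K11 k k - K11 0 0" for k l
    using test_symmetric_entries[OF sym(1) t0] sums unfolding K11_def by blast+
  have E12: "k \<in> {1..t} \<Longrightarrow> real t * K12 k 0 = - K12 0 0" "k \<in> {1..t} \<Longrightarrow> real t * K12 0 k = - K12 0 0"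
    "k \<in> {1..t} \<Longrightarrow> l \<in> {1..t} \<Longrightarrow> k \<noteq> l \<Longrightarrow> real t * (real t - 1) * (K12 k k - K12 k l) = (real t)\<^sup>2 * K12 k k - K12 0 0" for k l
    using test_symmetric_entries[OF sym(2) t0] sums unfolding K12_def by blast+
  have E22: "k \<in> {1..t} \<Longrightarrow> real t * K22 k 0 = - K22 0 0"
    "k \<in> {1..t} \<Longrightarrow> l \<in> {1..t} \<Longrightarrow> k \<noteq> l \<Longrightarrow> real t * (real t - 1) * (K22 k k - K22 k l) = (real t)\<^sup>2 * K22 k k - K22 0 0" for k l
    using test_symmetric_entries[OF sym(3) t0] sums unfolding K22_def by blast+
  define A B C where "A = real (unit_inner n p p d)" and "B = real (unit_inner n p (p - 1) d)"
    and "C = real (unit_inner n (p - 1) (p - 1) d)"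
  define S u v w X Y where "S = S_par (real n) (real p) rt" and "u = real t * S - B"
    and "v = v_par (real n) (real p) (real t) rt C" and "w = w_par (real n) (real p) rt C"
    and "X = X_par (real n) (real p) (real t) (real r) A" and "Y = real p * real r - A"
  have K00: "real p * K11 0 0 = Y" "real p * K12 0 0 = - B" "real p * K22 0 0 = w"
    using adj_control_direct[OF dL n0 p2 t0] adj_control_cross[OF dL n0 p2 t0] adj_control_carry[OF dL n0 p2 t0]
    unfolding K11_def K12_def K22_def Y_def B_def w_def A_def C_def rt_eq r_def by simp_all
  have pos: "0 < v" "0 < w"
    using criterion_positive(2,3)[OF p3 pt n1 rR[folded r_def]]
    unfolding v_def w_def C_def rt_def mins[folded r_def] by simp_all
  have x1_eq: "x1 t n p r = X - u\<^sup>2 / v" and y1_eq: "y1 t n p r = Y - B\<^sup>2 / w"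
    using x1_y1_eq[OF p2 n0, of t r]
    unfolding mins[folded r_def] X_def u_def v_def Y_def B_def w_def A_def C_def S_def rt_def by simp_all

  define e where "e = B / w"
  have column0: "?C $$ (k, 0) = K11 k 0 + e * K12 k 0" if k: "k \<le> t" for k
  proof -
    define y where "y = (\<lambda>k u. 1 * ?T 0 k u + e * ?F 0 k u)"
    have K0: "K12 0 k + e * K22 k 0 = 0" if "k \<le> t" for k
    proof (cases "k = 0")
      case True
      have "real p * (K12 0 0 + e * K22 0 0) = - B + e * w"
        unfolding distrib_left mult.left_commute[of "real p" e] K00 ..
      thus ?thesis using True pos P unfolding e_def by simp
    next
      case False
      hence k: "k \<in> {1..t}" using that by simp
      have "real p * (real t * (K12 0 k + e * K22 k 0)) = real p * (real t * K12 0 k) + e * (real p * (real t * K22 k 0))"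
        by (simp add: algebra_simps)
      also have "\<dots> = - (real p * K12 0 0) - e * (real p * K22 0 0)" using E12(2)[OF k] E22(1)[OF k] by simp
      also have "\<dots> = 0" unfolding K00 e_def using pos by simp
      finally show ?thesis using P T by simp
    qed
    have "(\<Sum>j\<le>t. ?C $$ (k, j) * control j) = adj_prod n p (?T k) y"
    proof (rule info_mat_via_adj_prod[OF n0 p0 _ _ k])
      show "y k u = direct_comb t d control k u + carry_comb t d (\<lambda>j. e * control j) k u" for k u
        unfolding direct_comb_def carry_comb_def sum_atMost_split by (simp add: y_def control_def)
      show "adj_prod n p (?F k) y = 0" if "k \<le> t" for k
        unfolding y_def adj_prod_combine_right[OF n0 p0] K21 using K0[OF that] by (simp add: K22_def)
    qed
    also have "\<dots> = K11 k 0 + e * K12 k 0"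
      unfolding y_def adj_prod_combine_right[OF n0 p0] K11_def K12_def by simp
    finally show ?thesis unfolding sum_atMost_split by (simp add: control_def)
  qed
  have Ci0: "?C $$ (k, 0) = - l0" if k: "k \<in> {1..t}" for k
  proof -
    have "real p * (real t * ?C $$ (k, 0)) = real p * (real t * K11 k 0) + e * (real p * (real t * K12 k 0))"
      using k by (subst column0) (auto simp: algebra_simps)
    also have "\<dots> = - (real p * K11 0 0) - e * (real p * K12 0 0)" using E11(1)[OF k] E12(1)[OF k] by simp
    also have "\<dots> = - y1 t n p r" unfolding K00 y1_eq e_def by (simp add: power2_eq_square)
    finally have "?C $$ (k, 0) = - y1 t n p r / (real p * real t)" using P T by (simp add: field_simps)
    thus ?thesis unfolding l0_def r_def by simp
  qed

  define l where "l = (real n * real p - real r) / (real t * real p)"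
  have S_l: "S = real t * ((real p - 1) * l)"
    unfolding S_def l_def rt_def using P T by (simp add: field_simps)
  have reps: "real (replication n p d k) = real p * l" "real (replication n (p - 1) d k) = (real p - 1) * l"
    if "k \<in> {1..t}" for k
    using replication_const[OF tb p3 pt n1 that] P unfolding l_def r_def by simp_all
  have per: "real (period_count n d k (Suc q)) = l" if "k \<in> {1..t}" "q < p" for k q
    using balanced_period_count[OF tb p3 pt n1 that] unfolding l_def r_def .
  have per': "(if 0 < q then real (period_count n d k q) else 0) = (if 0 < q then l else 0)" if "k \<in> {1..t}" "q < p" for k q
    using per[OF that(1), of "q - 1"] that by auto
  have D11: "real p * (real t * (real t - 1) * (K11 k k - K11 k m)) = X"
    if k: "k \<in> {1..t}" and m: "m \<in> {1..t}" "k \<noteq> m" for k m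
  proof -
    have squares: "(\<Sum>u<n. real (unit_count p d k (Suc u)) * real (unit_count p d k (Suc u))) = real p * l"
      using unit_sums_diagonal(1)[OF tb p3 pt n1 k] unfolding sum_shift_1 reps(1)[OF k] .
    have "(\<Sum>q<p. real (period_count n d k (Suc q)) * real (period_count n d k (Suc q))) = (\<Sum>q<p. l * l)"
      using per[OF k] by (intro sum.cong) auto
    hence "K11 k k = real p * l - real p * (l * l) / n - real p * l / p + (real p * l) * (real p * l) / (real n * real p)"
      unfolding K11_def by (subst adj_prod_direct_direct[OF n0 p0]) (simp add: squares reps(1)[OF k])
    hence "real n * K11 k k = real n * ((real p - 1) * l)" using P N by (simp add: field_simps)
    hence "K11 k k = (real p - 1) * l" using N by simp
    hence "real p * (real t)\<^sup>2 * K11 k k = real t * (real p - 1) * (real p * (real t * l))"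
      by (simp add: power2_eq_square)
    also have "real p * (real t * l) = real n * real p - real r" unfolding l_def using T P by simp
    finally have "real p * (real t)\<^sup>2 * K11 k k = real t * (real p - 1) * (real n * real p - real r)" .
    moreover have "real p * (real t * (real t - 1) * (K11 k k - K11 k m)) = real p * (real t)\<^sup>2 * K11 k k - real p * K11 0 0"
      unfolding E11(2)[OF k m] by (simp only: right_diff_distrib mult.assoc)
    ultimately show ?thesis unfolding K00 X_def Y_def by simp
  qed
  have D12: "real p * (real t * (real t - 1) * (K12 k k - K12 k m)) = - u"
    if k: "k \<in> {1..t}" and m: "m \<in> {1..t}" "k \<noteq> m" for k m
  proof -
    have units: "(\<Sum>u<n. real (unit_count p d k (Suc u)) * real (unit_count (p - 1) d k (Suc u))) = (real p - 1) * l"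
      using unit_sums_diagonal(2)[OF tb p3 pt n1 k] unfolding sum_shift_1 reps(2)[OF k] .
    have "(\<Sum>q<p. real (period_count n d k (Suc q)) * (if 0 < q then real (period_count n d k q) else 0))
        = (\<Sum>q<p. if 0 < q then l * l else 0)"
      using per[OF k] per'[OF k] by (intro sum.cong) auto
    also have "\<dots> = (real p - 1) * (l * l)" by (rule sum_if_pos[OF dL n0 p2 t0])
    finally have K: "K12 k k = - ((real p - 1) * (l * l) / n) - (real p - 1) * l / p
        + (real p * l) * ((real p - 1) * l) / (real n * real p)"
      unfolding K12_def using Lambda_preceded[OF dL n0 p2 t0, of k] k
      by (subst adj_prod_direct_carry[OF n0 p0]) (simp add: units reps[OF k] del: One_nat_def)
    have "real p * K12 k k = - ((real p - 1) * l)"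
      unfolding K using P N by (simp add: field_simps)
    hence "(real t)\<^sup>2 * (real p * K12 k k) = - (real t * S)" unfolding S_l by (simp add: power2_eq_square)
    hence "real p * (real t)\<^sup>2 * K12 k k = - (real t * S)" by (simp only: mult.assoc mult.left_commute)
    moreover have "real p * (real t * (real t - 1) * (K12 k k - K12 k m)) = real p * (real t)\<^sup>2 * K12 k k - real p * K12 0 0"
      unfolding E12(3)[OF k m] by (simp only: right_diff_distrib mult.assoc)
    ultimately show ?thesis unfolding K00 u_def by simp
  qed
  have D22: "real p * (real t * (real t - 1) * (K22 k k - K22 k m)) = v"
    if k: "k \<in> {1..t}" and m: "m \<in> {1..t}" "k \<noteq> m" for k m
  proof -
    have squares: "(\<Sum>u<n. real (unit_count (p - 1) d k (Suc u)) * real (unit_count (p - 1) d k (Suc u))) = (real p - 1) * l"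
      using unit_sums_diagonal(3)[OF tb p3 pt n1 k] unfolding sum_shift_1 reps(2)[OF k] .
    have "(\<Sum>q<p. (if 0 < q then real (period_count n d k q) else 0) * (if 0 < q then real (period_count n d k q) else 0))
        = (\<Sum>q<p. if 0 < q then l * l else 0)"
      using per'[OF k] by (intro sum.cong) auto
    also have "\<dots> = (real p - 1) * (l * l)" by (rule sum_if_pos[OF dL n0 p2 t0])
    finally have K: "K22 k k = (real p - 1) * l - (real p - 1) * (l * l) / n - (real p - 1) * l / p
        + ((real p - 1) * l) * ((real p - 1) * l) / (real n * real p)"
      unfolding K22_def
      by (subst adj_prod_carry_carry[OF n0 p0]) (simp add: squares reps[OF k] del: One_nat_def)
    have pK: "real p * K22 k k = (real p - 1) * ((real p - 1) * l) - (real p - 1) * (l * l) / n"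
      unfolding K using P N by (simp add: field_simps)
    have "real p * (real t)\<^sup>2 * K22 k k = (real t)\<^sup>2 * (real p * K22 k k)" by simp
    also have "\<dots> = (real t)\<^sup>2 * ((real p - 1) * ((real p - 1) * l) - (real p - 1) * (l * l) / n)"
      unfolding pK ..
    also have "\<dots> = real t * (real p - 1) * S - (real t * ((real p - 1) * l))\<^sup>2 / (real n * (real p - 1))"
      unfolding S_l using P N by (simp add: power2_eq_square field_simps)
    also have "\<dots> = real t * (real p - 1) * S - S\<^sup>2 / (real n * (real p - 1))" unfolding S_l ..
    also have "S\<^sup>2 / (real n * (real p - 1)) = real n * (real p - 1) - 2 * rt + rt\<^sup>2 / (real n * (real p - 1))"
      unfolding S_def using N P by (simp add: power2_eq_square field_simps)
    finally have "real p * (real t)\<^sup>2 * K22 k k - w = v"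
      unfolding v_def w_def S_def by (simp add: algebra_simps)
    moreover have "real p * (real t * (real t - 1) * (K22 k k - K22 k m)) = real p * (real t)\<^sup>2 * K22 k k - real p * K22 0 0"
      unfolding E22(2)[OF k m] by (simp only: right_diff_distrib mult.assoc)
    ultimately show ?thesis unfolding K00  by simp
  qed

  define c where "c = u / v"
  have diff: "?C $$ (k, k) - ?C $$ (k, m) = l1" if k: "k \<in> {1..t}" and m: "m \<in> {1..t}" "k \<noteq> m" for k m
  proof -
    define g where "g = (\<lambda>j. (if j = k then 1 else 0) - (if j = m then 1 else 0 :: real))"
    have pick: "(\<Sum>j\<le>t. g j * h j) = h k - h m" for h :: "nat \<Rightarrow> real"
    proof -
      have "(\<Sum>j\<le>t. g j * h j) = (\<Sum>j\<le>t. (if j = k then h k else 0) - (if j = m then h m else 0))"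
        by (intro sum.cong) (auto simp: g_def)
      thus ?thesis using k m by (simp add: sum_subtractf)
    qed
    define y where "y = (\<lambda>q w. 1 * (1 * ?T k q w + (- 1) * ?T m q w) + c * (1 * ?F k q w + (- 1) * ?F m q w))"
    have comb: "adj_prod n p z y = (adj_prod n p z (?T k) - adj_prod n p z (?T m))
        + c * (adj_prod n p z (?F k) - adj_prod n p z (?F m))" for z
      unfolding y_def adj_prod_combine_right[OF n0 p0] by simp
    have "real p * (real t * (real t - 1)) * ((K12 k k - K12 k m) + c * (K22 k k - K22 k m))
        = real p * (real t * (real t - 1) * (K12 k k - K12 k m)) + c * (real p * (real t * (real t - 1) * (K22 k k - K22 k m)))"
      by (simp only: distrib_left mult.assoc mult.left_commute[of _ c])
    also have "\<dots> = 0" unfolding D12[OF k m] D22[OF k m] c_def using pos by simp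
    finally have fit: "(K12 k k - K12 k m) + c * (K22 k k - K22 k m) = 0" using P T by simp
    have "(\<Sum>j\<le>t. ?C $$ (k, j) * g j) = adj_prod n p (?T k) y"
    proof (rule info_mat_via_adj_prod[OF n0 p0])
      show "y q w = direct_comb t d g q w + carry_comb t d (\<lambda>j. c * g j) q w" for q w
        unfolding direct_comb_def carry_comb_def mult.assoc sum_distrib_left[symmetric] pick by (simp add: y_def)
      show "adj_prod n p (?F q) y = 0" if "q \<le> t" for q
      proof -
        have "adj_prod n p (?F q) y = (K12 k q - K12 m q) + c * (K22 q k - K22 q m)"
          unfolding comb K21 K22_def ..
        also have "\<dots> = ((if q = k then 1 else 0) - (if q = m then 1 else 0))
            * ((K12 k k - K12 k m) + c * (K22 k k - K22 k m))"
          unfolding test_symmetric_column_diff(2)[OF sym(2) k m that] test_symmetric_column_diff(1)[OF sym(3) k m that]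
          by (simp only: distrib_left mult.left_commute[of _ c])
        finally show ?thesis unfolding fit by simp
      qed
    qed (use k in auto)
    hence "?C $$ (k, k) - ?C $$ (k, m) = (K11 k k - K11 k m) + c * (K12 k k - K12 k m)"
      unfolding comb K11_def K12_def using pick[of "\<lambda>j. ?C $$ (k, j)"] by (simp add: mult.commute)
    hence "real p * (real t * (real t - 1)) * (?C $$ (k, k) - ?C $$ (k, m))
        = real p * (real t * (real t - 1) * (K11 k k - K11 k m)) + c * (real p * (real t * (real t - 1) * (K12 k k - K12 k m)))"
      by (simp only: distrib_left mult.assoc mult.left_commute[of _ c])
    also have "\<dots> = x1 t n p r" unfolding D11[OF k m] D12[OF k m] c_def x1_eq by (simp add: power2_eq_square)
    finally show ?thesis unfolding l1_def r_def using P T by (simp add: field_simps)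
  qed
  have diag: "?C $$ (k, k) = l1 + (l0 - l1) / real t" if k: "k \<in> {1..t}" for k
  proof -
    have "0 = ?C $$ (k, 0) + (\<Sum>j = 1..t. ?C $$ (k, j))"
      using info_mat_row_sum[OF dD n0 p0, of k] k unfolding sum_atMost_split by simp
    also have "(\<Sum>j = 1..t. ?C $$ (k, j)) = (\<Sum>j = 1..t. (?C $$ (k, k) - l1) + (if j = k then l1 else 0))"
    proof (rule sum.cong[OF refl])
      fix j assume "j \<in> {1..t}"
      thus "?C $$ (k, j) = (?C $$ (k, k) - l1) + (if j = k then l1 else 0)" using diff[OF k, of j] by auto
    qed
    also have "\<dots> = real t * (?C $$ (k, k) - l1) + l1" using k by (simp add: sum.distrib)
    finally have "real t * (?C $$ (k, k) - l1) = l0 - l1" unfolding Ci0[OF k] by simp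
    thus ?thesis using T by (simp add: field_simps)
  qed
  show ?thesis
  proof (cases "i = j")
    case False
    thus ?thesis using diff[OF ij False] diag[OF ij(1)] by simp
  qed (use diag ij in simp)
qed

end

lemma balanced_inverse:
  assumes tb: "totally_balanced t n p d" and p3: "3 \<le> p" and pt: "p \<le> t + 1" and n1: "1 \<le> n"
    and rR: "replication n p d 0 \<in> R_set t n p" and y: "0 < y1 t n p (replication n p d 0)"
  shows "\<exists>V. mat_inverse (control_info_mat t n p d) = Some V \<and>
    (\<forall>i<t. V $$ (i, i) = (real t * (real t - 1)\<^sup>2 * real p / x1 t n p (replication n p d 0)
        + real t * real p / y1 t n p (replication n p d 0)) / real t)"
proof -
  define r where "r = replication n p d 0"
  define l1 where "l1 = x1 t n p r / (real p * real t * (real t - 1))"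
  define l0 where "l0 = y1 t n p r / (real p * real t)"
  have t2: "2 \<le> t" and t0: "0 < t" using p3 pt by simp_all
  have T: "1 < real t" and P: "0 < real p" using t2 p3 by auto
  have x: "0 < x1 t n p r" unfolding r_def by (rule criterion_positive(1)[OF p3 pt n1 rR])
  have l: "l1 \<noteq> 0" "l0 \<noteq> 0" unfolding l1_def l0_def using x y T P by (auto simp: r_def)
  have "control_info_mat t n p d $$ (i, j) = (if i = j then l1 else 0) + (l0 - l1) / real t"
    if "i < t" "j < t" for i j
    using control_info_mat_index[of "Suc i" t "Suc j" n p d] that
      balanced_info_entries[OF tb p3 pt n1 rR, of "Suc i" "Suc j"]
    unfolding l1_def l0_def r_def by simp
  then obtain V where V: "mat_inverse (control_info_mat t n p d) = Some V"
    "\<forall>i<t. V $$ (i, i) = 1 / l1 + (1 / l0 - 1 / l1) / real t"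
    using mat_inverse_compound_symmetric[OF control_info_mat_carrier t0 l] by blast
  have "1 / l1 + (1 / l0 - 1 / l1) / real t
      = (real t * (real t - 1)\<^sup>2 * real p / x1 t n p r + real t * real p / y1 t n p r) / real t"
    unfolding l1_def l0_def using x y T P by (simp add: r_def[symmetric] power2_eq_square field_simps)
  thus ?thesis using V unfolding r_def by auto
qed

section \<open>Optimality\<close>

lemma f_crit_eq:
  assumes "0 < x1 t n p r" "0 < y1 t n p r"
  shows "f_crit t n p r = ereal (real t * (real t - 1)\<^sup>2 * real p / x1 t n p r + real t * real p / y1 t n p r)"
  using assms unfolding f_crit_def by simp

lemma f_crit_infinite:
  assumes "0 < x1 t n p r" "y1 t n p r = 0" "0 < t" "0 < p"
  shows "f_crit t n p r = \<infinity>"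
  using assms unfolding f_crit_def by (simp add: divide_ereal_def)

theorem theorem1:
  fixes t n p :: nat and \<sigma> :: real and d :: design
  assumes "3 \<le> p" and "p \<le> t + 1" and "1 \<le> n"
    and "0 < \<sigma>"
    and "totally_balanced t n p d"
    and "replication n p d 0 \<in> R_set t n p"
    and "\<forall>r\<in>R_set t n p. f_crit t n p (replication n p d 0) \<le> f_crit t n p r"
  shows "A_optimal t n p (Lambda_class t n p) d \<and> MV_optimal \<sigma> t n p (Lambda_class t n p) d"
proof -
  note setting = assms(1-3)
  have t0: "0 < t" and p0: "0 < p" using assms(1,2) by auto
  have dL: "d \<in> Lambda_class t n p" by (rule balanced_Lambda[OF assms(5) setting])
  define F where "F = (\<lambda>r. real t * (real t - 1)\<^sup>2 * real p / x1 t n p r + real t * real p / y1 t n p r)"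
  let ?r = "replication n p d 0"
  have x: "0 < x1 t n p r" if "r \<in> R_set t n p" for r by (rule criterion_positive(1)[OF setting that])
  show ?thesis
  proof (cases "0 < y1 t n p ?r")
    case True
    obtain V where V: "mat_inverse (control_info_mat t n p d) = Some V" "\<And>i. i < t \<Longrightarrow> V $$ (i, i) = F ?r / real t"
      using balanced_inverse[OF assms(5) setting assms(6) True] unfolding F_def by auto
    have tr: "trace_inverse t n p d = ereal (F ?r)"
      unfolding trace_inverse_def V(1) using V(2) t0 by simp
    have lower: "F ?r \<le> (\<Sum>i<t. V' $$ (i, i))"
      if d': "d' \<in> Lambda_class t n p" and V': "mat_inverse (control_info_mat t n p d') = Some V'" for d' V'
    proof -
      let ?r' = "replication n p d' 0"
      note R' = inverse_some_imp[OF setting d' V']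
      have "ereal (F ?r) \<le> ereal (F ?r')"
        using assms(7) R'(1) f_crit_eq[OF x[OF assms(6)] True] f_crit_eq[OF x[OF R'(1)] R'(2)]
        unfolding F_def by metis
      also have "F ?r' \<le> (\<Sum>i<t. V' $$ (i, i))"
        unfolding F_def using R' by (intro control_info_le_y1(2)[OF setting d' _ _ V']) (auto simp: R_set_def)
      finally show ?thesis by simp
    qed
    have "trace_inverse t n p d \<le> trace_inverse t n p d'" if "d' \<in> Lambda_class t n p" for d'
      unfolding tr trace_inverse_def[of t n p d'] using lower[OF that] by (auto split: option.split)
    moreover have "max_contrast_variance \<sigma> t n p d \<le> max_contrast_variance \<sigma> t n p d'" if d': "d' \<in> Lambda_class t n p" for d'
    proof -
      have "contrast_variance \<sigma> t n p d ` {1..t} = (\<lambda>_. ereal (\<sigma>\<^sup>2 * (F ?r / real t))) ` {1..t}"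
        unfolding contrast_variance_def V(1) using V(2) by (intro image_cong) auto
      hence "contrast_variance \<sigma> t n p d ` {1..t} = {ereal (\<sigma>\<^sup>2 * (F ?r / real t))}"
        using t0 by (simp add: image_constant_conv)
      hence m: "max_contrast_variance \<sigma> t n p d = ereal (\<sigma>\<^sup>2 * (F ?r / real t))"
        unfolding max_contrast_variance_def by simp
      have "\<exists>i\<in>{1..t}. ereal (\<sigma>\<^sup>2 * (F ?r / real t)) \<le> contrast_variance \<sigma> t n p d' i"
      proof (cases "mat_inverse (control_info_mat t n p d')")
        case None
        thus ?thesis using t0 unfolding contrast_variance_def by (intro bexI[of _ 1]) auto
      next
        case (Some V')
        \<comment> \<open>Some variance is at least the average one.\<close>
        have "\<exists>i<t. F ?r / real t \<le> V' $$ (i, i)"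
        proof (rule ccontr)
          assume "\<not> ?thesis"
          hence "(\<Sum>i<t. V' $$ (i, i)) < (\<Sum>i<t. F ?r / real t)" using t0 by (intro sum_strict_mono) auto
          thus False using lower[OF d' Some] t0 by simp
        qed
        then obtain i where i: "i < t" "F ?r / real t \<le> V' $$ (i, i)" by blast
        have "\<sigma>\<^sup>2 * (F ?r / real t) \<le> \<sigma>\<^sup>2 * V' $$ (i, i)" using i(2) by (rule mult_left_mono) simp
        thus ?thesis unfolding contrast_variance_def Some
          using i(1) by (intro bexI[of _ "Suc i"]) auto
      qed
      then obtain i where i: "i \<in> {1..t}" "ereal (\<sigma>\<^sup>2 * (F ?r / real t)) \<le> contrast_variance \<sigma> t n p d' i" by blast
      have "contrast_variance \<sigma> t n p d' i \<le> max_contrast_variance \<sigma> t n p d'"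
        unfolding max_contrast_variance_def using i(1) by (intro Max_ge) auto
      thus ?thesis unfolding m using i(2) by (rule order_trans[rotated])
    qed
    ultimately show ?thesis unfolding A_optimal_def MV_optimal_def using dL by blast
  next
    case False
    have y0: "y1 t n p r = 0" if r: "r \<in> R_set t n p" for r
    proof (rule ccontr)
      assume "y1 t n p r \<noteq> 0"
      hence "0 < y1 t n p r" using y1_nonneg[OF setting r] by simp
      hence "f_crit t n p r < \<infinity>" using f_crit_eq[OF x[OF r]] by simp
      moreover have "y1 t n p ?r = 0" using False y1_nonneg[OF setting assms(6)] by simp
      hence "f_crit t n p ?r = \<infinity>" by (rule f_crit_infinite[OF x[OF assms(6)] _ t0 p0])
      ultimately show False using assms(7) r by force
    qed
    have singular: "mat_inverse (control_info_mat t n p d') = None" if "d' \<in> Lambda_class t n p" for d'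
      using inverse_some_imp[OF setting that] y0 by (cases "mat_inverse (control_info_mat t n p d')") fastforce+
    have "trace_inverse t n p d' = \<infinity>" if "d' \<in> Lambda_class t n p" for d'
      unfolding trace_inverse_def singular[OF that] by simp
    moreover have "max_contrast_variance \<sigma> t n p d' = \<infinity>" if "d' \<in> Lambda_class t n p" for d'
    proof -
      have "contrast_variance \<sigma> t n p d' ` {1..t} = {\<infinity>}"
        unfolding contrast_variance_def singular[OF that] using t0 by (auto simp: image_constant_conv)
      thus ?thesis unfolding max_contrast_variance_def by simp
    qed
    ultimately show ?thesis unfolding A_optimal_def MV_optimal_def using dL by simp
  qed
qed

end
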